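(* Let $\mathsf{G}$ be an orbifold groupoid (smooth, étale and proper), and let $\mathsf{L}\mathsf{G}^{\mathbb R}$ be the subgroupoid of the loop groupoid $\mathsf{L}\mathsf{G}$ fixed under the natural $\mathbb{R}$-action. Then $\mathsf{L}\mathsf{G}^{\mathbb R}$ is Morita equivalent to the groupoid $Hom(\overline{\mathbb{Z}},\mathsf{G})$ (with the natural topology) whose objects are morphisms $\phi:\overline{\mathbb{Z}}\to\mathsf{G}$ (so $s\phi_1(1)=t\phi_1(1)=\phi_0$, where $\phi_0\in\mathsf{G}_0$ is the image of the unique object of $\overline{\mathbb{Z}}$) and whose arrows $\phi\xrightarrow{\lambda}\psi$ are maps $\lambda:\mathbb{Z}\to\mathsf{G}_1$ with $$\lambda(0)\cdot\psi_1(n)=\phi_1(n)\cdot\lambda(0)=\lambda(n)\quad\text{for all } n\in\mathbb{Z}.$$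
   Context: **Groupoids.** A groupoid $\mathsf{G}$ has objects $\mathsf{G}_0$, arrows $\mathsf{G}_1$, source and target $s,t:\mathsf{G}_1\to\mathsf{G}_0$, composition $m$, inverse $i$, identities $e:\mathsf{G}_0\to\mathsf{G}_1$. Composition is written in diagrammatic order: $a\cdot b$ is defined when $t(a)=s(b)$. It is topological (smooth) if everything is in topological spaces (smooth manifolds, with $s,t$ submersions), étale if $s,t$ are local homeomorphisms (local diffeomorphisms), proper if $(s,t):\mathsf{G}_1\to\mathsf{G}_0\times\mathsf{G}_0$ is proper. For a group $G$, $\overline{G}$ is the groupoid with one object and arrows $G$. A morphism $\Psi:\mathsf{H}\to\mathsf{G}$ is a pair of continuous maps $\Psi_0,\Psi_1$ commuting with the structure maps. It is Morita if the square formed by $\Psi_1$, $\Psi_0\times\Psi_0$ and the two maps $(s,t)$ is cartesian and $s\pi_2:\mathsf{H}_0\,{}_{\Psi_0}\!\times_t\mathsf{G}_1\to\mathsf{G}_0$ is an open surjection. $\mathsf{G},\mathsf{H}$ are Morita equivalent if there are a topological groupoid $\mathsf{K}$ and Morita morphisms $\mathsf{G}\leftarrow\mathsf{K}\to\mathsf{H}$. **Circle groupoids.** For a finite set $q_1<\dots<q_n<q_0$ in $(0,1]$ (identified with points $e^{2\pi i q_k}$ of $S^1$) and $\epsilon>0$, consider the cover of $S^1$ by the (images of the) intervals $V_i=(q_i-\epsilon,q_{i+1}+\epsilon)$, indices cyclic (so $V_0=(q_0-\epsilon,q_1+1+\epsilon)$). It is admissible if all triple intersections of distinct members are empty; $\mathcal{W}$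 is the set of admissible covers. A cover given by $(\{p_k\},\epsilon)$ refines one given by $(\{q_k\},\epsilon')$ if $\epsilon\le\epsilon'$ and $\{q_k\}\subset\{p_k\}$; each set of the finer cover then lies canonically in a set of the coarser. $\mathcal{W}$ is directed under refinement. For $W\in\mathcal{W}$ let $\{W_\beta\}$ be the intervals $V_i+k$ ($k\in\mathbb{Z}$) of $\mathbb{R}$, and $W_\beta^l:=W_\beta+l$. Put $\underline{\mathbb{R}^W}_0=\bigsqcup_\beta W_\beta$, $\underline{\mathbb{R}^W}_1=\bigsqcup_{(\beta,\gamma)}W_\beta\cap W_\gamma$. The groupoid $\mathsf{S}^1_W$ has objects $\underline{\mathbb{R}^W}_0$, arrows $\underline{\mathbb{R}^W}_1\times\mathbb{Z}$, $s((x,W_{\beta\gamma}),l)=(x,W_\beta)$, $t((x,W_{\beta\gamma}),l)=(x+l,W_\gamma^l)$, $e(x,W_\beta)=((x,W_{\beta\beta}),0)$, $((x,W_{\beta\gamma}),l)\cdot((x+l,W^l_{\gamma\sigma}),k)=((x,W_{\beta\sigma}),l+k)$. If $W'$ refines $W$ there is a natural morphism $\rho^{W'}_W:\mathsf{S}^1_{W'}\to\mathsf{S}^1_W$. **Loop groupoid.** $\mathsf{L}\mathsf{G}(W)$ has as objects the morphisms $\mathsf{S}^1_W\to\mathsf{G}$; an arrow from $\Psi$ to $\Phi$ is a continuous $\Lambda:\underline{\mathbb{R}^W}_1\times\mathbb{Z}\to\mathsf{G}_1$ with $s\Lambda(r)=\Psi_0(s(r))$, $t\Lambda(r)=\Phi_0(t(r))$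 and $\Lambda(r)=\Psi_1(r)\cdot\Lambda(et(r))=\Lambda(es(r))\cdot\Phi_1(r)$ for all $r$. Arrows $\Lambda:\Psi\to\Phi$, $\Omega:\Phi\to\Gamma$ compose by $(\Omega\circ\Lambda)(es(r))=\Lambda(es(r))\cdot\Omega(es(r))$, $(\Omega\circ\Lambda)(r)=(\Omega\circ\Lambda)(es(r))\cdot\Gamma_1(r)$. Objects carry the compact-open topology, and arrows the compact-open topology via $\Lambda\mapsto(\Psi_1,\Lambda\circ e)$. Precomposition with $\rho^{W'}_W$ gives monomorphisms $\mathsf{L}\mathsf{G}(W)\hookrightarrow\mathsf{L}\mathsf{G}(W')$, and $\mathsf{L}\mathsf{G}:=\varinjlim_{W\in\mathcal{W}}\mathsf{L}\mathsf{G}(W)$. **$\mathbb{R}$-action.** For $z\in\mathbb{R}$ let $W^z=\{V+z\}$ be the shifted cover; $z$ sends $\Psi:\mathsf{S}^1_W\to\mathsf{G}$ to $\Psi^z:\mathsf{S}^1_{W^z}\to\mathsf{G}$, $\Psi^z_1((x,V^z_{\alpha\beta}),l)=\Psi_1((x-z,V_{\alpha\beta}),l)$, $\Psi_0^z(x,V_\alpha^z)=\Psi_0(x-z,V_\alpha)$, and acts on arrows in the same way. The natural topology on $Hom(\overline{\mathbb{Z}},\mathsf{G})$ is the one induced from the mapping spaces into $\mathsf{G}_1$; composition of arrows is $\lambda(0)\cdot\lambda'(0)$ at $0$. *)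

theory Defs
  imports "HOL-Analysis.Analysis"
begin

section \<open>Topological groupoids\<close>

text \<open>Only the values of the structure maps on \<open>topspace\<close> (for \<open>mul\<close>: on composable pairs) matter.
  \<open>mul a b\<close> is the composite in diagrammatic order.\<close>

record ('o, 'a) top_groupoid =
  Ob :: "'o topology"
  Ar :: "'a topology"
  src :: "'a \<Rightarrow> 'o"
  tgt :: "'a \<Rightarrow> 'o"
  ide :: "'o \<Rightarrow> 'a"
  ginv :: "'a \<Rightarrow> 'a"
  mul :: "'a \<Rightarrow> 'a \<Rightarrow> 'a"

definition composable :: "('o, 'a) top_groupoid \<Rightarrow> ('a \<times> 'a) set" where
  "composable G = {(a, b). a \<in> topspace (Ar G) \<and> b \<in> topspace (Ar G) \<and> tgt G a = src G b}"

definition topological_groupoid :: "('o, 'a) top_groupoid \<Rightarrow> bool" where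
  "topological_groupoid G \<longleftrightarrow>
     continuous_map (Ar G) (Ob G) (src G) \<and>
     continuous_map (Ar G) (Ob G) (tgt G) \<and>
     continuous_map (Ob G) (Ar G) (ide G) \<and>
     continuous_map (Ar G) (Ar G) (ginv G) \<and>
     continuous_map (subtopology (prod_topology (Ar G) (Ar G)) (composable G)) (Ar G)
       (\<lambda>(a, b). mul G a b) \<and>
     (\<forall>x\<in>topspace (Ob G). src G (ide G x) = x \<and> tgt G (ide G x) = x) \<and>
     (\<forall>(a, b)\<in>composable G. src G (mul G a b) = src G a \<and> tgt G (mul G a b) = tgt G b) \<and>
     (\<forall>a b c. (a, b) \<in> composable G \<longrightarrow> (b, c) \<in> composable G \<longrightarrow>
        mul G (mul G a b) c = mul G a (mul G b c)) \<and>
     (\<forall>a\<in>topspace (Ar G).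
        mul G (ide G (src G a)) a = a \<and> mul G a (ide G (tgt G a)) = a \<and>
        src G (ginv G a) = tgt G a \<and> tgt G (ginv G a) = src G a \<and>
        mul G a (ginv G a) = ide G (src G a) \<and> mul G (ginv G a) a = ide G (tgt G a))"

definition groupoid_morphism ::
    "('p, 'q) top_groupoid \<Rightarrow> ('o, 'a) top_groupoid \<Rightarrow> ('p \<Rightarrow> 'o) \<times> ('q \<Rightarrow> 'a) \<Rightarrow> bool" where
  "groupoid_morphism H G \<Psi> \<longleftrightarrow>
     continuous_map (Ob H) (Ob G) (fst \<Psi>) \<and>
     continuous_map (Ar H) (Ar G) (snd \<Psi>) \<and>
     (\<forall>a\<in>topspace (Ar H).
        src G (snd \<Psi> a) = fst \<Psi> (src H a) \<and>
        tgt G (snd \<Psi> a) = fst \<Psi> (tgt H a) \<and>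
        snd \<Psi> (ginv H a) = ginv G (snd \<Psi> a)) \<and>
     (\<forall>x\<in>topspace (Ob H). snd \<Psi> (ide H x) = ide G (fst \<Psi> x)) \<and>
     (\<forall>(a, b)\<in>composable H. snd \<Psi> (mul H a b) = mul G (snd \<Psi> a) (snd \<Psi> b))"

text \<open>The square with top edge \<open>p\<close>, left edge \<open>q\<close>, right edge \<open>f\<close> and bottom edge \<open>g\<close>
  is a pullback of spaces.\<close>

definition cartesian_square ::
    "'x topology \<Rightarrow> 'y topology \<Rightarrow> 'z topology \<Rightarrow>
     ('x \<Rightarrow> 'y) \<Rightarrow> ('x \<Rightarrow> 'z) \<Rightarrow> ('y \<Rightarrow> 'w) \<Rightarrow> ('z \<Rightarrow> 'w) \<Rightarrow> bool" where
  "cartesian_square X Y Z p q f g \<longleftrightarrow>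
     homeomorphic_map X (subtopology (prod_topology Y Z) {(y, z). f y = g z}) (\<lambda>x. (p x, q x))"

definition Morita_morphism ::
    "('p, 'q) top_groupoid \<Rightarrow> ('o, 'a) top_groupoid \<Rightarrow> ('p \<Rightarrow> 'o) \<times> ('q \<Rightarrow> 'a) \<Rightarrow> bool" where
  "Morita_morphism H G \<Psi> \<longleftrightarrow>
     groupoid_morphism H G \<Psi> \<and>
     cartesian_square (Ar H) (Ar G) (prod_topology (Ob H) (Ob H))
       (snd \<Psi>) (\<lambda>h. (src H h, tgt H h))
       (\<lambda>a. (src G a, tgt G a)) (\<lambda>(x, y). (fst \<Psi> x, fst \<Psi> y)) \<and>
     (let F = subtopology (prod_topology (Ob H) (Ar G)) {(x, a). fst \<Psi> x = tgt G a}
      in open_map F (Ob G) (\<lambda>(x, a). src G a) \<and>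
         (\<lambda>(x, a). src G a) ` topspace F = topspace (Ob G))"

text \<open>The types of the middle groupoid \<open>K\<close> have to be fixed, since HOL has no quantifier over types.
  They are those of the action groupoid of a bibundle \<open>P\<close>: the fibres of \<open>P\<close> over \<open>G\<close>-objects
  are torsors under \<open>H\<close>, so \<open>P\<close> embeds as a set into \<open>'o \<times> 'b\<close>, and the arrows are
  triples of an arrow of \<open>G\<close>, a point of \<open>P\<close> and an arrow of \<open>H\<close>.\<close>

definition Morita_equivalent ::
    "('o, 'a) top_groupoid \<Rightarrow> ('p, 'b) top_groupoid \<Rightarrow> bool" where
  "Morita_equivalent G H \<longleftrightarrow>
     topological_groupoid G \<and> topological_groupoid H \<and>
     (\<exists>(K :: ('o \<times> 'b, 'a \<times> ('o \<times> 'b) \<times> 'b) top_groupoid) \<Psi> \<Phi>.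
        topological_groupoid K \<and> Morita_morphism K G \<Psi> \<and> Morita_morphism K H \<Phi>)"

definition restrict_groupoid ::
    "('o, 'a) top_groupoid \<Rightarrow> 'o set \<Rightarrow> 'a set \<Rightarrow> ('o, 'a) top_groupoid" where
  "restrict_groupoid G S T = G\<lparr>Ob := subtopology (Ob G) S, Ar := subtopology (Ar G) T\<rparr>"


section \<open>Smooth manifolds\<close>

text \<open>The library's \<open>Euclidean_space n\<close> consists of the sequences vanishing from index \<open>n\<close> on.
  Unlike the type class \<open>euclidean_space\<close> it includes dimension 0.\<close>

primrec Ck_on :: "nat \<Rightarrow> nat \<Rightarrow> (nat \<Rightarrow> real) set \<Rightarrow> ((nat \<Rightarrow> real) \<Rightarrow> real) \<Rightarrow> bool" where
  "Ck_on 0 n U f \<longleftrightarrow> continuous_map (subtopology (Euclidean_space n) U) euclideanreal f"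
| "Ck_on (Suc k) n U f \<longleftrightarrow>
     continuous_map (subtopology (Euclidean_space n) U) euclideanreal f \<and>
     (\<forall>i<n. \<exists>g. (\<forall>x\<in>U. ((\<lambda>t. f (x(i := t))) has_real_derivative g x) (at (x i))) \<and> Ck_on k n U g)"

definition smooth_between ::
    "nat \<Rightarrow> nat \<Rightarrow> (nat \<Rightarrow> real) set \<Rightarrow> ((nat \<Rightarrow> real) \<Rightarrow> (nat \<Rightarrow> real)) \<Rightarrow> bool" where
  "smooth_between n m U g \<longleftrightarrow> (\<forall>k. \<forall>j<m. Ck_on k n U (\<lambda>x. g x j))"

type_synonym 'a chart = "nat \<times> 'a set \<times> ('a \<Rightarrow> nat \<Rightarrow> real)"

definition is_chart :: "'a topology \<Rightarrow> 'a chart \<Rightarrow> bool" where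
  "is_chart X = (\<lambda>(n, U, \<phi>).
     openin X U \<and> openin (Euclidean_space n) (\<phi> ` U) \<and>
     homeomorphic_map (subtopology X U) (subtopology (Euclidean_space n) (\<phi> ` U)) \<phi>)"

definition smooth_manifold :: "'a topology \<Rightarrow> 'a chart set \<Rightarrow> bool" where
  "smooth_manifold X A \<longleftrightarrow>
     Hausdorff_space X \<and> second_countable X \<and>
     (\<forall>c\<in>A. is_chart X c) \<and> (\<Union>(n, U, \<phi>)\<in>A. U) = topspace X \<and>
     (\<forall>(n, U, \<phi>)\<in>A. \<forall>(m, V, \<psi>)\<in>A.
        smooth_between n m (\<phi> ` (U \<inter> V)) (\<psi> \<circ> inv_into U \<phi>))"

text \<open>Smoothness of a map defined on an open subset \<open>S\<close> of \<open>X\<close>.\<close>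

definition smooth_on_open ::
    "'a topology \<Rightarrow> 'a chart set \<Rightarrow> 'b topology \<Rightarrow> 'b chart set \<Rightarrow> 'a set \<Rightarrow> ('a \<Rightarrow> 'b) \<Rightarrow> bool" where
  "smooth_on_open X A Y B S f \<longleftrightarrow>
     openin X S \<and> continuous_map (subtopology X S) Y f \<and>
     (\<forall>(n, U, \<phi>)\<in>A. \<forall>(m, V, \<psi>)\<in>B.
        smooth_between n m (\<phi> ` {x \<in> U \<inter> S. f x \<in> V}) (\<psi> \<circ> f \<circ> inv_into U \<phi>))"

definition smooth_map ::
    "'a topology \<Rightarrow> 'a chart set \<Rightarrow> 'b topology \<Rightarrow> 'b chart set \<Rightarrow> ('a \<Rightarrow> 'b) \<Rightarrow> bool" where
  "smooth_map X A Y B f \<longleftrightarrow> smooth_on_open X A Y B (topspace X) f"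

text \<open>Smoothness of a map defined on an arbitrary subset \<open>S\<close>, by local extension. If \<open>S\<close> is
  an embedded submanifold, this is smoothness for the induced manifold structure.\<close>

definition smooth_on_subset ::
    "'a topology \<Rightarrow> 'a chart set \<Rightarrow> 'b topology \<Rightarrow> 'b chart set \<Rightarrow> 'a set \<Rightarrow> ('a \<Rightarrow> 'b) \<Rightarrow> bool" where
  "smooth_on_subset X A Y B S f \<longleftrightarrow>
     S \<subseteq> topspace X \<and>
     (\<forall>p\<in>S. \<exists>N g. p \<in> N \<and> smooth_on_open X A Y B N g \<and> (\<forall>x\<in>S \<inter> N. g x = f x))"

definition prod_chart :: "'a chart \<Rightarrow> 'b chart \<Rightarrow> ('a \<times> 'b) chart" where
  "prod_chart = (\<lambda>(n, U, \<phi>) (m, V, \<psi>).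
     (n + m, U \<times> V, \<lambda>(x, y) i. if i < n then \<phi> x i else \<psi> y (i - n)))"

definition prod_atlas :: "'a chart set \<Rightarrow> 'b chart set \<Rightarrow> ('a \<times> 'b) chart set" where
  "prod_atlas A B = {prod_chart c d | c d. c \<in> A \<and> d \<in> B}"

definition partial :: "nat \<Rightarrow> ((nat \<Rightarrow> real) \<Rightarrow> real) \<Rightarrow> (nat \<Rightarrow> real) \<Rightarrow> real" where
  "partial i f x = deriv (\<lambda>t. f (x(i := t))) (x i)"

definition submersion ::
    "'a topology \<Rightarrow> 'a chart set \<Rightarrow> 'b topology \<Rightarrow> 'b chart set \<Rightarrow> ('a \<Rightarrow> 'b) \<Rightarrow> bool" where
  "submersion X A Y B f \<longleftrightarrow>
     smooth_map X A Y B f \<and>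
     (\<forall>(n, U, \<phi>)\<in>A. \<forall>(m, V, \<psi>)\<in>B. \<forall>x\<in>U. f x \<in> V \<longrightarrow>
        (\<forall>w :: nat \<Rightarrow> real. \<exists>v :: nat \<Rightarrow> real. \<forall>j<m.
           (\<Sum>i<n. partial i (\<lambda>y. (\<psi> \<circ> f \<circ> inv_into U \<phi>) y j) (\<phi> x) * v i) = w j))"

definition local_diffeomorphism ::
    "'a topology \<Rightarrow> 'a chart set \<Rightarrow> 'b topology \<Rightarrow> 'b chart set \<Rightarrow> ('a \<Rightarrow> 'b) \<Rightarrow> bool" where
  "local_diffeomorphism X A Y B f \<longleftrightarrow>
     (\<forall>p\<in>topspace X. \<exists>N. p \<in> N \<and> inj_on f N \<and>
        smooth_on_open X A Y B N f \<and> smooth_on_open Y B X A (f ` N) (inv_into N f))"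


section \<open>Orbifold groupoids\<close>

definition smooth_groupoid ::
    "('o, 'a) top_groupoid \<Rightarrow> 'o chart set \<Rightarrow> 'a chart set \<Rightarrow> bool" where
  "smooth_groupoid G A0 A1 \<longleftrightarrow>
     topological_groupoid G \<and>
     smooth_manifold (Ob G) A0 \<and> smooth_manifold (Ar G) A1 \<and>
     submersion (Ar G) A1 (Ob G) A0 (src G) \<and>
     submersion (Ar G) A1 (Ob G) A0 (tgt G) \<and>
     smooth_map (Ob G) A0 (Ar G) A1 (ide G) \<and>
     smooth_map (Ar G) A1 (Ar G) A1 (ginv G) \<and>
     smooth_on_subset (prod_topology (Ar G) (Ar G)) (prod_atlas A1 A1) (Ar G) A1
       (composable G) (\<lambda>(a, b). mul G a b)"

definition etale_groupoid ::
    "('o, 'a) top_groupoid \<Rightarrow> 'o chart set \<Rightarrow> 'a chart set \<Rightarrow> bool" where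
  "etale_groupoid G A0 A1 \<longleftrightarrow>
     local_diffeomorphism (Ar G) A1 (Ob G) A0 (src G) \<and>
     local_diffeomorphism (Ar G) A1 (Ob G) A0 (tgt G)"

definition proper_groupoid :: "('o, 'a) top_groupoid \<Rightarrow> bool" where
  "proper_groupoid G \<longleftrightarrow>
     proper_map (Ar G) (prod_topology (Ob G) (Ob G)) (\<lambda>a. (src G a, tgt G a))"

definition orbifold_groupoid ::
    "('o, 'a) top_groupoid \<Rightarrow> 'o chart set \<Rightarrow> 'a chart set \<Rightarrow> bool" where
  "orbifold_groupoid G A0 A1 \<longleftrightarrow>
     smooth_groupoid G A0 A1 \<and> etale_groupoid G A0 A1 \<and> proper_groupoid G"


section \<open>Circle groupoids\<close>

text \<open>A pair \<open>(Q, \<epsilon>)\<close> stands for the cover given by the points \<open>Q\<close> and the width \<open>\<epsilon>\<close>.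
  The interval of the lifted cover that starts at \<open>b - \<epsilon>\<close>, where \<open>b = q + k\<close> with \<open>q \<in> Q\<close>
  and \<open>k\<close> an integer, has index \<open>b\<close>. Thus \<open>V\<^sub>i + k\<close> has index \<open>q\<^sub>i + k\<close>, and a shift of
  the interval is a shift of its index.\<close>

type_synonym cover = "real set \<times> real"

definition breaks :: "cover \<Rightarrow> real set" where
  "breaks W = {q + of_int k | q k. q \<in> fst W}"

text \<open>For \<open>b = q\<^sub>i\<close> this is \<open>q\<^sub>i\<^sub>+\<^sub>1\<close>, and for \<open>b = q\<^sub>0\<close> it is \<open>q\<^sub>1 + 1\<close>.\<close>

definition next_break :: "cover \<Rightarrow> real \<Rightarrow> real" where
  "next_break W b = Inf {c \<in> breaks W. b < c}"

definition ivl :: "cover \<Rightarrow> real \<Rightarrow> real set" where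
  "ivl W b = {b - snd W <..< next_break W b + snd W}"

definition circle_image :: "real set \<Rightarrow> complex set" where
  "circle_image V = (\<lambda>x. cis (2 * pi * x)) ` V"

definition admissible_covers :: "cover set" where
  "admissible_covers = {W.
     finite (fst W) \<and> fst W \<noteq> {} \<and> fst W \<subseteq> {0<..1} \<and> 0 < snd W \<and>
     (\<forall>a\<in>fst W. \<forall>b\<in>fst W. \<forall>c\<in>fst W. a \<noteq> b \<longrightarrow> b \<noteq> c \<longrightarrow> a \<noteq> c \<longrightarrow>
        circle_image (ivl W a) \<inter> circle_image (ivl W b) \<inter> circle_image (ivl W c) = {})}"

definition refines :: "cover \<Rightarrow> cover \<Rightarrow> bool" where
  "refines W' W \<longleftrightarrow> snd W' \<le> snd W \<and> fst W \<subseteq> fst W'"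

text \<open>Points of the disjoint unions are written with the index first.\<close>

definition circle_groupoid ::
    "cover \<Rightarrow> (real \<times> real, ((real \<times> real) \<times> real) \<times> int) top_groupoid" where
  "circle_groupoid W =
     \<lparr>Ob = sum_topology (\<lambda>b. top_of_set (ivl W b)) (breaks W),
      Ar = prod_topology
             (sum_topology (\<lambda>(b, c). top_of_set (ivl W b \<inter> ivl W c)) (breaks W \<times> breaks W))
             (discrete_topology UNIV),
      src = (\<lambda>(((b, c), x), l). (b, x)),
      tgt = (\<lambda>(((b, c), x), l). (c + of_int l, x + of_int l)),
      ide = (\<lambda>(b, x). (((b, b), x), 0)),
      ginv = (\<lambda>(((b, c), x), l). (((c + of_int l, b + of_int l), x + of_int l), - l)),
      mul = (\<lambda>(((b, c), x), l) (((c', d), y), k). (((b, d - of_int l), x), l + k))\<rparr>"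

text \<open>The interval of the coarser cover that canonically contains the interval \<open>b\<close> of the finer
  one: the last break point of the coarser cover not after \<open>b\<close>.\<close>

definition coarsen :: "cover \<Rightarrow> real \<Rightarrow> real" where
  "coarsen W b = Sup {p \<in> breaks W. p \<le> b}"

definition circle_refine ::
    "cover \<Rightarrow> (real \<times> real \<Rightarrow> real \<times> real)
            \<times> (((real \<times> real) \<times> real) \<times> int \<Rightarrow> ((real \<times> real) \<times> real) \<times> int)" where
  "circle_refine W =
     (\<lambda>(b, x). (coarsen W b, x), \<lambda>(((b, c), x), l). (((coarsen W b, coarsen W c), x), l))"


section \<open>Loop groupoids over a fixed cover\<close>

definition compact_open_topology :: "'x topology \<Rightarrow> 'y topology \<Rightarrow> ('x \<Rightarrow> 'y) topology" where
  "compact_open_topology X Y = topology_generated_by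
     {{f \<in> extensional (topspace X). continuous_map X Y f \<and> f ` K \<subseteq> U} | K U.
        compactin X K \<and> openin Y U}"

text \<open>Maps are made \<open>extensional\<close>, so that equality of functions is equality of maps.\<close>

definition groupoid_morphisms ::
    "('p, 'q) top_groupoid \<Rightarrow> ('o, 'a) top_groupoid \<Rightarrow> (('p \<Rightarrow> 'o) \<times> ('q \<Rightarrow> 'a)) set" where
  "groupoid_morphisms H G = {\<Psi>. groupoid_morphism H G \<Psi> \<and>
     fst \<Psi> \<in> extensional (topspace (Ob H)) \<and> snd \<Psi> \<in> extensional (topspace (Ar H))}"

type_synonym ('o, 'a) loop_obj =
  "(real \<times> real \<Rightarrow> 'o) \<times> (((real \<times> real) \<times> real) \<times> int \<Rightarrow> 'a)"

text \<open>An arrow is stored together with its source and target.\<close>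

type_synonym ('o, 'a) loop_arr =
  "('o, 'a) loop_obj \<times> (((real \<times> real) \<times> real) \<times> int \<Rightarrow> 'a) \<times> ('o, 'a) loop_obj"

definition loop_arrows :: "('o, 'a) top_groupoid \<Rightarrow> cover \<Rightarrow> ('o, 'a) loop_arr set" where
  "loop_arrows G W = (let S = circle_groupoid W in
     {(\<Psi>, \<Lambda>, \<Phi>). \<Psi> \<in> groupoid_morphisms S G \<and> \<Phi> \<in> groupoid_morphisms S G \<and>
        \<Lambda> \<in> extensional (topspace (Ar S)) \<and> continuous_map (Ar S) (Ar G) \<Lambda> \<and>
        (\<forall>r\<in>topspace (Ar S).
           src G (\<Lambda> r) = fst \<Psi> (src S r) \<and> tgt G (\<Lambda> r) = fst \<Phi> (tgt S r) \<and>
           \<Lambda> r = mul G (snd \<Psi> r) (\<Lambda> (ide S (tgt S r))) \<and>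
           \<Lambda> r = mul G (\<Lambda> (ide S (src S r))) (snd \<Phi> r))})"

definition loop_groupoid_at ::
    "('o, 'a) top_groupoid \<Rightarrow> cover \<Rightarrow> (('o, 'a) loop_obj, ('o, 'a) loop_arr) top_groupoid" where
  "loop_groupoid_at G W = (let S = circle_groupoid W in
     \<lparr>Ob = subtopology
             (prod_topology (compact_open_topology (Ob S) (Ob G))
                            (compact_open_topology (Ar S) (Ar G)))
             (groupoid_morphisms S G),
      Ar = pullback_topology (loop_arrows G W)
             (\<lambda>(\<Psi>, \<Lambda>, \<Phi>). (snd \<Psi>, restrict (\<Lambda> \<circ> ide S) (topspace (Ob S))))
             (prod_topology (compact_open_topology (Ar S) (Ar G))
                            (compact_open_topology (Ob S) (Ar G))),
      src = (\<lambda>(\<Psi>, \<Lambda>, \<Phi>). \<Psi>),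
      tgt = (\<lambda>(\<Psi>, \<Lambda>, \<Phi>). \<Phi>),
      ide = (\<lambda>\<Psi>. (\<Psi>, snd \<Psi>, \<Psi>)),
      ginv = (\<lambda>(\<Psi>, \<Lambda>, \<Phi>).
        (\<Phi>, \<lambda>r\<in>topspace (Ar S). mul G (ginv G (\<Lambda> (ide S (src S r)))) (snd \<Psi> r), \<Psi>)),
      mul = (\<lambda>(\<Psi>, \<Lambda>, \<Phi>) (\<Phi>', \<Omega>, \<Gamma>).
        (\<Psi>, \<lambda>r\<in>topspace (Ar S).
               mul G (mul G (\<Lambda> (ide S (src S r))) (\<Omega> (ide S (src S r)))) (snd \<Gamma> r), \<Gamma>))\<rparr>)"

text \<open>Precomposition with the morphism from the circle groupoid of the finer cover \<open>W'\<close> to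
  that of \<open>W\<close>.\<close>

definition pull_obj :: "cover \<Rightarrow> cover \<Rightarrow> ('o, 'a) loop_obj \<Rightarrow> ('o, 'a) loop_obj" where
  "pull_obj W W' \<Psi> =
     (restrict (fst \<Psi> \<circ> fst (circle_refine W)) (topspace (Ob (circle_groupoid W'))),
      restrict (snd \<Psi> \<circ> snd (circle_refine W)) (topspace (Ar (circle_groupoid W'))))"

definition pull_arr :: "cover \<Rightarrow> cover \<Rightarrow> ('o, 'a) loop_arr \<Rightarrow> ('o, 'a) loop_arr" where
  "pull_arr W W' = (\<lambda>(\<Psi>, \<Lambda>, \<Phi>).
     (pull_obj W W' \<Psi>,
      restrict (\<Lambda> \<circ> snd (circle_refine W)) (topspace (Ar (circle_groupoid W'))),
      pull_obj W W' \<Phi>))"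


section \<open>The loop groupoid\<close>

text \<open>The directed colimit of the spaces \<open>D i\<close>, \<open>i \<in> I\<close>, along maps \<open>f i k : D i \<rightarrow> D k\<close> for
  \<open>le k i\<close>. Its points are the classes of pairs \<open>(i, x)\<close>.\<close>

definition colim_class ::
    "'i set \<Rightarrow> ('i \<Rightarrow> 'i \<Rightarrow> bool) \<Rightarrow> ('i \<Rightarrow> 'x topology) \<Rightarrow> ('i \<Rightarrow> 'i \<Rightarrow> 'x \<Rightarrow> 'x) \<Rightarrow>
     'i \<Rightarrow> 'x \<Rightarrow> ('i \<times> 'x) set" where
  "colim_class I le D f i x = {(j, y). j \<in> I \<and> y \<in> topspace (D j) \<and>
     (\<exists>k\<in>I. le k i \<and> le k j \<and> f i k x = f j k y)}"

definition colim_topology ::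
    "'i set \<Rightarrow> ('i \<Rightarrow> 'i \<Rightarrow> bool) \<Rightarrow> ('i \<Rightarrow> 'x topology) \<Rightarrow> ('i \<Rightarrow> 'i \<Rightarrow> 'x \<Rightarrow> 'x) \<Rightarrow>
     ('i \<times> 'x) set topology" where
  "colim_topology I le D f = topology (\<lambda>U.
     U \<subseteq> {colim_class I le D f i x | i x. i \<in> I \<and> x \<in> topspace (D i)} \<and>
     (\<forall>i\<in>I. openin (D i) {x \<in> topspace (D i). colim_class I le D f i x \<in> U}))"

lemma istopology_final:
  "istopology (\<lambda>U. U \<subseteq> C \<and> (\<forall>i\<in>I. openin (D i) {x \<in> topspace (D i). q i x \<in> U}))"
  (is "istopology ?P")
proof -
  have "?P (S \<inter> T)" if "?P S" "?P T" for S T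
  proof -
    have "{x \<in> topspace (D i). q i x \<in> S \<inter> T} =
      {x \<in> topspace (D i). q i x \<in> S} \<inter> {x \<in> topspace (D i). q i x \<in> T}" for i
      by blast
    then show ?thesis
      using that by (simp add: openin_Int le_infI1)
  qed
  moreover have "?P (\<Union>\<K>)" if "\<forall>S\<in>\<K>. ?P S" for \<K>
  proof -
    have "{x \<in> topspace (D i). q i x \<in> \<Union>\<K>} = (\<Union>S\<in>\<K>. {x \<in> topspace (D i). q i x \<in> S})" for i
      by blast
    moreover have "openin (D i) (\<Union>S\<in>\<K>. {x \<in> topspace (D i). q i x \<in> S})" if "i \<in> I" for i
      using \<open>\<forall>S\<in>\<K>. ?P S\<close> that by (intro openin_Union) blast
    ultimately show ?thesis
      using that by (simp add: Sup_le_iff)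
  qed
  ultimately show ?thesis
    unfolding istopology_def by blast
qed

lemma openin_colim_topology:
  "openin (colim_topology I le D f) U \<longleftrightarrow>
     U \<subseteq> {colim_class I le D f i x | i x. i \<in> I \<and> x \<in> topspace (D i)} \<and>
     (\<forall>i\<in>I. openin (D i) {x \<in> topspace (D i). colim_class I le D f i x \<in> U})"
  unfolding colim_topology_def by (subst topology_inverse'[OF istopology_final]) (rule refl)

abbreviation loop_obj_class ::
    "('o, 'a) top_groupoid \<Rightarrow> cover \<Rightarrow> ('o, 'a) loop_obj \<Rightarrow> (cover \<times> ('o, 'a) loop_obj) set" where
  "loop_obj_class G \<equiv>
     colim_class admissible_covers refines (\<lambda>W. Ob (loop_groupoid_at G W)) pull_obj"

abbreviation loop_arr_class ::
    "('o, 'a) top_groupoid \<Rightarrow> cover \<Rightarrow> ('o, 'a) loop_arr \<Rightarrow> (cover \<times> ('o, 'a) loop_arr) set" where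
  "loop_arr_class G \<equiv>
     colim_class admissible_covers refines (\<lambda>W. Ar (loop_groupoid_at G W)) pull_arr"

text \<open>The structure maps are computed on representatives; for \<open>mul\<close>, on representatives over a
  common cover that are composable there.\<close>

definition loop_groupoid ::
    "('o, 'a) top_groupoid \<Rightarrow>
     ((cover \<times> ('o, 'a) loop_obj) set, (cover \<times> ('o, 'a) loop_arr) set) top_groupoid" where
  "loop_groupoid G =
     \<lparr>Ob = colim_topology admissible_covers refines (\<lambda>W. Ob (loop_groupoid_at G W)) pull_obj,
      Ar = colim_topology admissible_covers refines (\<lambda>W. Ar (loop_groupoid_at G W)) pull_arr,
      src = (\<lambda>c. THE d. \<exists>(W, \<alpha>)\<in>c. d = loop_obj_class G W (src (loop_groupoid_at G W) \<alpha>)),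
      tgt = (\<lambda>c. THE d. \<exists>(W, \<alpha>)\<in>c. d = loop_obj_class G W (tgt (loop_groupoid_at G W) \<alpha>)),
      ide = (\<lambda>c. THE d. \<exists>(W, \<Psi>)\<in>c. d = loop_arr_class G W (ide (loop_groupoid_at G W) \<Psi>)),
      ginv = (\<lambda>c. THE d. \<exists>(W, \<alpha>)\<in>c. d = loop_arr_class G W (ginv (loop_groupoid_at G W) \<alpha>)),
      mul = (\<lambda>c c'. THE d. \<exists>W \<alpha> \<beta>. (W, \<alpha>) \<in> c \<and> (W, \<beta>) \<in> c' \<and>
        (\<alpha>, \<beta>) \<in> composable (loop_groupoid_at G W) \<and>
        d = loop_arr_class G W (mul (loop_groupoid_at G W) \<alpha> \<beta>))\<rparr>"


section \<open>The action of the real line\<close>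

definition shift_cover :: "real \<Rightarrow> cover \<Rightarrow> cover" where
  "shift_cover z W = ((\<lambda>b. b + z) ` breaks W \<inter> {0<..1}, snd W)"

definition shift_obj :: "real \<Rightarrow> cover \<Rightarrow> ('o, 'a) loop_obj \<Rightarrow> ('o, 'a) loop_obj" where
  "shift_obj z W \<Psi> =
     (\<lambda>(b, x)\<in>topspace (Ob (circle_groupoid (shift_cover z W))). fst \<Psi> (b - z, x - z),
      \<lambda>(((b, c), x), l)\<in>topspace (Ar (circle_groupoid (shift_cover z W))).
        snd \<Psi> (((b - z, c - z), x - z), l))"

definition shift_arr :: "real \<Rightarrow> cover \<Rightarrow> ('o, 'a) loop_arr \<Rightarrow> ('o, 'a) loop_arr" where
  "shift_arr z W = (\<lambda>(\<Psi>, \<Lambda>, \<Phi>).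
     (shift_obj z W \<Psi>,
      \<lambda>(((b, c), x), l)\<in>topspace (Ar (circle_groupoid (shift_cover z W))).
        \<Lambda> (((b - z, c - z), x - z), l),
      shift_obj z W \<Phi>))"

text \<open>Shifting is a bijection compatible with refinement, so on the colimit it acts by taking the
  image of a class.\<close>

definition act_obj ::
    "real \<Rightarrow> (cover \<times> ('o, 'a) loop_obj) set \<Rightarrow> (cover \<times> ('o, 'a) loop_obj) set" where
  "act_obj z c = (\<lambda>(W, \<Psi>). (shift_cover z W, shift_obj z W \<Psi>)) ` c"

definition act_arr ::
    "real \<Rightarrow> (cover \<times> ('o, 'a) loop_arr) set \<Rightarrow> (cover \<times> ('o, 'a) loop_arr) set" where
  "act_arr z c = (\<lambda>(W, \<alpha>). (shift_cover z W, shift_arr z W \<alpha>)) ` c"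

definition fixed_loop_groupoid ::
    "('o, 'a) top_groupoid \<Rightarrow>
     ((cover \<times> ('o, 'a) loop_obj) set, (cover \<times> ('o, 'a) loop_arr) set) top_groupoid" where
  "fixed_loop_groupoid G = restrict_groupoid (loop_groupoid G)
     {c. \<forall>z. act_obj z c = c} {c. \<forall>z. act_arr z c = c}"


section \<open>Morphisms from the integers\<close>

definition delooping :: "(unit, 'g :: group_add) top_groupoid" where
  "delooping =
     \<lparr>Ob = discrete_topology UNIV, Ar = discrete_topology UNIV,
      src = (\<lambda>_. ()), tgt = (\<lambda>_. ()), ide = (\<lambda>_. 0), ginv = uminus, mul = (+)\<rparr>"

type_synonym ('o, 'a) hom_obj = "(unit \<Rightarrow> 'o) \<times> (int \<Rightarrow> 'a)"

type_synonym ('o, 'a) hom_arr = "('o, 'a) hom_obj \<times> (int \<Rightarrow> 'a) \<times> ('o, 'a) hom_obj"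

definition hom_arrows :: "('o, 'a) top_groupoid \<Rightarrow> ('o, 'a) hom_arr set" where
  "hom_arrows G = {(\<phi>, \<kappa>, \<psi>). \<phi> \<in> groupoid_morphisms delooping G \<and>
     \<psi> \<in> groupoid_morphisms delooping G \<and>
     range \<kappa> \<subseteq> topspace (Ar G) \<and>
     src G (\<kappa> 0) = fst \<phi> () \<and> tgt G (\<kappa> 0) = fst \<psi> () \<and>
     (\<forall>n. mul G (\<kappa> 0) (snd \<psi> n) = \<kappa> n \<and> mul G (snd \<phi> n) (\<kappa> 0) = \<kappa> n)}"

definition integer_hom_groupoid ::
    "('o, 'a) top_groupoid \<Rightarrow> (('o, 'a) hom_obj, ('o, 'a) hom_arr) top_groupoid" where
  "integer_hom_groupoid G =
     \<lparr>Ob = pullback_topology (groupoid_morphisms delooping G) snd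
             (compact_open_topology (discrete_topology UNIV) (Ar G)),
      Ar = pullback_topology (hom_arrows G) (\<lambda>(\<phi>, \<kappa>, \<psi>). \<kappa>)
             (compact_open_topology (discrete_topology UNIV) (Ar G)),
      src = (\<lambda>(\<phi>, \<kappa>, \<psi>). \<phi>),
      tgt = (\<lambda>(\<phi>, \<kappa>, \<psi>). \<psi>),
      ide = (\<lambda>\<phi>. (\<phi>, snd \<phi>, \<phi>)),
      ginv = (\<lambda>(\<phi>, \<kappa>, \<psi>). (\<psi>, \<lambda>n. mul G (ginv G (\<kappa> 0)) (snd \<phi> n), \<phi>)),
      mul = (\<lambda>(\<phi>, \<kappa>, \<psi>) (\<psi>', \<mu>, \<theta>).
        (\<phi>, \<lambda>n. mul G (mul G (\<kappa> 0) (\<mu> 0)) (snd \<theta> n), \<theta>))\<rparr>"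

end

theory Submission
  imports Defs
begin

text \<open>A loop fixed by all translations has, up to refinement of the cover, constant components: the
  translation by \<open>x\<close> compares its values at \<open>x\<close> and at \<open>0\<close>. Hence a fixed class is determined by its
  holonomy, a morphism from the integers, and assigning to such a morphism the class of the
  constant loop with this holonomy is a bijection onto the fixed loops. It is even an isomorphism of
  topological groupoids: constant loops depend continuously on the holonomy because compact sets of
  arrows of a circle groupoid meet finitely many degrees, and the holonomy is continuous because
  evaluation at a base point chosen compatibly with refinement is defined and continuous on the
  whole colimit. An isomorphism is a Morita equivalence once the source map is open, and on the
  integer side this follows from local sections of the source map of the etale groupoid.\<close>

section \<open>Isomorphisms of topological groupoids\<close>

text \<open>Equality in the colimit is equality after a refinement, and for a fixed class this
  refinement depends on the translation \<open>z\<close>; no single one is available for all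
  \<open>z\<close> at once. Infinitely many translations are therefore used only for equations that
  mention \<open>W\<close> alone, between values at indices \<open>coarsen W x\<close>, and one
  small translation handles all remaining components, so that one refinement is enough. This rests
  on \<open>coarsen W x\<close>, the last break point not after \<open>x\<close>: it selects an
  interval around every point in a way that commutes with refinement, with integer translations and
  with shifts of the cover, so that the value of a loop at \<open>x\<close> is meaningful without a
  choice. The open sets of the colimit are never described, nor are its structure maps treated
  directly as continuous maps. Maps out of it are tested on each cover, maps into it factor through
  one cover, and the groupoid axioms of the fixed part are carried over from
  \<open>integer_hom_groupoid G\<close> along the bijection.\<close>

locale groupoid_space =
  fixes G :: "('o, 'a) top_groupoid"
  assumes topological_groupoid: "topological_groupoid G"
begin

lemma continuous_src: "continuous_map (Ar G) (Ob G) (src G)"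
  and continuous_tgt: "continuous_map (Ar G) (Ob G) (tgt G)"
  and continuous_ide: "continuous_map (Ob G) (Ar G) (ide G)"
  and continuous_ginv: "continuous_map (Ar G) (Ar G) (ginv G)"
  and continuous_mul:
    "continuous_map (subtopology (prod_topology (Ar G) (Ar G)) (composable G)) (Ar G)
       (\<lambda>(a, b). mul G a b)"
  using topological_groupoid by (auto simp: topological_groupoid_def)

lemma src_in [simp]: "a \<in> topspace (Ar G) \<Longrightarrow> src G a \<in> topspace (Ob G)"
  and tgt_in [simp]: "a \<in> topspace (Ar G) \<Longrightarrow> tgt G a \<in> topspace (Ob G)"
  and ide_in [simp]: "x \<in> topspace (Ob G) \<Longrightarrow> ide G x \<in> topspace (Ar G)"
  and ginv_in [simp]: "a \<in> topspace (Ar G) \<Longrightarrow> ginv G a \<in> topspace (Ar G)"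
  using continuous_src continuous_tgt continuous_ide continuous_ginv
  by (auto simp: continuous_map_def)

lemma mul_in [simp]:
  assumes "a \<in> topspace (Ar G)" "b \<in> topspace (Ar G)" "tgt G a = src G b"
  shows "mul G a b \<in> topspace (Ar G)"
proof -
  have "(a, b) \<in> topspace (subtopology (prod_topology (Ar G) (Ar G)) (composable G))"
    using assms by (auto simp: composable_def)
  from continuous_map_image_subset_topspace[OF continuous_mul, THEN subsetD, OF imageI, OF this]
  show ?thesis
    by simp
qed

lemma src_ide [simp]: "x \<in> topspace (Ob G) \<Longrightarrow> src G (ide G x) = x"
  and tgt_ide [simp]: "x \<in> topspace (Ob G) \<Longrightarrow> tgt G (ide G x) = x"
  using topological_groupoid by (auto simp: topological_groupoid_def)

lemma src_mul [simp]:
    "\<lbrakk>a \<in> topspace (Ar G); b \<in> topspace (Ar G); tgt G a = src G b\<rbrakk> \<Longrightarrow> src G (mul G a b) = src G a"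
  and tgt_mul [simp]:
    "\<lbrakk>a \<in> topspace (Ar G); b \<in> topspace (Ar G); tgt G a = src G b\<rbrakk> \<Longrightarrow> tgt G (mul G a b) = tgt G b"
  and mul_assoc:
    "\<lbrakk>a \<in> topspace (Ar G); b \<in> topspace (Ar G); c \<in> topspace (Ar G);
      tgt G a = src G b; tgt G b = src G c\<rbrakk> \<Longrightarrow> mul G (mul G a b) c = mul G a (mul G b c)"
  using topological_groupoid by (auto simp: topological_groupoid_def composable_def)

lemma ide_mul: "\<lbrakk>a \<in> topspace (Ar G); src G a = x\<rbrakk> \<Longrightarrow> mul G (ide G x) a = a"
  and mul_ide: "\<lbrakk>a \<in> topspace (Ar G); tgt G a = x\<rbrakk> \<Longrightarrow> mul G a (ide G x) = a"
  and src_ginv [simp]: "a \<in> topspace (Ar G) \<Longrightarrow> src G (ginv G a) = tgt G a"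
  and tgt_ginv [simp]: "a \<in> topspace (Ar G) \<Longrightarrow> tgt G (ginv G a) = src G a"
  and mul_ginv: "a \<in> topspace (Ar G) \<Longrightarrow> mul G a (ginv G a) = ide G (src G a)"
  and ginv_mul: "a \<in> topspace (Ar G) \<Longrightarrow> mul G (ginv G a) a = ide G (tgt G a)"
  using topological_groupoid by (auto simp: topological_groupoid_def)

lemma ginv_mul_cancel:
  "\<lbrakk>a \<in> topspace (Ar G); b \<in> topspace (Ar G); tgt G a = src G b\<rbrakk> \<Longrightarrow> mul G (ginv G a) (mul G a b) = b"
  by (simp add: ginv_mul ide_mul flip: mul_assoc)

lemma mul_ginv_cancel:
  "\<lbrakk>a \<in> topspace (Ar G); b \<in> topspace (Ar G); src G a = src G b\<rbrakk> \<Longrightarrow> mul G a (mul G (ginv G a) b) = b"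
  by (simp add: mul_ginv ide_mul flip: mul_assoc)

lemma mul_mul_ginv:
  "\<lbrakk>a \<in> topspace (Ar G); b \<in> topspace (Ar G); tgt G b = src G a\<rbrakk> \<Longrightarrow> mul G (mul G b a) (ginv G a) = b"
  by (simp add: mul_assoc mul_ginv mul_ide)

lemma continuous_map_mul:
  assumes f: "continuous_map X (Ar G) f" and g: "continuous_map X (Ar G) g"
    and fg: "\<And>x. x \<in> topspace X \<Longrightarrow> tgt G (f x) = src G (g x)"
  shows "continuous_map X (Ar G) (\<lambda>x. mul G (f x) (g x))"
proof -
  have "continuous_map X (subtopology (prod_topology (Ar G) (Ar G)) (composable G)) (\<lambda>x. (f x, g x))"
    using f g fg continuous_map_image_subset_topspace[OF f] continuous_map_image_subset_topspace[OF g]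
    by (auto simp: continuous_map_in_subtopology continuous_map_paired composable_def)
  from continuous_map_compose[OF this continuous_mul] show ?thesis
    by (simp add: o_def)
qed

lemmas continuous_map_ginv = continuous_map_compose[OF _ continuous_ginv, unfolded o_def]

end

text \<open>The inverse maps are not asked to form a morphism; \<open>groupoid_iso_inverse\<close>
  derives this when \<open>H\<close> is a topological groupoid.\<close>

definition groupoid_iso ::
    "('p, 'q) top_groupoid \<Rightarrow> ('o, 'a) top_groupoid \<Rightarrow> ('p \<Rightarrow> 'o) \<times> ('q \<Rightarrow> 'a) \<Rightarrow> bool" where
  "groupoid_iso H G \<Psi> \<longleftrightarrow> groupoid_morphism H G \<Psi> \<and>
     homeomorphic_map (Ob H) (Ob G) (fst \<Psi>) \<and> homeomorphic_map (Ar H) (Ar G) (snd \<Psi>)"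

lemma groupoid_morphismD:
  assumes "groupoid_morphism H G f"
  shows "continuous_map (Ob H) (Ob G) (fst f)" "continuous_map (Ar H) (Ar G) (snd f)"
    "\<And>x. x \<in> topspace (Ob H) \<Longrightarrow> fst f x \<in> topspace (Ob G)"
    "\<And>a. a \<in> topspace (Ar H) \<Longrightarrow> snd f a \<in> topspace (Ar G)"
    "\<And>a. a \<in> topspace (Ar H) \<Longrightarrow> src G (snd f a) = fst f (src H a)"
    "\<And>a. a \<in> topspace (Ar H) \<Longrightarrow> tgt G (snd f a) = fst f (tgt H a)"
    "\<And>a. a \<in> topspace (Ar H) \<Longrightarrow> snd f (ginv H a) = ginv G (snd f a)"
    "\<And>x. x \<in> topspace (Ob H) \<Longrightarrow> snd f (ide H x) = ide G (fst f x)"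
    "\<And>a b. \<lbrakk>a \<in> topspace (Ar H); b \<in> topspace (Ar H); tgt H a = src H b\<rbrakk> \<Longrightarrow>
      snd f (mul H a b) = mul G (snd f a) (snd f b)"
  using assms by (auto simp: groupoid_morphism_def composable_def continuous_map_def Pi_iff)

lemma groupoid_morphismI:
  assumes "continuous_map (Ob H) (Ob G) f0" "continuous_map (Ar H) (Ar G) f1"
    "\<And>a. a \<in> topspace (Ar H) \<Longrightarrow> src G (f1 a) = f0 (src H a)"
    "\<And>a. a \<in> topspace (Ar H) \<Longrightarrow> tgt G (f1 a) = f0 (tgt H a)"
    "\<And>a. a \<in> topspace (Ar H) \<Longrightarrow> f1 (ginv H a) = ginv G (f1 a)"
    "\<And>x. x \<in> topspace (Ob H) \<Longrightarrow> f1 (ide H x) = ide G (f0 x)"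
    "\<And>a b. \<lbrakk>a \<in> topspace (Ar H); b \<in> topspace (Ar H); tgt H a = src H b\<rbrakk> \<Longrightarrow>
      f1 (mul H a b) = mul G (f1 a) (f1 b)"
  shows "groupoid_morphism H G (f0, f1)"
  using assms by (auto simp: groupoid_morphism_def composable_def)

lemma groupoid_morphism_compose:
  assumes f: "groupoid_morphism H G f" and g: "groupoid_morphism G K g"
  shows "groupoid_morphism H K (fst g \<circ> fst f, snd g \<circ> snd f)"
  by (rule groupoid_morphismI) (use groupoid_morphismD(1,2)[OF f] groupoid_morphismD(1,2)[OF g] in
      \<open>auto intro: continuous_map_compose simp: groupoid_morphismD(3-)[OF f] groupoid_morphismD(3-)[OF g]\<close>)

lemma groupoid_iso_compose:
  assumes "groupoid_iso H G f" "groupoid_iso G K g"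
  shows "groupoid_iso H K (fst g \<circ> fst f, snd g \<circ> snd f)"
  using assms unfolding groupoid_iso_def fst_conv snd_conv
  by (meson groupoid_morphism_compose homeomorphic_map_compose)

context
  fixes H :: "('p, 'q) top_groupoid" and G :: "('o, 'a) top_groupoid" and f
  assumes top: "topological_groupoid H" and iso: "groupoid_iso H G f"
begin

interpretation H: groupoid_space H
  by unfold_locales (rule top)

text \<open>Only \<open>H\<close> is known to be a topological groupoid here. The delicate condition
  is compatibility with composition: arrows that are composable in \<open>G\<close> come from
  composable arrows of \<open>H\<close> because \<open>fst f\<close> is injective on
  objects.\<close>

lemma groupoid_iso_inverse:
  obtains g where "homeomorphic_maps (Ob H) (Ob G) (fst f) (fst g)"
    "homeomorphic_maps (Ar H) (Ar G) (snd f) (snd g)" "groupoid_iso G H g"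
proof -
  obtain g0 g1 where g0: "homeomorphic_maps (Ob H) (Ob G) (fst f) g0"
    and g1: "homeomorphic_maps (Ar H) (Ar G) (snd f) g1"
    using iso by (auto simp: groupoid_iso_def homeomorphic_map_maps)
  have f0: "fst f x \<in> topspace (Ob G)" "g0 (fst f x) = x" if "x \<in> topspace (Ob H)" for x
    using g0 that by (auto simp: homeomorphic_maps_def continuous_map_def)
  have f1: "snd f a \<in> topspace (Ar G)" "g1 (snd f a) = a" if "a \<in> topspace (Ar H)" for a
    using g1 that by (auto simp: homeomorphic_maps_def continuous_map_def)
  have ob: "\<exists>x\<in>topspace (Ob H). y = fst f x" if "y \<in> topspace (Ob G)" for y
    using g0 that by (auto simp: homeomorphic_maps_def continuous_map_def intro!: bexI[of _ "g0 y"])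
  have ar: "\<exists>a\<in>topspace (Ar H). b = snd f a" if "b \<in> topspace (Ar G)" for b
    using g1 that by (auto simp: homeomorphic_maps_def continuous_map_def intro!: bexI[of _ "g1 b"])
  have m: "groupoid_morphism H G f"
    using iso by (simp add: groupoid_iso_def)
  have "groupoid_morphism G H (g0, g1)"
    unfolding groupoid_morphism_def fst_conv snd_conv
  proof (intro conjI ballI; (unfold case_prod_unfold)?)
    show "continuous_map (Ob G) (Ob H) g0" "continuous_map (Ar G) (Ar H) g1"
      using g0 g1 by (auto simp: homeomorphic_maps_def)
  next
    fix b assume "b \<in> topspace (Ar G)"
    then obtain a where a: "a \<in> topspace (Ar H)" "b = snd f a"
      using ar by blast
    have "src G b = fst f (src H a)" "tgt G b = fst f (tgt H a)" "ginv G b = snd f (ginv H a)"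
      using m a by (auto simp: groupoid_morphism_def)
    with a show "src H (g1 b) = g0 (src G b)" "tgt H (g1 b) = g0 (tgt G b)"
      "g1 (ginv G b) = ginv H (g1 b)"
      by (simp_all add: f0 f1)
  next
    fix y assume "y \<in> topspace (Ob G)"
    then obtain x where x: "x \<in> topspace (Ob H)" "y = fst f x"
      using ob by blast
    have "ide G y = snd f (ide H x)"
      using m x by (auto simp: groupoid_morphism_def)
    with x show "g1 (ide G y) = ide H (g0 y)"
      by (simp add: f0 f1)
  next
    fix p assume "p \<in> composable G"
    then obtain b b' where p: "p = (b, b')" "b \<in> topspace (Ar G)" "b' \<in> topspace (Ar G)"
      "tgt G b = src G b'"
      by (auto simp: composable_def)
    then obtain a a' where a: "a \<in> topspace (Ar H)" "b = snd f a" "a' \<in> topspace (Ar H)" "b' = snd f a'"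
      using ar by blast
    have "fst f (tgt H a) = fst f (src H a')"
      using m a p by (auto simp: groupoid_morphism_def)
    then have aa: "tgt H a = src H a'"
      by (metis f0(2) a(1,3) H.tgt_in H.src_in)
    then have "mul G b b' = snd f (mul H a a')"
      using m a by (fastforce simp: groupoid_morphism_def composable_def)
    with a aa p show "g1 (mul G (fst p) (snd p)) = mul H (g1 (fst p)) (g1 (snd p))"
      by (simp add: f1)
  qed
  then have "groupoid_iso G H (g0, g1)"
    unfolding groupoid_iso_def
    using g0 g1 homeomorphic_maps_sym homeomorphic_maps_imp_map by (metis fst_conv snd_conv)
  with g0 g1 that[of "(g0, g1)"] show thesis
    by simp
qed

text \<open>Each structure map of \<open>G\<close> is the one of \<open>H\<close> conjugated by
  \<open>f\<close>. In the main application the structure maps of \<open>G\<close> are definite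
  descriptions on a colimit, and this transport gives their continuity and the groupoid axioms at
  once.\<close>

lemma topological_groupoid_iso: "topological_groupoid G"
proof -
  obtain g where g0: "homeomorphic_maps (Ob H) (Ob G) (fst f) (fst g)"
    and g1: "homeomorphic_maps (Ar H) (Ar G) (snd f) (snd g)" and g: "groupoid_iso G H g"
    by (rule groupoid_iso_inverse)
  have cf: "continuous_map (Ob H) (Ob G) (fst f)" "continuous_map (Ar H) (Ar G) (snd f)"
    and cg: "continuous_map (Ob G) (Ob H) (fst g)" "continuous_map (Ar G) (Ar H) (snd g)"
    and mf: "groupoid_morphism H G f"
    using g0 g1 iso by (auto simp: homeomorphic_maps_def groupoid_iso_def)
  have g0_in: "fst g x \<in> topspace (Ob H)" "fst f (fst g x) = x" if "x \<in> topspace (Ob G)" for x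
    using g0 that by (auto simp: homeomorphic_maps_def continuous_map_def)
  have g1_in: "snd g a \<in> topspace (Ar H)" "snd f (snd g a) = a" if "a \<in> topspace (Ar G)" for a
    using g1 that by (auto simp: homeomorphic_maps_def continuous_map_def)
  have f0_in: "fst f x \<in> topspace (Ob G)" "fst g (fst f x) = x" if "x \<in> topspace (Ob H)" for x
    using g0 that by (auto simp: homeomorphic_maps_def continuous_map_def)
  have f1_in: "snd f x \<in> topspace (Ar G)" "snd g (snd f x) = x" if "x \<in> topspace (Ar H)" for x
    using g1 that by (auto simp: homeomorphic_maps_def continuous_map_def)
  have src: "src G a = fst f (src H (snd g a))" and tgt: "tgt G a = fst f (tgt H (snd g a))"
    and inv: "ginv G a = snd f (ginv H (snd g a))" if "a \<in> topspace (Ar G)" for a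
    using that mf g1_in[OF that] by (auto simp: groupoid_morphism_def)
  have ide: "ide G x = snd f (ide H (fst g x))" if "x \<in> topspace (Ob G)" for x
    using that mf g0_in[OF that] by (auto simp: groupoid_morphism_def)
  have comp: "tgt H (snd g a) = src H (snd g b)"
    if "a \<in> topspace (Ar G)" "b \<in> topspace (Ar G)" "tgt G a = src G b" for a b
    using that by (metis f0_in(2) g1_in(1) src tgt H.tgt_in H.src_in)
  have mul: "mul G a b = snd f (mul H (snd g a) (snd g b))"
    if "a \<in> topspace (Ar G)" "b \<in> topspace (Ar G)" "tgt G a = src G b" for a b
  proof -
    have "(snd g a, snd g b) \<in> composable H"
      using that comp by (auto simp: composable_def g1_in)
    then have "snd f (mul H (snd g a) (snd g b)) = mul G (snd f (snd g a)) (snd f (snd g b))"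
      using mf by (auto simp: groupoid_morphism_def)
    then show ?thesis
      using that by (simp add: g1_in)
  qed
  show ?thesis
    unfolding topological_groupoid_def
  proof (intro conjI)
    show "continuous_map (Ar G) (Ob G) (src G)"
      by (rule continuous_map_eq[OF continuous_map_compose[OF
            continuous_map_compose[OF cg(2) H.continuous_src] cf(1)]]) (simp add: src)
    show "continuous_map (Ar G) (Ob G) (tgt G)"
      by (rule continuous_map_eq[OF continuous_map_compose[OF
            continuous_map_compose[OF cg(2) H.continuous_tgt] cf(1)]]) (simp add: tgt)
    show "continuous_map (Ob G) (Ar G) (ide G)"
      by (rule continuous_map_eq[OF continuous_map_compose[OF
            continuous_map_compose[OF cg(1) H.continuous_ide] cf(2)]]) (simp add: ide)
    show "continuous_map (Ar G) (Ar G) (ginv G)"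
      by (rule continuous_map_eq[OF continuous_map_compose[OF
            continuous_map_compose[OF cg(2) H.continuous_ginv] cf(2)]]) (simp add: inv)
    let ?X = "subtopology (prod_topology (Ar G) (Ar G)) (composable G)"
    have "continuous_map ?X (Ar H) (snd g \<circ> fst)" "continuous_map ?X (Ar H) (snd g \<circ> snd)"
      using cg(2) by (auto intro!: continuous_map_compose[OF _ cg(2)] continuous_map_subtopology_fst
          continuous_map_subtopology_snd)
    then have "continuous_map ?X (Ar H) (\<lambda>p. mul H ((snd g \<circ> fst) p) ((snd g \<circ> snd) p))"
      by (rule H.continuous_map_mul) (auto simp: composable_def comp)
    from continuous_map_compose[OF this cf(2)]
    show "continuous_map ?X (Ar G) (\<lambda>(a, b). mul G a b)"
      by (rule continuous_map_eq) (auto simp: composable_def mul)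
    show "\<forall>x\<in>topspace (Ob G). src G (ide G x) = x \<and> tgt G (ide G x) = x"
      by (simp add: ide src tgt f1_in g0_in g1_in)
    show "\<forall>(a, b)\<in>composable G. src G (mul G a b) = src G a \<and> tgt G (mul G a b) = tgt G b"
      by (auto simp: composable_def mul comp src f1_in g1_in tgt)
    show "\<forall>a b c. (a, b) \<in> composable G \<longrightarrow> (b, c) \<in> composable G \<longrightarrow>
        mul G (mul G a b) c = mul G a (mul G b c)"
    proof (intro allI impI)
      fix a b c assume "(a, b) \<in> composable G" "(b, c) \<in> composable G"
      then have abc: "a \<in> topspace (Ar G)" "b \<in> topspace (Ar G)" "c \<in> topspace (Ar G)"
        "tgt G a = src G b" "tgt G b = src G c"
        by (auto simp: composable_def)
      let ?a = "snd g a" and ?b = "snd g b" and ?c = "snd g c"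
      have c: "tgt H ?a = src H ?b" "tgt H ?b = src H ?c"
        using comp abc by auto
      have 1: "mul H ?a ?b \<in> topspace (Ar H)" "mul H ?b ?c \<in> topspace (Ar H)"
        using abc c by (auto simp: g1_in)
      have 2: "mul G (snd f (mul H ?a ?b)) c = snd f (mul H (mul H ?a ?b) ?c)"
        using abc c 1 by (subst mul) (auto simp: f1_in g1_in tgt src)
      have 3: "mul G a (snd f (mul H ?b ?c)) = snd f (mul H ?a (mul H ?b ?c))"
        using abc c 1 by (subst mul) (auto simp: f1_in g1_in tgt src)
      show "mul G (mul G a b) c = mul G a (mul G b c)"
        using abc c by (simp add: mul[OF abc(1,2,4)] mul[OF abc(2,3,5)] 2 3 H.mul_assoc g1_in)
    qed
    show "\<forall>a\<in>topspace (Ar G).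
        mul G (ide G (src G a)) a = a \<and> mul G a (ide G (tgt G a)) = a \<and>
        src G (ginv G a) = tgt G a \<and> tgt G (ginv G a) = src G a \<and>
        mul G a (ginv G a) = ide G (src G a) \<and> mul G (ginv G a) a = ide G (tgt G a)"
    proof
      fix a assume a: "a \<in> topspace (Ar G)"
      have s: "src G a \<in> topspace (Ob G)" "tgt G a \<in> topspace (Ob G)"
        using a by (auto simp: src tgt f0_in g1_in)
      have i: "ide G (src G a) \<in> topspace (Ar G)" "ide G (tgt G a) \<in> topspace (Ar G)"
        "ginv G a \<in> topspace (Ar G)"
        using a s by (auto simp: ide inv f1_in g0_in g1_in)
      have j: "snd g (ide G (src G a)) = ide H (src H (snd g a))"
        "snd g (ide G (tgt G a)) = ide H (tgt H (snd g a))" "snd g (ginv G a) = ginv H (snd g a)"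
        using a s by (auto simp: ide inv f1_in g0_in g1_in src tgt f0_in)
      have k: "fst g (src G a) = src H (snd g a)" "fst g (tgt G a) = tgt H (snd g a)"
        using a by (simp_all add: src tgt f0_in g1_in)
      have si: "src G (ginv G a) = tgt G a" "tgt G (ginv G a) = src G a"
        "src G (ide G (src G a)) = src G a" "tgt G (ide G (src G a)) = src G a"
        "src G (ide G (tgt G a)) = tgt G a" "tgt G (ide G (tgt G a)) = tgt G a"
        unfolding src[OF i(1)] src[OF i(2)] src[OF i(3)] tgt[OF i(1)] tgt[OF i(2)] tgt[OF i(3)] j
        using a by (simp_all add: src tgt g1_in)
      show "mul G (ide G (src G a)) a = a \<and> mul G a (ide G (tgt G a)) = a \<and>
        src G (ginv G a) = tgt G a \<and> tgt G (ginv G a) = src G a \<and>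
        mul G a (ginv G a) = ide G (src G a) \<and> mul G (ginv G a) a = ide G (tgt G a)"
        using a i si s by (simp add: mul j H.ide_mul H.mul_ide H.mul_ginv H.ginv_mul g1_in f1_in ide k)
    qed
  qed
qed

lemma open_src_iso:
  assumes "open_map (Ar H) (Ob H) (src H)"
  shows "open_map (Ar G) (Ob G) (src G)"
proof -
  obtain g where g0: "homeomorphic_maps (Ob H) (Ob G) (fst f) (fst g)"
    and g1: "homeomorphic_maps (Ar H) (Ar G) (snd f) (snd g)" and g: "groupoid_iso G H g"
    by (rule groupoid_iso_inverse)
  have "open_map (Ar G) (Ob G) (fst f \<circ> (src H \<circ> snd g))"
    using assms g1 iso g by (intro open_map_compose[of _ "Ob H"] open_map_compose[of _ "Ar H"])
      (auto simp: groupoid_iso_def intro: homeomorphic_imp_open_map)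
  moreover have "(fst f \<circ> (src H \<circ> snd g)) a = src G a" if "a \<in> topspace (Ar G)" for a
  proof -
    have "snd g a \<in> topspace (Ar H)" "snd f (snd g a) = a"
      using that g1 by (auto simp: homeomorphic_maps_def continuous_map_def)
    then show ?thesis
      using iso by (auto simp: groupoid_iso_def groupoid_morphism_def)
  qed
  ultimately show ?thesis
    by (rule open_map_eq)
qed

end

text \<open>In the fibre product of \<open>Ob H\<close> and \<open>Ar G\<close> the object is
  determined by the arrow, as the preimage of its target. The projection to \<open>Ar G\<close> is
  thus a homeomorphism, and the required open surjection is \<open>src G\<close> up to this
  identification; this is where openness of the source map enters.\<close>

lemma Morita_morphism_iso:
  assumes H: "topological_groupoid H" and iso: "groupoid_iso H G f"
    and op: "open_map (Ar H) (Ob H) (src H)"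
  shows "Morita_morphism H G f"
proof -
  interpret H: groupoid_space H
    by unfold_locales (rule H)
  interpret G: groupoid_space G
    by unfold_locales (rule topological_groupoid_iso[OF H iso])
  obtain g where g0: "homeomorphic_maps (Ob H) (Ob G) (fst f) (fst g)"
    and g1: "homeomorphic_maps (Ar H) (Ar G) (snd f) (snd g)" and g: "groupoid_iso G H g"
    by (rule groupoid_iso_inverse[OF H iso])
  have mf: "groupoid_morphism H G f" and mg: "groupoid_morphism G H g"
    and cf: "continuous_map (Ar H) (Ar G) (snd f)" and cg: "continuous_map (Ar G) (Ar H) (snd g)"
    and cg0: "continuous_map (Ob G) (Ob H) (fst g)"
    using iso g by (auto simp: groupoid_iso_def groupoid_morphism_def)
  have f1: "snd f a \<in> topspace (Ar G)" "snd g (snd f a) = a" "src G (snd f a) = fst f (src H a)"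
    "tgt G (snd f a) = fst f (tgt H a)" if "a \<in> topspace (Ar H)" for a
    using g1 mf that by (auto simp: homeomorphic_maps_def continuous_map_def groupoid_morphism_def)
  have g1': "snd g a \<in> topspace (Ar H)" "snd f (snd g a) = a" "src H (snd g a) = fst g (src G a)"
    "tgt H (snd g a) = fst g (tgt G a)" if "a \<in> topspace (Ar G)" for a
    using g1 mg that by (auto simp: homeomorphic_maps_def continuous_map_def groupoid_morphism_def)
  have f0: "fst f x \<in> topspace (Ob G)" "fst g (fst f x) = x" if "x \<in> topspace (Ob H)" for x
    using g0 that by (auto simp: homeomorphic_maps_def continuous_map_def)
  have g0': "fst g x \<in> topspace (Ob H)" "fst f (fst g x) = x" if "x \<in> topspace (Ob G)" for x
    using g0 that by (auto simp: homeomorphic_maps_def continuous_map_def)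
  have "cartesian_square (Ar H) (Ar G) (prod_topology (Ob H) (Ob H))
       (snd f) (\<lambda>h. (src H h, tgt H h))
       (\<lambda>a. (src G a, tgt G a)) (\<lambda>(x, y). (fst f x, fst f y))"
    unfolding cartesian_square_def
    \<comment> \<open>The arrow of \<open>G\<close> alone determines the preimage: its endpoints fix
      the pair of objects, because \<open>fst f\<close> is injective.\<close>
    apply (rule homeomorphic_maps_imp_map[where g = "snd g \<circ> fst"])
    unfolding homeomorphic_maps_def
    apply (intro conjI)
    subgoal using cf H.continuous_src H.continuous_tgt
      by (auto simp: continuous_map_in_subtopology continuous_map_paired f1)
    subgoal by (intro continuous_map_compose[OF _ cg] continuous_map_subtopology_fst)
    subgoal by (simp add: f1)
    subgoal by (auto simp: g1' f0)
    done
  moreover have "open_map (subtopology (prod_topology (Ob H) (Ar G)) {(x, a). fst f x = tgt G a})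
    (Ob G) (\<lambda>(x, a). src G a)" (is "open_map ?F _ _")
  proof -
    have "homeomorphic_maps ?F (Ar G) snd (\<lambda>a. (fst g (tgt G a), a))"
      unfolding homeomorphic_maps_def
    proof (intro conjI ballI)
      show "continuous_map ?F (Ar G) snd"
        by (rule continuous_map_subtopology_snd)
      show "continuous_map (Ar G) ?F (\<lambda>a. (fst g (tgt G a), a))"
        using continuous_map_compose[OF G.continuous_tgt cg0]
        by (auto simp: continuous_map_in_subtopology continuous_map_paired o_def g0')
      show "(fst g (tgt G (snd p)), snd p) = p" if "p \<in> topspace ?F" for p
        proof -
        have "fst p \<in> topspace (Ob H)" "tgt G (snd p) = fst f (fst p)"
          using that by auto
        then show ?thesis
          by (simp add: f0)
      qed
    qed auto
    then have "open_map ?F (Ar G) snd"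
      using homeomorphic_maps_imp_map homeomorphic_imp_open_map by blast
    then have "open_map ?F (Ob G) (src G \<circ> snd)"
      using open_src_iso[OF H iso op] by (rule open_map_compose)
    then show ?thesis
      by (simp add: o_def case_prod_unfold)
  qed
  moreover have "(\<lambda>(x, a). src G a) ` topspace
    (subtopology (prod_topology (Ob H) (Ar G)) {(x, a). fst f x = tgt G a}) = topspace (Ob G)"
  proof (intro equalityI subsetI)
    fix y assume y: "y \<in> topspace (Ob G)"
    show "y \<in> (\<lambda>(x, a). src G a) ` topspace
      (subtopology (prod_topology (Ob H) (Ar G)) {(x, a). fst f x = tgt G a})"
      using y by (intro image_eqI[of _ _ "(fst g y, ide G y)"]) (auto simp: g0')
  qed auto
  ultimately show ?thesis
    using mf by (simp add: Morita_morphism_def)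
qed

text \<open>\<open>Morita_equivalent\<close> fixes the types of the middle groupoid, so
  \<open>H\<close> is replaced by a copy \<open>K\<close> of the prescribed types. Its two legs are
  the inverse of the relabelling and the composite of that inverse with \<open>f\<close>.\<close>

lemma Morita_equivalent_iso:
  fixes H :: "('p, 'b) top_groupoid" and G :: "('o, 'a) top_groupoid"
  assumes H: "topological_groupoid H" and iso: "groupoid_iso H G f"
    and op: "open_map (Ar H) (Ob H) (src H)"
  shows "Morita_equivalent G H"
proof -
  interpret H: groupoid_space H
    by unfold_locales (rule H)
  \<comment> \<open>An object is coded by its image in \<open>G\<close> and its identity arrow,
    whose source recovers it. The maps \<open>k0\<close> and \<open>k1\<close> decode, and the
    topologies of \<open>K\<close> are pulled back along them.\<close>
  define i0 where "i0 x = (fst f x, ide H x)" for x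
  define i1 where "i1 a = (snd f a, i0 (src H a), a)" for a
  define k0 :: "'o \<times> 'b \<Rightarrow> 'p" where "k0 = src H \<circ> snd"
  define k1 :: "'a \<times> ('o \<times> 'b) \<times> 'b \<Rightarrow> 'b" where "k1 = snd \<circ> snd"
  define K where "K = \<lparr>Ob = pullback_topology (i0 ` topspace (Ob H)) k0 (Ob H),
    Ar = pullback_topology (i1 ` topspace (Ar H)) k1 (Ar H),
    src = i0 \<circ> src H \<circ> k1, tgt = i0 \<circ> tgt H \<circ> k1, ide = i1 \<circ> ide H \<circ> k0,
    ginv = i1 \<circ> ginv H \<circ> k1, mul = (\<lambda>a b. i1 (mul H (k1 a) (k1 b)))\<rparr>"
  have k0: "k0 (i0 x) = x" if "x \<in> topspace (Ob H)" for x
    using that by (simp add: k0_def i0_def)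
  have k1: "k1 (i1 a) = a" for a
    by (simp add: k1_def i1_def)
  have "homeomorphic_maps (Ob H) (Ob K) i0 k0"
    unfolding homeomorphic_maps_def
  proof (intro conjI)
    show "continuous_map (Ob H) (Ob K) i0"
      unfolding K_def by (auto simp: k0 intro!: continuous_map_pullback' continuous_map_eq[OF continuous_map_id])
    have "continuous_map (Ob K) (Ob H) (id \<circ> k0)"
      unfolding K_def top_groupoid.select_convs by (rule continuous_map_pullback) simp
    then show "continuous_map (Ob K) (Ob H) k0"
      by simp
  qed (auto simp: k0 K_def topspace_pullback_topology)
  moreover have "homeomorphic_maps (Ar H) (Ar K) i1 k1"
    unfolding homeomorphic_maps_def
  proof (intro conjI)
    show "continuous_map (Ar H) (Ar K) i1"
      unfolding K_def by (auto simp: k1 intro!: continuous_map_pullback' continuous_map_eq[OF continuous_map_id])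
    have "continuous_map (Ar K) (Ar H) (id \<circ> k1)"
      unfolding K_def top_groupoid.select_convs by (rule continuous_map_pullback) simp
    then show "continuous_map (Ar K) (Ar H) k1"
      by simp
  qed (auto simp: k1 K_def topspace_pullback_topology)
  ultimately have iso_i: "groupoid_iso H K (i0, i1)"
    unfolding groupoid_iso_def groupoid_morphism_def
    by (auto simp: homeomorphic_maps_map homeomorphic_imp_continuous_map K_def k0 k1)
  obtain h where h: "groupoid_iso K H h"
    by (rule groupoid_iso_inverse[OF H iso_i])
  have K: "topological_groupoid K" and opK: "open_map (Ar K) (Ob K) (src K)"
    using topological_groupoid_iso[OF H iso_i] open_src_iso[OF H iso_i op] by auto
  show ?thesis
    unfolding Morita_equivalent_def
    using H topological_groupoid_iso[OF H iso] K Morita_morphism_iso[OF K h opK]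
      Morita_morphism_iso[OF K groupoid_iso_compose[OF h iso] opK] by blast
qed

section \<open>Mapping spaces\<close>

lemma topspace_compact_open [simp]:
  "topspace (compact_open_topology X Y) = {f \<in> extensional (topspace X). continuous_map X Y f}"
  (is "_ = ?R")
proof -
  have "?R \<in> {{f \<in> extensional (topspace X). continuous_map X Y f \<and> f ` K \<subseteq> U} | K U.
        compactin X K \<and> openin Y U}"
    by (rule CollectI, rule exI[of _ "{}"], rule exI[of _ "{}"]) auto
  then show ?thesis
    unfolding compact_open_topology_def topology_generated_by_topspace by blast
qed

lemma continuous_map_eval:
  assumes "x \<in> topspace X"
  shows "continuous_map (compact_open_topology X Y) Y (\<lambda>f. f x)"
  unfolding continuous_map_def
proof (intro conjI allI impI)
  show "(\<lambda>f. f x) \<in> topspace (compact_open_topology X Y) \<rightarrow> topspace Y"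
    using assms by (auto simp: continuous_map_def)
next
  fix U assume U: "openin Y U"
  have "openin (compact_open_topology X Y)
    {f \<in> extensional (topspace X). continuous_map X Y f \<and> f ` {x} \<subseteq> U}"
    unfolding compact_open_topology_def using U assms
    by (intro topology_generated_by_Basis CollectI exI[of _ "{x}"] exI[of _ U]) (auto simp: compactin_sing)
  then show "openin (compact_open_topology X Y) {f \<in> topspace (compact_open_topology X Y). f x \<in> U}"
    by (simp add: conj_assoc)
qed

text \<open>A compact set has finite image under \<open>p\<close>, so a subbasic condition on the
  maps reduces to finitely many conditions on the values \<open>f t n\<close>. The general
  \<open>p\<close> covers all later uses: the degree of an arrow, the constant map on objects, and
  the identity of a discrete space.\<close>

lemma continuous_map_into_compact_open_discrete:
  assumes p: "continuous_map X (discrete_topology UNIV) p"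
    and f: "\<And>n. continuous_map T Y (\<lambda>t. f t n)"
  shows "continuous_map T (compact_open_topology X Y) (\<lambda>t. \<lambda>x\<in>topspace X. f t (p x))"
proof -
  have cont: "continuous_map X Y (\<lambda>x\<in>topspace X. f t (p x))" if "t \<in> topspace T" for t
  proof -
    have "continuous_map (discrete_topology UNIV) Y (f t)"
      using f that by (auto simp: continuous_map_def)
    from continuous_map_compose[OF p this] show ?thesis
      by (rule continuous_map_eq) simp
  qed
  have op: "openin T ((\<lambda>t. \<lambda>x\<in>topspace X. f t (p x)) -`
    {f \<in> extensional (topspace X). continuous_map X Y f \<and> f ` K \<subseteq> U} \<inter> topspace T)"
    if K: "compactin X K" and U: "openin Y U" for K U
  proof -
    have "finite (p ` K)"
      using image_compactin[OF K p] by (simp add: compactin_discrete_topology)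
    moreover have "openin T {t \<in> topspace T. f t n \<in> U}" for n
      using f U by (auto simp: continuous_map_def)
    \<comment> \<open>For empty \<open>K\<close> the indexed intersection is the whole type, hence
      the extra factor \<open>topspace T\<close>.\<close>
    ultimately have "openin T ((\<Inter>n\<in>p ` K. {t \<in> topspace T. f t n \<in> U}) \<inter> topspace T)"
      by (intro openin_INT) auto
    moreover have "(\<Inter>n\<in>p ` K. {t \<in> topspace T. f t n \<in> U}) \<inter> topspace T =
      (\<lambda>t. \<lambda>x\<in>topspace X. f t (p x)) -`
        {f \<in> extensional (topspace X). continuous_map X Y f \<and> f ` K \<subseteq> U} \<inter> topspace T"
      using cont compactin_subset_topspace[OF K] by (auto simp: image_subset_iff subset_iff)
    ultimately show ?thesis
      by simp
  qed
  have "(\<lambda>x\<in>topspace X. f t (p x)) \<in> topspace (compact_open_topology X Y)" if "t \<in> topspace T" for t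
    using cont[OF that] by simp
  then show ?thesis
    using op unfolding compact_open_topology_def continuous_on_generated_topo_iff
      topology_generated_by_topspace by blast
qed

lemma continuous_map_into_compact_open_UNIV:
  assumes "\<And>n. continuous_map T Y (\<lambda>t. f t n)"
  shows "continuous_map T (compact_open_topology (discrete_topology UNIV) Y) f"
  using continuous_map_into_compact_open_discrete[of "discrete_topology UNIV" id T Y f] assms
  by (simp add: restrict_def)

section \<open>The groupoid of morphisms from the integers\<close>

context groupoid_space
begin

abbreviation "hom_objects \<equiv> groupoid_morphisms (delooping :: (unit, int) top_groupoid) G"

lemma hom_objects_iff:
  "\<phi> \<in> hom_objects \<longleftrightarrow> fst \<phi> () \<in> topspace (Ob G) \<and>
    (\<forall>n. snd \<phi> n \<in> topspace (Ar G) \<and> src G (snd \<phi> n) = fst \<phi> () \<and> tgt G (snd \<phi> n) = fst \<phi> () \<and>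
      snd \<phi> (- n) = ginv G (snd \<phi> n)) \<and>
    snd \<phi> 0 = ide G (fst \<phi> ()) \<and> (\<forall>m n. snd \<phi> (m + n) = mul G (snd \<phi> m) (snd \<phi> n))"
  by (auto simp: groupoid_morphisms_def groupoid_morphism_def delooping_def composable_def)

lemma hom_object:
  assumes "\<phi> \<in> hom_objects"
  shows "fst \<phi> () \<in> topspace (Ob G)" "snd \<phi> n \<in> topspace (Ar G)" "src G (snd \<phi> n) = fst \<phi> ()"
    "tgt G (snd \<phi> n) = fst \<phi> ()" "snd \<phi> (- n) = ginv G (snd \<phi> n)" "snd \<phi> 0 = ide G (fst \<phi> ())"
    "snd \<phi> (m + n) = mul G (snd \<phi> m) (snd \<phi> n)"
  using assms by (auto simp: hom_objects_iff)

lemma hom_object_eqI: "\<lbrakk>fst \<phi> () = fst \<psi> (); snd \<phi> = snd \<psi>\<rbrakk> \<Longrightarrow> \<phi> = \<psi>" for \<phi> \<psi> :: "('o, 'a) hom_obj"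
  by (auto simp: prod_eq_iff fun_eq_iff)

text \<open>All values of \<open>\<kappa>\<close> are arrows as soon as \<open>\<kappa> 0\<close> is
  one, because the others are composites with it; so membership can be checked at
  \<open>0\<close>.\<close>

lemma hom_arrows_iff:
  "(\<phi>, \<kappa>, \<psi>) \<in> hom_arrows G \<longleftrightarrow> \<phi> \<in> hom_objects \<and> \<psi> \<in> hom_objects \<and> \<kappa> 0 \<in> topspace (Ar G) \<and>
    src G (\<kappa> 0) = fst \<phi> () \<and> tgt G (\<kappa> 0) = fst \<psi> () \<and>
    (\<forall>n. mul G (\<kappa> 0) (snd \<psi> n) = \<kappa> n \<and> mul G (snd \<phi> n) (\<kappa> 0) = \<kappa> n)"
proof -
  have "range \<kappa> \<subseteq> topspace (Ar G)" if a: "\<psi> \<in> hom_objects" "\<kappa> 0 \<in> topspace (Ar G)"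
    "tgt G (\<kappa> 0) = fst \<psi> ()" "\<forall>n. mul G (\<kappa> 0) (snd \<psi> n) = \<kappa> n"
  proof
    fix a assume "a \<in> range \<kappa>"
    then obtain n where n: "a = \<kappa> n"
      by blast
    have "mul G (\<kappa> 0) (snd \<psi> n) \<in> topspace (Ar G)"
      using a(1-3) by (simp add: hom_object)
    then show "a \<in> topspace (Ar G)"
      by (simp add: n a(4))
  qed
  then show ?thesis
    by (auto simp: hom_arrows_def)
qed

lemma hom_arrow:
  assumes "(\<phi>, \<kappa>, \<psi>) \<in> hom_arrows G"
  shows "\<phi> \<in> hom_objects" "\<psi> \<in> hom_objects" "\<kappa> n \<in> topspace (Ar G)"
    "src G (\<kappa> n) = fst \<phi> ()" "tgt G (\<kappa> n) = fst \<psi> ()"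
    "mul G (\<kappa> 0) (snd \<psi> n) = \<kappa> n" "mul G (snd \<phi> n) (\<kappa> 0) = \<kappa> n"
proof -
  have a: "\<phi> \<in> hom_objects" "\<psi> \<in> hom_objects" "range \<kappa> \<subseteq> topspace (Ar G)"
    "mul G (\<kappa> 0) (snd \<psi> n) = \<kappa> n" "mul G (snd \<phi> n) (\<kappa> 0) = \<kappa> n"
    "src G (\<kappa> 0) = fst \<phi> ()" "tgt G (\<kappa> 0) = fst \<psi> ()"
    using assms by (auto simp: hom_arrows_def)
  then show "\<phi> \<in> hom_objects" "\<psi> \<in> hom_objects" "\<kappa> n \<in> topspace (Ar G)"
    "mul G (\<kappa> 0) (snd \<psi> n) = \<kappa> n" "mul G (snd \<phi> n) (\<kappa> 0) = \<kappa> n"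
    by auto
  have "\<kappa> 0 \<in> topspace (Ar G)"
    using a by auto
  then have "src G (mul G (\<kappa> 0) (snd \<psi> n)) = fst \<phi> ()" "tgt G (mul G (\<kappa> 0) (snd \<psi> n)) = fst \<psi> ()"
    using a(1-3) a(6-) by (simp_all add: hom_object)
  then show "src G (\<kappa> n) = fst \<phi> ()" "tgt G (\<kappa> n) = fst \<psi> ()"
    using a(4) by simp_all
qed

abbreviation "Hom \<equiv> integer_hom_groupoid G"

lemma Hom_simps [simp]:
  "src Hom (\<phi>, \<kappa>, \<psi>) = \<phi>" "tgt Hom (\<phi>, \<kappa>, \<psi>) = \<psi>" "ide Hom \<phi> = (\<phi>, snd \<phi>, \<phi>)"
  "ginv Hom (\<phi>, \<kappa>, \<psi>) = (\<psi>, \<lambda>n. mul G (ginv G (\<kappa> 0)) (snd \<phi> n), \<phi>)"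
  "mul Hom (\<phi>, \<kappa>, \<psi>) (\<psi>', \<mu>, \<theta>) =
    (\<phi>, \<lambda>n. mul G (mul G (\<kappa> 0) (\<mu> 0)) (snd \<theta> n), \<theta>)"
  by (simp_all add: integer_hom_groupoid_def)

lemma continuous_map_discrete_UNIV [simp]:
  "continuous_map (discrete_topology UNIV) Y f \<longleftrightarrow> range f \<subseteq> topspace Y"
  by auto

lemma topspace_Hom [simp]: "topspace (Ob Hom) = hom_objects" "topspace (Ar Hom) = hom_arrows G"
  unfolding integer_hom_groupoid_def top_groupoid.select_convs topspace_pullback_topology
  by (auto simp: hom_arrow) (metis hom_object(2) snd_conv)

lemma continuous_map_into_Hom_Ob:
  assumes "\<And>t. t \<in> topspace T \<Longrightarrow> f t \<in> hom_objects"
    and "\<And>n. continuous_map T (Ar G) (\<lambda>t. snd (f t) n)"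
  shows "continuous_map T (Ob Hom) f"
  unfolding integer_hom_groupoid_def top_groupoid.select_convs
  using assms continuous_map_into_compact_open_UNIV[of T "Ar G" "\<lambda>t. snd (f t)"]
  by (intro continuous_map_pullback') (auto simp: o_def)

lemma continuous_map_into_Hom_Ar:
  assumes "\<And>t. t \<in> topspace T \<Longrightarrow> f t \<in> hom_arrows G"
    and "\<And>n. continuous_map T (Ar G) (\<lambda>t. fst (snd (f t)) n)"
  shows "continuous_map T (Ar Hom) f"
  unfolding integer_hom_groupoid_def top_groupoid.select_convs
  using assms continuous_map_into_compact_open_UNIV[of T "Ar G" "\<lambda>t. fst (snd (f t))"]
  by (intro continuous_map_pullback') (auto simp: o_def case_prod_unfold)

lemma continuous_map_Hom_Ob: "continuous_map (Ob Hom) (Ar G) (\<lambda>\<phi>. snd \<phi> n)"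
proof -
  have "continuous_map (Ob Hom) (Ar G) ((\<lambda>f. f n) \<circ> snd)"
    unfolding integer_hom_groupoid_def top_groupoid.select_convs
    by (intro continuous_map_pullback continuous_map_eval) simp
  then show ?thesis
    by (simp add: o_def)
qed

text \<open>The topology on objects is pulled back along \<open>snd\<close> alone, so the base
  object has to be recovered as the source of the value at \<open>0\<close>.\<close>

lemma continuous_map_Hom_base: "continuous_map (Ob Hom) (Ob G) (\<lambda>\<phi>. fst \<phi> ())"
  by (rule continuous_map_eq[OF continuous_map_compose[OF continuous_map_Hom_Ob[of 0] continuous_src]])
    (simp add: hom_object)

lemma continuous_map_Hom_Ar: "continuous_map (Ar Hom) (Ar G) (\<lambda>c. fst (snd c) n)"
proof -
  have "continuous_map (Ar Hom) (Ar G) ((\<lambda>f. f n) \<circ> (\<lambda>(\<phi>, \<kappa>, \<psi>). \<kappa>))"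
    unfolding integer_hom_groupoid_def top_groupoid.select_convs
    by (intro continuous_map_pullback continuous_map_eval) simp
  then show ?thesis
    by (simp add: o_def case_prod_unfold)
qed

text \<open>The topology on arrows records only \<open>\<kappa>\<close>. The source is recovered
  from it: \<open>snd \<phi> n\<close> is \<open>\<kappa> n\<close> times the inverse of
  \<open>\<kappa> 0\<close>. For the target the inverse stands on the left.\<close>

lemma continuous_map_Hom_src: "continuous_map (Ar Hom) (Ar G) (\<lambda>c. snd (src Hom c) n)"
proof -
  have "continuous_map (Ar Hom) (Ar G) (\<lambda>c. mul G (fst (snd c) n) (ginv G (fst (snd c) 0)))"
    by (intro continuous_map_mul continuous_map_ginv continuous_map_Hom_Ar) (auto simp: hom_arrow)
  then show ?thesis
  proof (rule continuous_map_eq)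
    fix c assume "c \<in> topspace (Ar Hom)"
    then obtain \<phi> \<kappa> \<psi> where c: "c = (\<phi>, \<kappa>, \<psi>)" "(\<phi>, \<kappa>, \<psi>) \<in> hom_arrows G"
      by (cases c) auto
    have "mul G (mul G (snd \<phi> n) (\<kappa> 0)) (ginv G (\<kappa> 0)) = snd \<phi> n"
      using c hom_arrow[OF c(2)] by (intro mul_mul_ginv) (simp_all add: hom_object)
    then show "mul G (fst (snd c) n) (ginv G (fst (snd c) 0)) = snd (src Hom c) n"
      using c by (simp add: hom_arrow)
  qed
qed

lemma continuous_map_Hom_tgt: "continuous_map (Ar Hom) (Ar G) (\<lambda>c. snd (tgt Hom c) n)"
proof -
  have "continuous_map (Ar Hom) (Ar G) (\<lambda>c. mul G (ginv G (fst (snd c) 0)) (fst (snd c) n))"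
    by (intro continuous_map_mul continuous_map_ginv continuous_map_Hom_Ar) (auto simp: hom_arrow)
  then show ?thesis
  proof (rule continuous_map_eq)
    fix c assume "c \<in> topspace (Ar Hom)"
    then obtain \<phi> \<kappa> \<psi> where c: "c = (\<phi>, \<kappa>, \<psi>)" "(\<phi>, \<kappa>, \<psi>) \<in> hom_arrows G"
      by (cases c) auto
    have "mul G (ginv G (\<kappa> 0)) (mul G (\<kappa> 0) (snd \<psi> n)) = snd \<psi> n"
      using c hom_arrow[OF c(2)] by (intro ginv_mul_cancel) (simp_all add: hom_object)
    then show "mul G (ginv G (fst (snd c) 0)) (fst (snd c) n) = snd (tgt Hom c) n"
      using c by (simp add: hom_arrow)
  qed
qed

lemma Hom_arrow:
  assumes "c \<in> hom_arrows G"
  shows "src Hom c \<in> hom_objects" "tgt Hom c \<in> hom_objects" "fst (snd c) n \<in> topspace (Ar G)"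
    "src G (fst (snd c) n) = fst (src Hom c) ()" "tgt G (fst (snd c) n) = fst (tgt Hom c) ()"
  using assms by (cases c; simp add: hom_arrow)+

lemma ide_in_hom_arrows: "\<phi> \<in> hom_objects \<Longrightarrow> (\<phi>, snd \<phi>, \<phi>) \<in> hom_arrows G"
  by (simp add: hom_arrows_iff hom_object ide_mul mul_ide)

lemma ginv_in_hom_arrows:
  assumes c: "(\<phi>, \<kappa>, \<psi>) \<in> hom_arrows G"
  shows "(\<psi>, \<lambda>n. mul G (ginv G (\<kappa> 0)) (snd \<phi> n), \<phi>) \<in> hom_arrows G"
proof -
  note h = hom_arrow[OF c]
  have 0: "mul G (ginv G (\<kappa> 0)) (snd \<phi> 0) = ginv G (\<kappa> 0)"
    using h by (simp add: hom_object mul_ide)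
  have "mul G (snd \<psi> n) (ginv G (\<kappa> 0)) = mul G (ginv G (\<kappa> 0)) (snd \<phi> n)" for n
  proof -
    have "snd \<psi> n = mul G (ginv G (\<kappa> 0)) (mul G (snd \<phi> n) (\<kappa> 0))"
      using h ginv_mul_cancel[of "\<kappa> 0" "snd \<psi> n"] by (simp add: hom_object)
    also have "\<dots> = mul G (mul G (ginv G (\<kappa> 0)) (snd \<phi> n)) (\<kappa> 0)"
      using h by (subst mul_assoc) (simp_all add: hom_object)
    finally show ?thesis
      using h mul_mul_ginv[of "\<kappa> 0" "mul G (ginv G (\<kappa> 0)) (snd \<phi> n)"] by (simp add: hom_object)
  qed
  with 0 h show ?thesis
    by (simp add: hom_arrows_iff)
qed

lemma mul_in_hom_arrows:
  assumes c: "(\<phi>, \<kappa>, \<psi>) \<in> hom_arrows G" and d: "(\<psi>, \<mu>, \<theta>) \<in> hom_arrows G"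
  shows "(\<phi>, \<lambda>n. mul G (mul G (\<kappa> 0) (\<mu> 0)) (snd \<theta> n), \<theta>) \<in> hom_arrows G"
proof -
  note h = hom_arrow[OF c] hom_arrow[OF d]
  have 0: "mul G (mul G (\<kappa> 0) (\<mu> 0)) (snd \<theta> 0) = mul G (\<kappa> 0) (\<mu> 0)"
    using h by (simp add: hom_object mul_ide)
  have "mul G (snd \<phi> n) (mul G (\<kappa> 0) (\<mu> 0)) = mul G (mul G (\<kappa> 0) (\<mu> 0)) (snd \<theta> n)" for n
  proof -
    have "mul G (snd \<phi> n) (mul G (\<kappa> 0) (\<mu> 0)) = mul G (mul G (snd \<phi> n) (\<kappa> 0)) (\<mu> 0)"
      using h by (subst mul_assoc) (simp_all add: hom_object)
    also have "\<dots> = mul G (mul G (\<kappa> 0) (snd \<psi> n)) (\<mu> 0)"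
      using h by simp
    also have "\<dots> = mul G (\<kappa> 0) (mul G (snd \<psi> n) (\<mu> 0))"
      using h(1-6) h(8-) by (subst mul_assoc) (simp_all add: hom_object)
    also have "\<dots> = mul G (\<kappa> 0) (mul G (\<mu> 0) (snd \<theta> n))"
      using h by simp
    also have "\<dots> = mul G (mul G (\<kappa> 0) (\<mu> 0)) (snd \<theta> n)"
      using h by (subst mul_assoc) (simp_all add: hom_object)
    finally show ?thesis .
  qed
  with 0 h show ?thesis
    by (simp add: hom_arrows_iff)
qed

lemma topological_groupoid_Hom: "topological_groupoid Hom"
  unfolding topological_groupoid_def
proof (intro conjI)
  show "continuous_map (Ar Hom) (Ob Hom) (src Hom)"
    by (rule continuous_map_into_Hom_Ob[OF _ continuous_map_Hom_src]) (auto simp: hom_arrow)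
  show "continuous_map (Ar Hom) (Ob Hom) (tgt Hom)"
    by (rule continuous_map_into_Hom_Ob[OF _ continuous_map_Hom_tgt]) (auto simp: hom_arrow)
  show "continuous_map (Ob Hom) (Ar Hom) (ide Hom)"
    by (rule continuous_map_into_Hom_Ar) (auto simp: ide_in_hom_arrows continuous_map_Hom_Ob)
  show "continuous_map (Ar Hom) (Ar Hom) (ginv Hom)"
  proof (rule continuous_map_into_Hom_Ar)
    show "continuous_map (Ar Hom) (Ar G) (\<lambda>c. fst (snd (ginv Hom c)) n)" for n
    proof (rule continuous_map_eq)
      show "continuous_map (Ar Hom) (Ar G)
        (\<lambda>c. mul G (ginv G (fst (snd c) 0)) (snd (src Hom c) n))"
        by (intro continuous_map_mul continuous_map_ginv continuous_map_Hom_Ar continuous_map_Hom_src)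
          (simp_all add: Hom_arrow hom_object)
    qed auto
    show "ginv Hom c \<in> hom_arrows G" if "c \<in> topspace (Ar Hom)" for c
      using that by (cases c) (simp add: ginv_in_hom_arrows)
  qed
  show "continuous_map (subtopology (prod_topology (Ar Hom) (Ar Hom)) (composable Hom)) (Ar Hom)
    (\<lambda>(a, b). mul Hom a b)" (is "continuous_map ?X _ _")
  proof (rule continuous_map_into_Hom_Ar)
    have 1: "continuous_map ?X (Ar G) (\<lambda>p. fst (snd (fst p)) n)" for n
      by (rule continuous_map_compose[OF continuous_map_subtopology_fst continuous_map_Hom_Ar,
            unfolded o_def])
    have 2: "continuous_map ?X (Ar G) (\<lambda>p. fst (snd (snd p)) n)" for n
      by (rule continuous_map_compose[OF continuous_map_subtopology_snd continuous_map_Hom_Ar,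
            unfolded o_def])
    have 3: "continuous_map ?X (Ar G) (\<lambda>p. snd (tgt Hom (snd p)) n)" for n
      by (rule continuous_map_compose[OF continuous_map_subtopology_snd continuous_map_Hom_tgt,
            unfolded o_def])
    show "continuous_map ?X (Ar G) (\<lambda>p. fst (snd (case p of (a, b) \<Rightarrow> mul Hom a b)) n)" for n
    proof (rule continuous_map_eq)
      show "continuous_map ?X (Ar G) (\<lambda>p. mul G (mul G (fst (snd (fst p)) 0) (fst (snd (snd p)) 0))
          (snd (tgt Hom (snd p)) n))"
        by (intro continuous_map_mul 1 2 3)
          (simp_all add: composable_def case_prod_unfold mem_Times_iff Hom_arrow hom_object)
    qed auto
    show "(case p of (a, b) \<Rightarrow> mul Hom a b) \<in> hom_arrows G" if "p \<in> topspace ?X" for p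
    proof -
      obtain \<phi> \<kappa> \<psi> \<psi>' \<mu> \<theta> where p: "p = ((\<phi>, \<kappa>, \<psi>), \<psi>', \<mu>, \<theta>)"
        by (metis prod.exhaust)
      with that show ?thesis
        by (auto simp: composable_def intro: mul_in_hom_arrows)
    qed
  qed
  show "\<forall>x\<in>topspace (Ob Hom). src Hom (ide Hom x) = x \<and> tgt Hom (ide Hom x) = x"
    by simp
  show "\<forall>(a, b)\<in>composable Hom. src Hom (mul Hom a b) = src Hom a \<and> tgt Hom (mul Hom a b) = tgt Hom b"
    by (auto simp: composable_def)
  show "\<forall>a b c. (a, b) \<in> composable Hom \<longrightarrow> (b, c) \<in> composable Hom \<longrightarrow>
        mul Hom (mul Hom a b) c = mul Hom a (mul Hom b c)"
  proof (intro allI impI)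
    fix a b c assume "(a, b) \<in> composable Hom" "(b, c) \<in> composable Hom"
    then obtain \<phi> \<kappa> \<psi> \<mu> \<theta> \<nu> \<omega> where abc: "a = (\<phi>, \<kappa>, \<psi>)" "b = (\<psi>, \<mu>, \<theta>)" "c = (\<theta>, \<nu>, \<omega>)"
      and *: "(\<phi>, \<kappa>, \<psi>) \<in> hom_arrows G" "(\<psi>, \<mu>, \<theta>) \<in> hom_arrows G" "(\<theta>, \<nu>, \<omega>) \<in> hom_arrows G"
      by (cases a; cases b; cases c) (auto simp: composable_def)
    note h = hom_arrow(1-5)[OF *(1)] hom_arrow(1-5)[OF *(2)] hom_arrow(1-5)[OF *(3)]
    show "mul Hom (mul Hom a b) c = mul Hom a (mul Hom b c)"
      unfolding abc using h by (simp add: hom_object mul_ide mul_assoc)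
  qed
  show "\<forall>a\<in>topspace (Ar Hom).
        mul Hom (ide Hom (src Hom a)) a = a \<and> mul Hom a (ide Hom (tgt Hom a)) = a \<and>
        src Hom (ginv Hom a) = tgt Hom a \<and> tgt Hom (ginv Hom a) = src Hom a \<and>
        mul Hom a (ginv Hom a) = ide Hom (src Hom a) \<and> mul Hom (ginv Hom a) a = ide Hom (tgt Hom a)"
  proof
    fix a assume "a \<in> topspace (Ar Hom)"
    then obtain \<phi> \<kappa> \<psi> where a: "a = (\<phi>, \<kappa>, \<psi>)" and *: "(\<phi>, \<kappa>, \<psi>) \<in> hom_arrows G"
      by (cases a) auto
    note h = hom_arrow[OF *]
    show "mul Hom (ide Hom (src Hom a)) a = a \<and> mul Hom a (ide Hom (tgt Hom a)) = a \<and>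
        src Hom (ginv Hom a) = tgt Hom a \<and> tgt Hom (ginv Hom a) = src Hom a \<and>
        mul Hom a (ginv Hom a) = ide Hom (src Hom a) \<and> mul Hom (ginv Hom a) a = ide Hom (tgt Hom a)"
      unfolding a using h by (simp add: hom_object mul_ide ide_mul mul_ginv ginv_mul)
  qed
qed

text \<open>An arrow of \<open>Hom\<close> is its source together with the value at \<open>0\<close>, so a local section
  of \<open>src G\<close> through that value induces a local section of \<open>src Hom\<close>.\<close>

lemma conjugate_in_hom_arrows:
  assumes \<phi>: "\<phi> \<in> hom_objects" and a: "a \<in> topspace (Ar G)" "src G a = fst \<phi> ()"
  shows "(\<phi>, \<lambda>n. mul G (snd \<phi> n) a, (\<lambda>_. tgt G a, \<lambda>n. mul G (ginv G a) (mul G (snd \<phi> n) a)))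
    \<in> hom_arrows G"
proof -
  note h = hom_object[OF \<phi>]
  let ?\<psi> = "(\<lambda>_ :: unit. tgt G a, \<lambda>n. mul G (ginv G a) (mul G (snd \<phi> n) a))"
  have m: "mul G (snd \<phi> n) a \<in> topspace (Ar G)" "src G (mul G (snd \<phi> n) a) = fst \<phi> ()"
    "tgt G (mul G (snd \<phi> n) a) = tgt G a" for n
    using h a by simp_all
  have a\<psi>: "mul G a (snd ?\<psi> n) = mul G (snd \<phi> n) a" for n
    using m a by (simp add: mul_ginv_cancel)
  have "?\<psi> \<in> hom_objects"
    unfolding hom_objects_iff
  proof (intro conjI allI)
    show "snd ?\<psi> (- n) = ginv G (snd ?\<psi> n)" for n
    proof -
      \<comment> \<open>A left inverse is enough: multiplying by \<open>ginv\<close> on the right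
        turns this into the claim.\<close>
      have "mul G (snd ?\<psi> (- n)) (snd ?\<psi> n) = ide G (tgt G a)"
      proof -
        have "mul G (snd ?\<psi> (- n)) (snd ?\<psi> n) = mul G (ginv G a) (mul G (snd \<phi> (- n)) (mul G a (snd ?\<psi> n)))"
          using m a h by (simp add: mul_assoc)
        also have "\<dots> = mul G (ginv G a) (mul G (mul G (snd \<phi> (- n)) (snd \<phi> n)) a)"
          unfolding a\<psi> using a h by (subst mul_assoc) simp_all
        also have "\<dots> = ide G (tgt G a)"
          using a h(1-4) by (simp add: ide_mul ginv_mul flip: hom_object(7)[OF \<phi>])
            (simp add: hom_object(6)[OF \<phi>] ide_mul ginv_mul)
        finally show ?thesis .
      qed
      then have "mul G (mul G (snd ?\<psi> (- n)) (snd ?\<psi> n)) (ginv G (snd ?\<psi> n)) = ginv G (snd ?\<psi> n)"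
        using m a by (simp add: ide_mul)
      then show ?thesis
        using m a by (simp add: mul_mul_ginv)
    qed
    show "snd ?\<psi> (m' + n) = mul G (snd ?\<psi> m') (snd ?\<psi> n)" for m' n
    proof -
      have "mul G (snd ?\<psi> m') (snd ?\<psi> n) = mul G (ginv G a) (mul G (snd \<phi> m') (mul G a (snd ?\<psi> n)))"
        using m a h by (simp add: mul_assoc)
      also have "\<dots> = mul G (ginv G a) (mul G (mul G (snd \<phi> m') (snd \<phi> n)) a)"
        unfolding a\<psi> using a h by (subst mul_assoc) simp_all
      finally show ?thesis
        by (simp add: hom_object(7)[OF \<phi>])
    qed
  qed (use m a in \<open>simp_all add: hom_object(6)[OF \<phi>] ide_mul ginv_mul\<close>)
  then show ?thesis
    unfolding hom_arrows_iff using \<phi> a a\<psi> by (simp add: hom_object(6)[OF \<phi>] ide_mul)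
qed

lemma open_src_Hom:
  assumes loc: "\<And>a. a \<in> topspace (Ar G) \<Longrightarrow> \<exists>S \<sigma>. openin (Ob G) S \<and> src G a \<in> S \<and> \<sigma> (src G a) = a \<and>
    continuous_map (subtopology (Ob G) S) (Ar G) \<sigma> \<and> (\<forall>x\<in>S. src G (\<sigma> x) = x)"
  shows "open_map (Ar Hom) (Ob Hom) (src Hom)"
  unfolding open_map_def
proof (intro allI impI)
  fix V assume V: "openin (Ar Hom) V"
  show "openin (Ob Hom) (src Hom ` V)"
  proof (subst openin_subopen, intro ballI)
    fix \<phi> assume "\<phi> \<in> src Hom ` V"
    then obtain \<kappa> \<psi> where V\<phi>: "(\<phi>, \<kappa>, \<psi>) \<in> V"
      by auto
    then have *: "(\<phi>, \<kappa>, \<psi>) \<in> hom_arrows G"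
      using openin_subset[OF V] by auto
    note h = hom_arrow[OF *]
    obtain S \<sigma> where S: "openin (Ob G) S" "fst \<phi> () \<in> S" "\<sigma> (fst \<phi> ()) = \<kappa> 0"
      and \<sigma>: "continuous_map (subtopology (Ob G) S) (Ar G) \<sigma>" "\<And>x. x \<in> S \<Longrightarrow> src G (\<sigma> x) = x"
      using loc[OF h(3)[of 0]] h(4) by auto
    have SO: "S \<subseteq> topspace (Ob G)"
      using S openin_subset by auto
    have \<sigma>_in: "\<sigma> x \<in> topspace (Ar G)" if "x \<in> S" for x
      using \<sigma>(1) that SO by (auto simp: continuous_map_def)
    define D where "D = {\<phi> \<in> hom_objects. fst \<phi> () \<in> S}"
    \<comment> \<open>A continuous section of \<open>src Hom\<close> over \<open>D\<close>: each
      \<open>\<phi>\<close> is conjugated by the arrow that \<open>\<sigma>\<close> attaches to its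
      base object.\<close>
    define \<tau> where "\<tau> \<phi> = (\<phi>, \<lambda>n. mul G (snd \<phi> n) (\<sigma> (fst \<phi> ())),
      (\<lambda>_::unit. tgt G (\<sigma> (fst \<phi> ())),
        \<lambda>n. mul G (ginv G (\<sigma> (fst \<phi> ()))) (mul G (snd \<phi> n) (\<sigma> (fst \<phi> ())))))"
      for \<phi> :: "('o, 'a) hom_obj"
    have \<tau>_in: "\<tau> \<phi> \<in> hom_arrows G" if "\<phi> \<in> D" for \<phi>
      using that \<sigma>_in \<sigma>(2) unfolding \<tau>_def D_def by (intro conjugate_in_hom_arrows) auto
    have D: "openin (Ob Hom) D"
      using openin_continuous_map_preimage[OF continuous_map_Hom_base S(1)] by (simp add: D_def)
    have "continuous_map (subtopology (Ob Hom) D) (Ar Hom) \<tau>"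
    proof (rule continuous_map_into_Hom_Ar)
      have 1: "continuous_map (subtopology (Ob Hom) D) (Ar G) (\<lambda>\<phi>. snd \<phi> n)" for n
        by (rule continuous_map_from_subtopology[OF continuous_map_Hom_Ob])
      have 2: "continuous_map (subtopology (Ob Hom) D) (Ar G) (\<lambda>\<phi>. \<sigma> (fst \<phi> ()))"
        by (rule continuous_map_compose[OF _ \<sigma>(1), unfolded o_def])
          (auto simp: continuous_map_in_subtopology D_def intro: continuous_map_from_subtopology[OF continuous_map_Hom_base])
      show "continuous_map (subtopology (Ob Hom) D) (Ar G) (\<lambda>\<phi>. fst (snd (\<tau> \<phi>)) n)" for n
        unfolding \<tau>_def fst_conv snd_conv
        by (rule continuous_map_mul[OF 1 2]) (auto simp: D_def hom_object \<sigma>)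
    qed (auto simp: \<tau>_in)
    from openin_continuous_map_preimage[OF this V]
    have "openin (subtopology (Ob Hom) D) {\<phi> \<in> D. \<tau> \<phi> \<in> V}"
      by (rule back_subst[of "openin _"]) (auto simp: D_def)
    then have "openin (Ob Hom) {\<phi> \<in> D. \<tau> \<phi> \<in> V}"
      using D openin_trans_full by blast
    \<comment> \<open>The section passes through the given arrow, since \<open>\<sigma>\<close>
      takes the value \<open>\<kappa> 0\<close> at the base object and \<open>\<psi>\<close> is then
      forced.\<close>
    moreover have "\<tau> \<phi> = (\<phi>, \<kappa>, \<psi>)"
    proof -
      have "mul G (ginv G (\<kappa> 0)) (\<kappa> n) = snd \<psi> n" for n
        using h ginv_mul_cancel[of "\<kappa> 0" "snd \<psi> n"] by (simp add: hom_object)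
      then show ?thesis
        unfolding \<tau>_def S(3) using h by (auto simp: prod_eq_iff fun_eq_iff)
    qed
    then have "\<phi> \<in> {\<phi> \<in> D. \<tau> \<phi> \<in> V}"
      using V\<phi> h S by (simp add: D_def)
    moreover have "{\<phi> \<in> D. \<tau> \<phi> \<in> V} \<subseteq> src Hom ` V"
    proof
      fix \<phi> assume "\<phi> \<in> {\<phi> \<in> D. \<tau> \<phi> \<in> V}"
      then show "\<phi> \<in> src Hom ` V"
        by (intro image_eqI[of _ _ "\<tau> \<phi>"]) (auto simp: \<tau>_def)
    qed
    ultimately show "\<exists>U. openin (Ob Hom) U \<and> \<phi> \<in> U \<and> U \<subseteq> src Hom ` V"
      by blast
  qed
qed

end

lemma local_diffeomorphism_local_section:
  assumes f: "local_diffeomorphism X A Y B f" and p: "p \<in> topspace X"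
  obtains S \<sigma> where "openin Y S" "f p \<in> S" "\<sigma> (f p) = p"
    "continuous_map (subtopology Y S) X \<sigma>" "\<forall>y\<in>S. f (\<sigma> y) = y"
proof -
  obtain N where N: "p \<in> N" "inj_on f N" "smooth_on_open Y B X A (f ` N) (inv_into N f)"
    using f p unfolding local_diffeomorphism_def by blast
  show thesis
    using N by (intro that[of "f ` N" "inv_into N f"]) (auto simp: smooth_on_open_def f_inv_into_f)
qed

section \<open>Covers of the circle\<close>

lemma breaks_add_int [simp]: "p + of_int k \<in> breaks W \<longleftrightarrow> p \<in> breaks W"
proof
  assume "p + of_int k \<in> breaks W"
  then obtain q j where q: "q \<in> fst W" "p + of_int k = q + of_int j"
    by (auto simp: breaks_def)
  then have "p = q + of_int (j - k)"
    by simp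
  then show "p \<in> breaks W"
    using q unfolding breaks_def by blast
next
  assume "p \<in> breaks W"
  then obtain q j where q: "q \<in> fst W" "p = q + of_int j"
    by (auto simp: breaks_def)
  then have "p + of_int k = q + of_int (j + k)"
    by simp
  then show "p + of_int k \<in> breaks W"
    using q unfolding breaks_def by blast
qed

lemma breaks_diff_int [simp]: "p - of_int k \<in> breaks W \<longleftrightarrow> p \<in> breaks W"
  using breaks_add_int[of p "- k"] by simp

lemma fst_subset_breaks: "fst W \<subseteq> breaks W"
proof
  fix q assume "q \<in> fst W"
  then have "q + of_int 0 \<in> breaks W"
    unfolding breaks_def by blast
  then show "q \<in> breaks W"
    by simp
qed

lemma finite_breaks:
  assumes "finite (fst W)"
  shows "finite (breaks W \<inter> {a..b})"
proof (rule finite_subset)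
  show "breaks W \<inter> {a..b} \<subseteq> (\<Union>q\<in>fst W. (\<lambda>k. q + of_int k) ` {\<lceil>a - q\<rceil>..\<lfloor>b - q\<rfloor>})"
  proof
    fix p assume p: "p \<in> breaks W \<inter> {a..b}"
    then obtain q k where q: "q \<in> fst W" "p = q + of_int k"
      by (auto simp: breaks_def)
    then have "k \<in> {\<lceil>a - q\<rceil>..\<lfloor>b - q\<rfloor>}"
      using p by (simp add: ceiling_le_iff le_floor_iff)
    then show "p \<in> (\<Union>q\<in>fst W. (\<lambda>k. q + of_int k) ` {\<lceil>a - q\<rceil>..\<lfloor>b - q\<rfloor>})"
      using q by blast
  qed
qed (use assms in simp)

text \<open>An integer translation moves one of two close break points into the finite set
  \<open>fst W\<close>, so only finitely many distances below 1 occur.\<close>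

lemma breaks_gap:
  assumes "finite (fst W)"
  obtains \<delta> where "0 < \<delta>"
    "\<And>p p'. \<lbrakk>p \<in> breaks W; p' \<in> breaks W; p \<noteq> p'\<rbrakk> \<Longrightarrow> \<delta> \<le> \<bar>p - p'\<bar>"
proof -
  define M where "M = Max (insert 1 (abs ` fst W))"
  have M: "\<bar>q\<bar> \<le> M" if "q \<in> fst W" for q
    unfolding M_def using assms that by (intro Max_ge) auto
  \<comment> \<open>Since \<open>M\<close> bounds \<open>fst W\<close>, the window contains every
    break point within distance 1 of a point of \<open>fst W\<close>. The inserted 1 keeps
    \<open>D\<close> nonempty and accounts for pairs at distance at least 1.\<close>
  define D where "D = insert 1 ((\<lambda>(q, r). \<bar>q - r\<bar>) `
    {(q, r) \<in> fst W \<times> (breaks W \<inter> {- M - 1..M + 1}). q \<noteq> r})"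
  have "{(q, r) \<in> fst W \<times> (breaks W \<inter> {- M - 1..M + 1}). q \<noteq> r}
      \<subseteq> fst W \<times> (breaks W \<inter> {- M - 1..M + 1})"
    by auto
  then have "finite {(q, r) \<in> fst W \<times> (breaks W \<inter> {- M - 1..M + 1}). q \<noteq> r}"
    by (rule finite_subset) (simp add: assms finite_breaks)
  then have fin: "finite D"
    unfolding D_def by simp
  show thesis
  proof (rule that)
    show "0 < Min D"
      using fin by (subst Min_gr_iff) (auto simp: D_def)
  next
    fix p p' assume p: "p \<in> breaks W" "p' \<in> breaks W" "p \<noteq> p'"
    show "Min D \<le> \<bar>p - p'\<bar>"
    proof (cases "\<bar>p - p'\<bar> < 1")
      case True
      obtain q k where q: "q \<in> fst W" "p = q + of_int k"
        using p by (auto simp: breaks_def)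
      have "\<bar>q - (p' - of_int k)\<bar> \<in> D"
        unfolding D_def using q p True M[OF q(1)]
        by (intro insertI2 image_eqI[of _ _ "(q, p' - of_int k)"]) auto
      then show ?thesis
        using fin q by (simp add: Min_le algebra_simps)
    next
      case False
      moreover have "Min D \<le> 1"
        using fin by (rule Min_le) (simp add: D_def)
      ultimately show ?thesis
        by linarith
    qed
  qed
qed

lemma break_le:
  assumes "fst W \<noteq> {}"
  shows "\<exists>p\<in>breaks W. p \<le> x"
proof -
  obtain q where q: "q \<in> breaks W"
    using assms fst_subset_breaks by blast
  show ?thesis
    by (rule bexI[of _ "q + of_int \<lfloor>x - q\<rfloor>"]) (use q in \<open>simp_all, linarith\<close>)
qed

lemma break_gt:
  assumes "fst W \<noteq> {}"
  shows "\<exists>p\<in>breaks W. x < p"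
proof -
  obtain q where q: "q \<in> breaks W"
    using assms fst_subset_breaks by blast
  show ?thesis
    by (rule bexI[of _ "q + of_int (\<lfloor>x - q\<rfloor> + 1)"]) (use q breaks_add_int in \<open>auto simp del: of_int_add, linarith\<close>)
qed

section \<open>Locating points and indices among the break points\<close>

lemma coarsen_eqI:
  "\<lbrakk>z \<in> breaks W; z \<le> x; \<And>p. \<lbrakk>p \<in> breaks W; p \<le> x\<rbrakk> \<Longrightarrow> p \<le> z\<rbrakk> \<Longrightarrow> coarsen W x = z"
  unfolding coarsen_def by (rule cSup_eq_maximum) auto

lemma coarsen_cong: "(\<And>p. p \<in> breaks W \<Longrightarrow> p \<le> x \<longleftrightarrow> p \<le> y) \<Longrightarrow> coarsen W x = coarsen W y"
  unfolding coarsen_def by (rule arg_cong[of _ _ Sup]) auto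

lemma next_break_eqI:
  "\<lbrakk>z \<in> breaks W; b < z; \<And>p. \<lbrakk>p \<in> breaks W; b < p\<rbrakk> \<Longrightarrow> z \<le> p\<rbrakk> \<Longrightarrow> next_break W b = z"
  unfolding next_break_def by (rule cInf_eq_minimum) auto

lemma admissible_fst:
  "W \<in> admissible_covers \<Longrightarrow> finite (fst W)" "W \<in> admissible_covers \<Longrightarrow> fst W \<noteq> {}"
  "W \<in> admissible_covers \<Longrightarrow> 0 < snd W" "W \<in> admissible_covers \<Longrightarrow> fst W \<subseteq> {0<..1}"
  by (auto simp: admissible_covers_def)

context
  fixes W :: cover assumes W: "finite (fst W)" "fst W \<noteq> {}"
begin

text \<open>\<open>coarsen W\<close> is the floor function of the locally finite set
  \<open>breaks W\<close>, and these three facts characterise it. The supremum is a maximum because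
  only the finite window from some break point \<open>a\<close> up to \<open>x\<close>
  matters.\<close>

lemma coarsen_in: "coarsen W x \<in> breaks W"
  and coarsen_le: "coarsen W x \<le> x"
  and le_coarsen: "\<lbrakk>p \<in> breaks W; p \<le> x\<rbrakk> \<Longrightarrow> p \<le> coarsen W x"
proof -
  obtain a where a: "a \<in> breaks W" "a \<le> x"
    using break_le[OF W(2)] by blast
  let ?A = "breaks W \<inter> {a..x}"
  have fin: "finite ?A" and ne: "?A \<noteq> {}"
    using finite_breaks[OF W(1)] a by auto
  have M: "Max ?A \<in> ?A"
    using fin ne by (rule Max_in)
  have "p \<le> Max ?A" if "p \<in> breaks W" "p \<le> x" for p
    using Max_ge[OF fin, of p] M that by (cases "a \<le> p") auto
  moreover from this M have "coarsen W x = Max ?A"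
    by (intro coarsen_eqI) auto
  ultimately show "coarsen W x \<in> breaks W" "coarsen W x \<le> x"
    "\<lbrakk>p \<in> breaks W; p \<le> x\<rbrakk> \<Longrightarrow> p \<le> coarsen W x"
    using M by auto
qed

lemma next_break_in: "next_break W b \<in> breaks W"
  and less_next_break: "b < next_break W b"
  and next_break_le: "\<lbrakk>p \<in> breaks W; b < p\<rbrakk> \<Longrightarrow> next_break W b \<le> p"
proof -
  obtain c where c: "c \<in> breaks W" "b < c"
    using break_gt[OF W(2)] by blast
  let ?A = "breaks W \<inter> {b..c} - {b}"
  have fin: "finite ?A" and ne: "?A \<noteq> {}"
    using finite_breaks[OF W(1)] c by auto
  have M: "Min ?A \<in> ?A"
    using fin ne by (rule Min_in)
  have "Min ?A \<le> p" if "p \<in> breaks W" "b < p" for p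
    using Min_le[OF fin, of p] M that by (cases "p \<le> c") auto
  moreover from this M have "next_break W b = Min ?A"
    by (intro next_break_eqI) auto
  ultimately show "next_break W b \<in> breaks W" "b < next_break W b"
    "\<lbrakk>p \<in> breaks W; b < p\<rbrakk> \<Longrightarrow> next_break W b \<le> p"
    using M by auto
qed

lemma le_coarsen_iff: "p \<in> breaks W \<Longrightarrow> p \<le> coarsen W x \<longleftrightarrow> p \<le> x"
  using le_coarsen coarsen_le order_trans by blast

text \<open>A break point of the coarser cover \<open>W'\<close> is also one of \<open>W\<close>, so
  it lies at or below \<open>x\<close> exactly when it lies at or below \<open>coarsen W x\<close>.
  This makes pullback along refinements functorial and the index around a point compatible with
  refinement.\<close>

lemma coarsen_coarsen:
  "breaks W' \<subseteq> breaks W \<Longrightarrow> coarsen W' (coarsen W x) = coarsen W' x"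
  by (rule coarsen_cong) (use le_coarsen_iff in auto)

lemma coarsen_add_int: "coarsen W (x + of_int k) = coarsen W x + of_int k"
proof (rule coarsen_eqI)
  fix p assume p: "p \<in> breaks W" "p \<le> x + of_int k"
  then have "p - of_int k \<le> coarsen W x"
    by (intro le_coarsen) auto
  then show "p \<le> coarsen W x + of_int k"
    by simp
qed (simp_all add: coarsen_in coarsen_le)

lemma next_break_add_int: "next_break W (b + of_int k) = next_break W b + of_int k"
proof (rule next_break_eqI)
  fix p assume p: "p \<in> breaks W" "b + of_int k < p"
  then have "next_break W b \<le> p - of_int k"
    by (intro next_break_le) auto
  then show "next_break W b + of_int k \<le> p"
    by simp
qed (simp_all add: next_break_in less_next_break)

lemma ivl_add_int: "x + of_int k \<in> ivl W (b + of_int k) \<longleftrightarrow> x \<in> ivl W b"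
  by (auto simp: ivl_def next_break_add_int)

lemma less_next_coarsen: "x < next_break W (coarsen W x)"
  using le_coarsen[OF next_break_in] less_next_break[of "coarsen W x"] by (meson leD not_less)

lemma in_ivl_coarsen: "0 < snd W \<Longrightarrow> x \<in> ivl W (coarsen W x)"
  using coarsen_le[of x] less_next_coarsen[of x] by (simp add: ivl_def)

text \<open>The intervals exceed their break points by only \<open>snd W\<close> at either end. If
  \<open>x\<close> is not that close to \<open>p\<close>, the index of an interval through
  \<open>x\<close> is on the same side of \<open>p\<close> as \<open>x\<close>; ambiguity of the
  index comes only from nearby break points.\<close>

lemma ivl_side:
  assumes "x \<in> ivl W b" "p \<in> breaks W" "snd W \<le> \<bar>x - p\<bar>"
  shows "p \<le> b \<longleftrightarrow> p \<le> x"
  using assms next_break_le[of p b] by (cases "p \<le> b") (auto simp: ivl_def)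

end

lemma breaks_mono: "refines W' W \<Longrightarrow> breaks W \<subseteq> breaks W'"
  by (auto simp: refines_def breaks_def)

lemma refines_refl [simp]: "refines W W"
  by (simp add: refines_def)

lemma refines_trans: "\<lbrakk>refines W'' W'; refines W' W\<rbrakk> \<Longrightarrow> refines W'' W"
  by (auto simp: refines_def)

text \<open>The first break point of \<open>W\<close> after \<open>b\<close> is also one of
  \<open>W'\<close>, so the interval of \<open>W'\<close> ends no later than that of
  \<open>W\<close>; the start and the width only help.\<close>

lemma ivl_refine:
  assumes W: "W \<in> admissible_covers" and W': "W' \<in> admissible_covers" and r: "refines W' W"
    and x: "x \<in> ivl W' b"
  shows "x \<in> ivl W (coarsen W b)"
proof -
  note f = admissible_fst(1,2)[OF W] and f' = admissible_fst(1,2)[OF W']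
  have "b < next_break W (coarsen W b)"
    by (rule less_next_coarsen[OF f])
  then have "next_break W' b \<le> next_break W (coarsen W b)"
    using next_break_in[OF f] breaks_mono[OF r] by (intro next_break_le[OF f']) auto
  then show ?thesis
    using x coarsen_le[OF f, of b] r by (auto simp: ivl_def refines_def)
qed

section \<open>Admissibility on the real line\<close>

lemma cis_2pi_eq_iff: "cis (2 * pi * x) = cis (2 * pi * y) \<longleftrightarrow> x - y \<in> \<int>"
proof -
  have "cis (2 * pi * x) = cis (2 * pi * y) \<longleftrightarrow> (\<exists>n::int. 2 * pi * x = 2 * pi * y + of_int (2 * n) * pi)"
    unfolding cis_conv_exp exp_eq by (auto simp: complex_eq_iff algebra_simps)
  also have "\<dots> \<longleftrightarrow> (\<exists>n::int. x = y + of_int n)"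
  proof (intro ex_cong1)
    show "2 * pi * x = 2 * pi * y + of_int (2 * n) * pi \<longleftrightarrow> x = y + of_int n" for n :: int
    proof -
      have "2 * pi * y + of_int (2 * n) * pi = 2 * pi * (y + of_int n)"
        by (simp add: algebra_simps)
      then show ?thesis
        by simp
    qed
  qed
  also have "\<dots> \<longleftrightarrow> x - y \<in> \<int>"
    by (auto simp: Ints_def algebra_simps)
  finally show ?thesis .
qed

text \<open>Admissibility expressed by the lifted intervals, where it is visibly invariant under shifts.\<close>

lemma admissible_covers_iff:
  "W \<in> admissible_covers \<longleftrightarrow>
     (finite (fst W) \<and> fst W \<noteq> {} \<and> fst W \<subseteq> {0<..1} \<and> 0 < snd W) \<and>
     (\<forall>x. \<forall>a\<in>breaks W. \<forall>b\<in>breaks W. \<forall>c\<in>breaks W. x \<in> ivl W a \<longrightarrow> x \<in> ivl W b \<longrightarrow> x \<in> ivl W c \<longrightarrow>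
       a - b \<in> \<int> \<or> b - c \<in> \<int> \<or> a - c \<in> \<int>)" (is "_ \<longleftrightarrow> ?B \<and> ?R")
proof (cases ?B)
  case True
  then have f: "finite (fst W)" "fst W \<noteq> {}"
    by blast+
  \<comment> \<open>In the fundamental domain \<open>{0<..1}\<close> congruent points coincide, so
    distinct members of \<open>fst W\<close> stay distinct modulo the integers.\<close>
  have Z: "a = b" if "a \<in> fst W" "b \<in> fst W" "a - b \<in> \<int>" for a b
  proof -
    obtain n where n: "a - b = of_int n"
      using \<open>a - b \<in> \<int>\<close> by (auto simp: Ints_def)
    have "a \<in> {0<..1}" "b \<in> {0<..1}"
      using that True by auto
    then have "\<bar>a - b\<bar> < 1"
      by auto
    then have "n = 0"
      unfolding n by linarith
    with n show ?thesis
      by simp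
  qed
  have C: "cis (2 * pi * x) \<in> circle_image (ivl W a) \<longleftrightarrow> (\<exists>k. x + of_int k \<in> ivl W a)" for x a
  proof
    assume "cis (2 * pi * x) \<in> circle_image (ivl W a)"
    then obtain y where y: "y \<in> ivl W a" "cis (2 * pi * x) = cis (2 * pi * y)"
      unfolding circle_image_def by blast
    then obtain k where "x - y = of_int k"
      unfolding cis_2pi_eq_iff by (auto elim: Ints_cases)
    then have "y = x + of_int (- k)"
      by simp
    with y show "\<exists>k. x + of_int k \<in> ivl W a"
      by blast
  next
    assume "\<exists>k. x + of_int k \<in> ivl W a"
    then obtain k where k: "x + of_int k \<in> ivl W a"
      by blast
    have "cis (2 * pi * x) = cis (2 * pi * (x + of_int k))"
      by (simp add: cis_2pi_eq_iff)
    then show "cis (2 * pi * x) \<in> circle_image (ivl W a)"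
      unfolding circle_image_def using k by blast
  qed
  have "(\<forall>a\<in>fst W. \<forall>b\<in>fst W. \<forall>c\<in>fst W. a \<noteq> b \<longrightarrow> b \<noteq> c \<longrightarrow> a \<noteq> c \<longrightarrow>
        circle_image (ivl W a) \<inter> circle_image (ivl W b) \<inter> circle_image (ivl W c) = {}) \<longleftrightarrow> ?R"
    (is "?L \<longleftrightarrow> _")
  proof
    assume L: ?L
    show ?R
    proof (intro allI ballI impI)
      fix x a b c
      assume "a \<in> breaks W" "b \<in> breaks W" "c \<in> breaks W"
        and x: "x \<in> ivl W a" "x \<in> ivl W b" "x \<in> ivl W c"
      then obtain p q r i j k where p: "p \<in> fst W" "q \<in> fst W" "r \<in> fst W"
        "a = p + of_int i" "b = q + of_int j" "c = r + of_int k"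
        by (auto simp: breaks_def)
      have "x + of_int (- i) \<in> ivl W p" "x + of_int (- j) \<in> ivl W q" "x + of_int (- k) \<in> ivl W r"
        using x ivl_add_int[OF f, of "x - of_int i" i p] ivl_add_int[OF f, of "x - of_int j" j q]
          ivl_add_int[OF f, of "x - of_int k" k r] p by simp_all
      then have "cis (2 * pi * x) \<in> circle_image (ivl W p) \<inter> circle_image (ivl W q) \<inter> circle_image (ivl W r)"
        by (auto simp only: C Int_iff)
      then have "p = q \<or> q = r \<or> p = r"
        using L p by blast
      then show "a - b \<in> \<int> \<or> b - c \<in> \<int> \<or> a - c \<in> \<int>"
        using p by (auto simp flip: of_int_diff)
    qed
  next
    assume R: ?R
    show ?L
    proof (intro ballI impI)
      fix a b c assume abc: "a \<in> fst W" "b \<in> fst W" "c \<in> fst W" "a \<noteq> b" "b \<noteq> c" "a \<noteq> c"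
      show "circle_image (ivl W a) \<inter> circle_image (ivl W b) \<inter> circle_image (ivl W c) = {}"
      proof (rule ccontr)
        assume "\<not> ?thesis"
        then obtain x where x: "cis (2 * pi * x) \<in> circle_image (ivl W a)"
          "cis (2 * pi * x) \<in> circle_image (ivl W b)" "cis (2 * pi * x) \<in> circle_image (ivl W c)"
          unfolding circle_image_def by blast
        then obtain i j k where i: "x + of_int i \<in> ivl W a" "x + of_int j \<in> ivl W b" "x + of_int k \<in> ivl W c"
          unfolding C by blast
        have "x \<in> ivl W (a - of_int i)" "x \<in> ivl W (b - of_int j)" "x \<in> ivl W (c - of_int k)"
          using i ivl_add_int[OF f, of x i "a - of_int i"] ivl_add_int[OF f, of x j "b - of_int j"]
            ivl_add_int[OF f, of x k "c - of_int k"] by simp_all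
        moreover have "a - of_int i \<in> breaks W" "b - of_int j \<in> breaks W" "c - of_int k \<in> breaks W"
          using abc fst_subset_breaks[of W] by auto
        ultimately have "(a - of_int i) - (b - of_int j) \<in> \<int> \<or> (b - of_int j) - (c - of_int k) \<in> \<int> \<or>
            (a - of_int i) - (c - of_int k) \<in> \<int>"
          using R by blast
        moreover have "(u - of_int m) - (v - of_int n) \<in> \<int> \<longleftrightarrow> u - v \<in> \<int>" for u v :: real and m n
        proof -
          have eq: "(u - of_int m) - (v - of_int n) = (u - v) + of_int (n - m)"
            by simp
          show ?thesis
            unfolding eq using Ints_add[of "u - v" "of_int (n - m)"]
              Ints_diff[of "u - v + of_int (n - m)" "of_int (n - m)"]
            by (auto simp del: of_int_diff)
        qed
        ultimately show False
          using Z abc by blast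
      qed
    qed
  qed
  then show ?thesis
    using True by (auto simp: admissible_covers_def)
qed (auto simp: admissible_covers_def)

text \<open>A stronger condition than admissibility that can still be reached by refinement: the
  open neighbourhoods of radius \<open>snd W\<close> around the break points are disjoint, so a
  point is close to at most one of them.\<close>

definition spaced :: "cover \<Rightarrow> bool" where
  "spaced W \<longleftrightarrow> (\<forall>p\<in>breaks W. \<forall>q\<in>breaks W. p \<noteq> q \<longrightarrow> 2 * snd W \<le> \<bar>p - q\<bar>)"

text \<open>The exceptional \<open>d\<close> is the break point close to \<open>x\<close>, and it
  serves all intervals through \<open>x\<close> simultaneously. If none is close, any value may be
  taken for \<open>d\<close>.\<close>

lemma spaced_side:
  assumes W: "finite (fst W)" "fst W \<noteq> {}" and spaced: "spaced W"
  obtains d where "\<And>b p. \<lbrakk>x \<in> ivl W b; p \<in> breaks W; p \<noteq> d\<rbrakk> \<Longrightarrow> p \<le> b \<longleftrightarrow> p \<le> x"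
proof (cases "\<exists>d\<in>breaks W. \<bar>x - d\<bar> < snd W")
  case True
  then obtain d where d: "d \<in> breaks W" "\<bar>x - d\<bar> < snd W"
    by blast
  show thesis
  proof (rule that)
    fix b p assume p: "x \<in> ivl W b" "p \<in> breaks W" "p \<noteq> d"
    then have "2 * snd W \<le> \<bar>p - d\<bar>"
      using d spaced by (auto simp: spaced_def)
    then have "snd W \<le> \<bar>x - p\<bar>"
      using d by linarith
    then show "p \<le> b \<longleftrightarrow> p \<le> x"
      using ivl_side[OF W] p by blast
  qed
next
  case False
  then show thesis
    using ivl_side[OF W] that by (meson not_less)
qed

lemma spaced_imp_admissible:
  assumes W: "finite (fst W)" "fst W \<noteq> {}" "fst W \<subseteq> {0<..1}" "0 < snd W" and spaced: "spaced W"
  shows "W \<in> admissible_covers"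
proof -
  have "a = b \<or> b = c \<or> a = c" if abc: "a \<in> breaks W" "b \<in> breaks W" "c \<in> breaks W"
    and x: "x \<in> ivl W a" "x \<in> ivl W b" "x \<in> ivl W c" for a b c x
  proof -
    obtain d where d: "\<And>b p. \<lbrakk>x \<in> ivl W b; p \<in> breaks W; p \<noteq> d\<rbrakk> \<Longrightarrow> p \<le> b \<longleftrightarrow> p \<le> x"
      using spaced_side[OF W(1,2) spaced] by blast
    \<comment> \<open>Two indices other than \<open>d\<close> both lie at or below \<open>x\<close>,
      hence each lies at or below the other. Besides \<open>d\<close> at most one index is possible,
      so among three indices two agree.\<close>
    have "p = q" if "p \<in> {a, b, c}" "q \<in> {a, b, c}" "p \<noteq> d" "q \<noteq> d" for p q
      using d[of p q] d[of q p] d[of p p] d[of q q] that abc x by auto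
    then show ?thesis
      by blast
  qed
  then have "a - b \<in> \<int> \<or> b - c \<in> \<int> \<or> a - c \<in> \<int>" if "a \<in> breaks W" "b \<in> breaks W" "c \<in> breaks W"
    "x \<in> ivl W a" "x \<in> ivl W b" "x \<in> ivl W c" for a b c x
    using that by (metis diff_self Ints_0)
  then show ?thesis
    using W unfolding admissible_covers_iff by blast
qed

text \<open>The union of the two sets of points with a small width refines both covers. Besides
  directedness this provides a spaced refinement of any single cover.\<close>

lemma spaced_refinement:
  assumes "W1 \<in> admissible_covers" "W2 \<in> admissible_covers"
  obtains W where "W \<in> admissible_covers" "spaced W" "refines W W1" "refines W W2"
proof -
  note W = admissible_fst[OF assms(1)] admissible_fst[OF assms(2)]
  let ?Q = "fst W1 \<union> fst W2"
  obtain \<delta> where \<delta>: "0 < \<delta>" "\<And>p p'. \<lbrakk>p \<in> breaks (?Q, 1); p' \<in> breaks (?Q, 1); p \<noteq> p'\<rbrakk> \<Longrightarrow> \<delta> \<le> \<bar>p - p'\<bar>"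
    using breaks_gap[of "(?Q, 1)"] W by auto
  \<comment> \<open>\<open>spaced\<close> asks for half of the gap \<open>\<delta>\<close>, the
    other terms for refinement. The gap could be computed with width 1 because \<open>breaks\<close>
    ignores the width.\<close>
  define \<epsilon> where "\<epsilon> = min (\<delta> / 2) (min (snd W1) (snd W2))"
  have "breaks (?Q, \<epsilon>) = breaks (?Q, 1)"
    by (simp add: breaks_def)
  then have "spaced (?Q, \<epsilon>)"
    using \<delta> by (force simp: spaced_def \<epsilon>_def)
  moreover have "0 < \<epsilon>"
    using W \<delta> by (simp add: \<epsilon>_def)
  moreover have "refines (?Q, \<epsilon>) W1" "refines (?Q, \<epsilon>) W2"
    by (auto simp: refines_def \<epsilon>_def)
  ultimately show thesis
    using that[of "(?Q, \<epsilon>)"] spaced_imp_admissible[of "(?Q, \<epsilon>)"] W by auto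
qed

section \<open>Shifted covers\<close>

lemma breaks_shift: "p \<in> breaks (shift_cover z W) \<longleftrightarrow> p - z \<in> breaks W"
proof
  assume "p \<in> breaks (shift_cover z W)"
  then obtain q k where "q \<in> fst (shift_cover z W)" "p = q + of_int k"
    unfolding breaks_def by blast
  then obtain b where b: "b \<in> breaks W" "p = b + z + of_int k"
    unfolding shift_cover_def by auto
  then have "p - z = b + of_int k"
    by simp
  then show "p - z \<in> breaks W"
    using b by simp
next
  assume p: "p - z \<in> breaks W"
  \<comment> \<open>The unique integer that moves \<open>p\<close> into \<open>{0<..1}\<close>,
    where \<open>shift_cover\<close> keeps its representatives.\<close>
  define k where "k = \<lceil>p\<rceil> - 1"
  have "p - of_int k = (p - z - of_int k) + z"
    by simp
  moreover have "p - z - of_int k \<in> breaks W"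
    using p by simp
  moreover have "p - of_int k \<in> {0<..1}"
    unfolding k_def by (auto, linarith+)
  ultimately have "p - of_int k \<in> fst (shift_cover z W)"
    unfolding shift_cover_def fst_conv by blast
  then have "(p - of_int k) + of_int k \<in> breaks (shift_cover z W)"
    unfolding breaks_def by blast
  then show "p \<in> breaks (shift_cover z W)"
    by simp
qed

lemma snd_shift [simp]: "snd (shift_cover z W) = snd W"
  by (simp add: shift_cover_def)

lemma shift_fst:
  assumes "finite (fst W)" "fst W \<noteq> {}"
  shows "finite (fst (shift_cover z W))" "fst (shift_cover z W) \<noteq> {}"
proof -
  have "finite ((\<lambda>b. b + z) ` (breaks W \<inter> {0 - z..1 - z}))"
    by (intro finite_imageI finite_breaks assms)
  moreover have "fst (shift_cover z W) \<subseteq> (\<lambda>b. b + z) ` (breaks W \<inter> {0 - z..1 - z})"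
    by (auto simp: shift_cover_def)
  ultimately show "finite (fst (shift_cover z W))"
    by (rule finite_subset[rotated])
  obtain b where "b \<in> breaks W"
    using assms fst_subset_breaks by blast
  then have "b + z \<in> breaks (shift_cover z W)"
    by (simp add: breaks_shift)
  then show "fst (shift_cover z W) \<noteq> {}"
    by (auto simp: breaks_def)
qed

context
  fixes W :: cover assumes W: "finite (fst W)" "fst W \<noteq> {}"
begin

lemma coarsen_shift: "coarsen (shift_cover z W) x = coarsen W (x - z) + z"
proof (rule coarsen_eqI)
  fix p assume "p \<in> breaks (shift_cover z W)" "p \<le> x"
  then show "p \<le> coarsen W (x - z) + z"
    using le_coarsen[OF W, of "p - z" "x - z"] by (simp add: breaks_shift)
qed (use coarsen_le[OF W, of "x - z"] coarsen_in[OF W] in \<open>simp_all add: breaks_shift\<close>)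

lemma next_break_shift: "next_break (shift_cover z W) b = next_break W (b - z) + z"
proof (rule next_break_eqI)
  fix p assume "p \<in> breaks (shift_cover z W)" "b < p"
  then show "next_break W (b - z) + z \<le> p"
    using next_break_le[OF W, of "p - z" "b - z"] by (simp add: breaks_shift)
qed (use less_next_break[OF W, of "b - z"] next_break_in[OF W] in \<open>simp_all add: breaks_shift\<close>)

lemma ivl_shift: "x \<in> ivl (shift_cover z W) b \<longleftrightarrow> x - z \<in> ivl W (b - z)"
  by (auto simp: ivl_def next_break_shift)

end

lemma shift_admissible:
  assumes "W \<in> admissible_covers"
  shows "shift_cover z W \<in> admissible_covers"
proof -
  note W = admissible_fst[OF assms]
  have "a - b \<in> \<int> \<or> b - c \<in> \<int> \<or> a - c \<in> \<int>"
    if "a - z \<in> breaks W" "b - z \<in> breaks W" "c - z \<in> breaks W"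
      "x - z \<in> ivl W (a - z)" "x - z \<in> ivl W (b - z)" "x - z \<in> ivl W (c - z)" for a b c x
  proof -
    have "(a - z) - (b - z) \<in> \<int> \<or> (b - z) - (c - z) \<in> \<int> \<or> (a - z) - (c - z) \<in> \<int>"
      using that assms unfolding admissible_covers_iff by blast
    then show ?thesis
      by simp
  qed
  then show ?thesis
    unfolding admissible_covers_iff using W shift_fst[OF W(1,2)]
    by (auto simp: breaks_shift ivl_shift) (auto simp: shift_cover_def)
qed

text \<open>Literal equality of pairs is wanted because the action on a class takes images of its
  members. It holds because the points of an admissible cover are exactly its break points in
  \<open>{0<..1}\<close>.\<close>

lemma shift_shift:
  assumes "W \<in> admissible_covers"
  shows "shift_cover z (shift_cover (- z) W) = W"
proof (rule prod_eqI)
  have "b \<in> fst (shift_cover z (shift_cover (- z) W)) \<longleftrightarrow> b \<in> breaks W \<and> b \<in> {0<..1}" for b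
  proof -
    have "b \<in> (\<lambda>b. b + z) ` breaks (shift_cover (- z) W) \<longleftrightarrow> b \<in> breaks W"
      by (auto simp: breaks_shift image_iff intro!: bexI[of _ "b - z"])
    then show ?thesis
      by (simp add: shift_cover_def[of z])
  qed
  moreover have "b \<in> fst W \<longleftrightarrow> b \<in> breaks W \<and> b \<in> {0<..1}" for b
  proof
    assume "b \<in> breaks W \<and> b \<in> {0<..1}"
    then obtain q k where q: "q \<in> fst W" "b = q + of_int k" "b \<in> {0<..1}"
      by (auto simp: breaks_def)
    have "q \<in> {0<..1}"
      using q admissible_fst(4)[OF assms] by blast
    then have "k = 0"
      using q by simp
    then show "b \<in> fst W"
      using q by simp
  qed (use fst_subset_breaks admissible_fst(4)[OF assms] in blast)
  ultimately show "fst (shift_cover z (shift_cover (- z) W)) = fst W"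
    by blast
qed simp

lemma shift_refines: "refines W' W \<Longrightarrow> refines (shift_cover z W') (shift_cover z W)"
  using breaks_mono[of W' W] by (auto simp: refines_def shift_cover_def)

section \<open>Shift-invariant functions\<close>

text \<open>On the diagonal, invariance under the shift by \<open>x\<close> itself compares the values at \<open>x\<close> and \<open>0\<close>.
  Off the diagonal, only one break point can separate the indices from \<open>x\<close>; if it is a break point
  of \<open>W\<close>, a small shift of \<open>W\<close> avoids it.\<close>

lemma shift_invariant_constant:
  fixes F :: "((real \<times> real) \<times> real) \<times> int \<Rightarrow> 'c"
  assumes W: "W \<in> admissible_covers"
    and inv: "\<And>z. \<exists>W'\<in>admissible_covers. refines W' W \<and> refines W' (shift_cover z W) \<and>
      (\<forall>b\<in>breaks W'. \<forall>c\<in>breaks W'. \<forall>x l. x \<in> ivl W' b \<longrightarrow> x \<in> ivl W' c \<longrightarrow>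
        F (((coarsen W b, coarsen W c), x), l) =
        F (((coarsen W (b - z), coarsen W (c - z)), x - z), l))"
  shows "F (((coarsen W x, coarsen W x), x), l) = F (((coarsen W 0, coarsen W 0), 0), l)"
    and "\<exists>W'\<in>admissible_covers. refines W' W \<and>
      (\<forall>b\<in>breaks W'. \<forall>c\<in>breaks W'. \<forall>x l. x \<in> ivl W' b \<longrightarrow> x \<in> ivl W' c \<longrightarrow>
        F (((coarsen W b, coarsen W c), x), l) = F (((coarsen W 0, coarsen W 0), 0), l))"
proof -
  note f = admissible_fst(1,2)[OF W]
  have coarsen_diff: "coarsen W (y - z) = coarsen (shift_cover z W) y - z" for y z
    by (simp add: coarsen_shift[OF f])
  have diag: "F (((coarsen W x, coarsen W x), x), l) = F (((coarsen W 0, coarsen W 0), 0), l)" for x l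
  proof -
    obtain W' where W': "W' \<in> admissible_covers" "refines W' W" "refines W' (shift_cover x W)"
      and F: "\<And>b c y l. \<lbrakk>b \<in> breaks W'; c \<in> breaks W'; y \<in> ivl W' b; y \<in> ivl W' c\<rbrakk> \<Longrightarrow>
        F (((coarsen W b, coarsen W c), y), l) =
        F (((coarsen W (b - x), coarsen W (c - x)), y - x), l)"
      using inv[of x] by blast
    note f' = admissible_fst[OF W'(1)]
    \<comment> \<open>This index over \<open>W'\<close> coarsens to the canonical index both of
      \<open>W\<close> and of the shifted cover. The equation therefore compares \<open>x\<close>
      with \<open>x - x\<close>, and \<open>W'\<close> no longer appears in the result.\<close>
    let ?b = "coarsen W' x"
    have "F (((coarsen W ?b, coarsen W ?b), x), l) =
        F (((coarsen W (?b - x), coarsen W (?b - x)), x - x), l)"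
      by (intro F coarsen_in in_ivl_coarsen f')
    moreover have "coarsen W ?b = coarsen W x"
      by (rule coarsen_coarsen[OF f'(1,2) breaks_mono[OF W'(2)]])
    moreover have "coarsen W (?b - x) = coarsen W (x - x)"
      unfolding coarsen_diff using coarsen_coarsen[OF f'(1,2) breaks_mono[OF W'(3)]] by simp
    ultimately show ?thesis
      by simp
  qed
  then show "F (((coarsen W x, coarsen W x), x), l) = F (((coarsen W 0, coarsen W 0), 0), l)" .
  obtain \<delta> where \<delta>: "0 < \<delta>"
    "\<And>p p'. \<lbrakk>p \<in> breaks W; p' \<in> breaks W; p \<noteq> p'\<rbrakk> \<Longrightarrow> \<delta> \<le> \<bar>p - p'\<bar>"
    using breaks_gap[OF f(1)] by blast
  \<comment> \<open>Nonzero and below the smallest gap, so subtracting \<open>z\<close> from a break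
    point of \<open>W\<close> never gives another one.\<close>
  define z where "z = \<delta> / 2"
  obtain W' where W': "W' \<in> admissible_covers" "refines W' W" "refines W' (shift_cover z W)"
    and F: "\<And>b c y l. \<lbrakk>b \<in> breaks W'; c \<in> breaks W'; y \<in> ivl W' b; y \<in> ivl W' c\<rbrakk> \<Longrightarrow>
      F (((coarsen W b, coarsen W c), y), l) =
      F (((coarsen W (b - z), coarsen W (c - z)), y - z), l)"
    using inv[of z] by blast
  note f' = admissible_fst[OF W'(1)]
  \<comment> \<open>Over a spaced refinement at most one break point \<open>d\<close> can separate
    an index from a given point.\<close>
  obtain W'' where W'': "W'' \<in> admissible_covers" "spaced W''" "refines W'' W'"
    using spaced_refinement[OF W'(1) W'(1)] by blast
  note f'' = admissible_fst[OF W''(1)]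
  have "F (((coarsen W b, coarsen W c), x), l) = F (((coarsen W 0, coarsen W 0), 0), l)"
    if bc: "b \<in> breaks W''" "c \<in> breaks W''" "x \<in> ivl W'' b" "x \<in> ivl W'' c" for b c x l
  proof -
    obtain d where d: "\<And>b p. \<lbrakk>x \<in> ivl W'' b; p \<in> breaks W''; p \<noteq> d\<rbrakk> \<Longrightarrow> p \<le> b \<longleftrightarrow> p \<le> x"
      using spaced_side[OF f''(1,2) W''(2)] by blast
    show ?thesis
    proof (cases "d \<in> breaks W")
      case False
      \<comment> \<open>No break point of \<open>W\<close> separates \<open>b'\<close> from
        \<open>x\<close>, so both indices coarsen to the canonical one and the value is already
        diagonal.\<close>
      have "coarsen W b' = coarsen W x" if "x \<in> ivl W'' b'" for b'
        by (rule coarsen_cong, rule d) (use that False breaks_mono W'(2) W''(3) in blast)+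
      with bc diag show ?thesis
        by simp
    next
      case True
      have dz: "d - z \<notin> breaks W"
        using \<delta>(2)[of d "d - z"] \<delta>(1) True by (auto simp: z_def)
      have shift: "coarsen W (coarsen W' b' - z) = coarsen W (x - z)" if "x \<in> ivl W'' b'" for b'
      proof -
        have "coarsen (shift_cover z W) b' = coarsen (shift_cover z W) x"
        proof (rule coarsen_cong)
          fix p assume p: "p \<in> breaks (shift_cover z W)"
          then have "p \<in> breaks W''" "p \<noteq> d"
            using breaks_mono W'(3) W''(3) dz by (blast, auto simp: breaks_shift)
          with that show "p \<le> b' \<longleftrightarrow> p \<le> x"
            by (rule d)
        qed
        then show ?thesis
          unfolding coarsen_diff coarsen_coarsen[OF f'(1,2) breaks_mono[OF W'(3)]] by simp
      qed
      \<comment> \<open>Since \<open>d\<close> is not a break point of the cover shifted by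
        \<open>z\<close>, both indices become canonical on the shifted side: invariance under this
        one \<open>z\<close> moves the off-diagonal value to a diagonal one.\<close>
      have "F (((coarsen W (coarsen W' b), coarsen W (coarsen W' c)), x), l) =
        F (((coarsen W (coarsen W' b - z), coarsen W (coarsen W' c - z)), x - z), l)"
        using bc by (intro F coarsen_in f' ivl_refine[OF W'(1) W''(1,3)])
      then have "F (((coarsen W b, coarsen W c), x), l) =
          F (((coarsen W (x - z), coarsen W (x - z)), x - z), l)"
        unfolding coarsen_coarsen[OF f'(1,2) breaks_mono[OF W'(2)]] using bc by (simp add: shift)
      with diag show ?thesis
        by simp
    qed
  qed
  then show "\<exists>W'\<in>admissible_covers. refines W' W \<and>
      (\<forall>b\<in>breaks W'. \<forall>c\<in>breaks W'. \<forall>x l. x \<in> ivl W' b \<longrightarrow> x \<in> ivl W' c \<longrightarrow>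
        F (((coarsen W b, coarsen W c), x), l) = F (((coarsen W 0, coarsen W 0), 0), l))"
    using W'' W'(2) refines_trans by blast
qed

section \<open>Circle groupoids\<close>

lemma continuous_map_from_sum_topology:
  assumes "\<And>i. i \<in> I \<Longrightarrow> continuous_map (X i) Y (\<lambda>x. f (i, x))"
  shows "continuous_map (sum_topology X I) Y f"
  unfolding continuous_map_def
proof (intro conjI allI impI)
  show "f \<in> topspace (sum_topology X I) \<rightarrow> topspace Y"
    using assms by (auto simp: continuous_map_def Pi_iff)
next
  fix U assume U: "openin Y U"
  have "{x. (i, x) \<in> {x \<in> topspace (sum_topology X I). f x \<in> U}} = {x \<in> topspace (X i). f (i, x) \<in> U}"
    if "i \<in> I" for i
    using that by auto
  then show "openin (sum_topology X I) {x \<in> topspace (sum_topology X I). f x \<in> U}"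
    using openin_continuous_map_preimage[OF assms U] by (auto simp: openin_sum_topology)
qed

lemma topspace_circle_Ob: "topspace (Ob (circle_groupoid W)) = {(b, x). b \<in> breaks W \<and> x \<in> ivl W b}"
  by (auto simp: circle_groupoid_def)

lemma topspace_circle_Ar: "topspace (Ar (circle_groupoid W)) =
  {(((b, c), x), l). b \<in> breaks W \<and> c \<in> breaks W \<and> x \<in> ivl W b \<and> x \<in> ivl W c}"
  by (auto simp: circle_groupoid_def)

lemma circle_simps [simp]:
  "src (circle_groupoid W) (((b, c), x), l) = (b, x)"
  "tgt (circle_groupoid W) (((b, c), x), l) = (c + of_int l, x + of_int l)"
  "ide (circle_groupoid W) (b, x) = (((b, b), x), 0)"
  "ginv (circle_groupoid W) (((b, c), x), l) = (((c + of_int l, b + of_int l), x + of_int l), - l)"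
  "mul (circle_groupoid W) (((b, c), x), l) (((c', d), y), k) = (((b, d - of_int l), x), l + k)"
  by (simp_all add: circle_groupoid_def)

lemma circle_closed:
  assumes "finite (fst W)" "fst W \<noteq> {}"
  shows "r \<in> topspace (Ar (circle_groupoid W)) \<Longrightarrow> src (circle_groupoid W) r \<in> topspace (Ob (circle_groupoid W))"
    and "r \<in> topspace (Ar (circle_groupoid W)) \<Longrightarrow> tgt (circle_groupoid W) r \<in> topspace (Ob (circle_groupoid W))"
    and "p \<in> topspace (Ob (circle_groupoid W)) \<Longrightarrow> ide (circle_groupoid W) p \<in> topspace (Ar (circle_groupoid W))"
    and "r \<in> topspace (Ar (circle_groupoid W)) \<Longrightarrow> ginv (circle_groupoid W) r \<in> topspace (Ar (circle_groupoid W))"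
    and "\<lbrakk>r \<in> topspace (Ar (circle_groupoid W)); q \<in> topspace (Ar (circle_groupoid W));
      tgt (circle_groupoid W) r = src (circle_groupoid W) q\<rbrakk> \<Longrightarrow>
      mul (circle_groupoid W) r q \<in> topspace (Ar (circle_groupoid W))"
proof -
  \<comment> \<open>A composite stores its end index relative to its own starting point
    \<open>x\<close>, so the end index of the second arrow is moved back by the degree of the
    first.\<close>
  have d: "x \<in> ivl W (d - of_int l)" if "x + of_int l \<in> ivl W d" for x d l
    using ivl_add_int[OF assms, of x l "d - of_int l"] that by simp
  show "r \<in> topspace (Ar (circle_groupoid W)) \<Longrightarrow> src (circle_groupoid W) r \<in> topspace (Ob (circle_groupoid W))"
    "r \<in> topspace (Ar (circle_groupoid W)) \<Longrightarrow> tgt (circle_groupoid W) r \<in> topspace (Ob (circle_groupoid W))"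
    "p \<in> topspace (Ob (circle_groupoid W)) \<Longrightarrow> ide (circle_groupoid W) p \<in> topspace (Ar (circle_groupoid W))"
    "r \<in> topspace (Ar (circle_groupoid W)) \<Longrightarrow> ginv (circle_groupoid W) r \<in> topspace (Ar (circle_groupoid W))"
    "\<lbrakk>r \<in> topspace (Ar (circle_groupoid W)); q \<in> topspace (Ar (circle_groupoid W));
      tgt (circle_groupoid W) r = src (circle_groupoid W) q\<rbrakk> \<Longrightarrow>
      mul (circle_groupoid W) r q \<in> topspace (Ar (circle_groupoid W))"
    by (auto simp: topspace_circle_Ar topspace_circle_Ob ivl_add_int[OF assms] intro: d)
qed

lemma continuous_circle_ide:
  "continuous_map (Ob (circle_groupoid W)) (Ar (circle_groupoid W)) (ide (circle_groupoid W))"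
proof -
  let ?S = "sum_topology (\<lambda>(b, c). top_of_set (ivl W b \<inter> ivl W c)) (breaks W \<times> breaks W)"
  have "continuous_map (top_of_set (ivl W b)) ?S (\<lambda>x. ((b, b), x))" if "b \<in> breaks W" for b
    using continuous_map_component_injection[of "(b, b)" "breaks W \<times> breaks W"
        "\<lambda>(b, c). top_of_set (ivl W b \<inter> ivl W c)"] that by simp
  then have "continuous_map (Ob (circle_groupoid W)) (Ar (circle_groupoid W)) (\<lambda>(b, x). (((b, b), x), 0))"
    unfolding circle_groupoid_def
    by (auto intro!: continuous_map_from_sum_topology simp: continuous_map_paired)
  then show ?thesis
    by (simp add: circle_groupoid_def)
qed

lemma continuous_circle_degree:
  "continuous_map (Ar (circle_groupoid W)) (discrete_topology UNIV) snd"
  unfolding circle_groupoid_def by (simp add: continuous_map_snd)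

text \<open>Translation by \<open>- z\<close>, as a morphism from the circle groupoid of the shifted
  cover to that of \<open>W\<close>. The action on loops becomes precomposition with it, in parallel
  with \<open>circle_refine\<close>.\<close>

definition circle_shift ::
    "real \<Rightarrow> (real \<times> real \<Rightarrow> real \<times> real)
            \<times> (((real \<times> real) \<times> real) \<times> int \<Rightarrow> ((real \<times> real) \<times> real) \<times> int)" where
  "circle_shift z = (\<lambda>(b, x). (b - z, x - z), \<lambda>(((b, c), x), l). (((b - z, c - z), x - z), l))"

lemma shift_obj_eq: "shift_obj z W \<Psi> =
  (restrict (fst \<Psi> \<circ> fst (circle_shift z)) (topspace (Ob (circle_groupoid (shift_cover z W)))),
   restrict (snd \<Psi> \<circ> snd (circle_shift z)) (topspace (Ar (circle_groupoid (shift_cover z W)))))"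
  by (simp add: shift_obj_def circle_shift_def comp_def case_prod_unfold)

lemma shift_arr_eq: "shift_arr z W (\<Psi>, \<Lambda>, \<Phi>) =
  (shift_obj z W \<Psi>,
   restrict (\<Lambda> \<circ> snd (circle_shift z)) (topspace (Ar (circle_groupoid (shift_cover z W)))),
   shift_obj z W \<Phi>)"
  by (simp add: shift_arr_def circle_shift_def comp_def case_prod_unfold)

lemma groupoid_morphism_circle_shift:
  assumes W: "finite (fst W)" "fst W \<noteq> {}"
  shows "groupoid_morphism (circle_groupoid (shift_cover z W)) (circle_groupoid W) (circle_shift z)"
proof -
  let ?W = "shift_cover z W"
  note W' = shift_fst[OF W, of z]
  have "continuous_map (Ob (circle_groupoid ?W)) (Ob (circle_groupoid W)) (fst (circle_shift z))"
    unfolding circle_groupoid_def top_groupoid.select_convs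
  proof (rule continuous_map_from_sum_topology)
    fix b assume "b \<in> breaks ?W"
    then have 1: "continuous_map (top_of_set (ivl W (b - z)))
        (sum_topology (\<lambda>b. top_of_set (ivl W b)) (breaks W)) (\<lambda>x. (b - z, x))"
      by (intro continuous_map_component_injection) (simp add: breaks_shift)
    have "continuous_map (top_of_set (ivl ?W b)) (top_of_set (ivl W (b - z))) (\<lambda>x. x - z)"
      by (auto simp: continuous_map_in_subtopology ivl_shift[OF W] intro!: continuous_intros)
    from continuous_map_compose[OF this 1] show "continuous_map (top_of_set (ivl ?W b))
        (sum_topology (\<lambda>b. top_of_set (ivl W b)) (breaks W)) (\<lambda>x. fst (circle_shift z) (b, x))"
      by (simp add: circle_shift_def comp_def)
  qed
  moreover have "continuous_map (Ar (circle_groupoid ?W)) (Ar (circle_groupoid W)) (snd (circle_shift z))"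
  proof -
    let ?S = "\<lambda>W. sum_topology (\<lambda>(b, c). top_of_set (ivl W b \<inter> ivl W c)) (breaks W \<times> breaks W)"
    have "continuous_map (?S ?W) (?S W) (\<lambda>((b, c), x). ((b - z, c - z), x - z))"
    proof (rule continuous_map_from_sum_topology)
      fix i assume "i \<in> breaks ?W \<times> breaks ?W"
      then obtain b c where i: "i = (b, c)" and bc: "b \<in> breaks ?W" "c \<in> breaks ?W"
        by blast
      have 1: "continuous_map (top_of_set (ivl W (b - z) \<inter> ivl W (c - z))) (?S W) (\<lambda>x. ((b - z, c - z), x))"
        using continuous_map_component_injection[of "(b - z, c - z)" "breaks W \<times> breaks W"
            "\<lambda>(b, c). top_of_set (ivl W b \<inter> ivl W c)"] bc by (simp add: breaks_shift)
      have "continuous_map (top_of_set (ivl ?W b \<inter> ivl ?W c))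
          (top_of_set (ivl W (b - z) \<inter> ivl W (c - z))) (\<lambda>x. x - z)"
        by (auto simp: continuous_map_in_subtopology ivl_shift[OF W] intro!: continuous_intros)
      from continuous_map_compose[OF this 1] show "continuous_map (case i of (b, c) \<Rightarrow> top_of_set (ivl ?W b \<inter> ivl ?W c)) (?S W)
          (\<lambda>x. (\<lambda>((b, c), x). ((b - z, c - z), x - z)) (i, x))"
        by (simp add: comp_def i)
    qed
    then have "continuous_map (Ar (circle_groupoid ?W)) (Ar (circle_groupoid W))
        (\<lambda>p. ((\<lambda>((b, c), x). ((b - z, c - z), x - z)) (fst p), snd p))"
      unfolding circle_groupoid_def top_groupoid.select_convs
      by (intro continuous_map_pairedI continuous_map_snd
          continuous_map_compose[OF continuous_map_fst, unfolded comp_def])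
    then show ?thesis
      by (simp add: circle_shift_def case_prod_unfold)
  qed
  ultimately have "groupoid_morphism (circle_groupoid ?W) (circle_groupoid W)
      (fst (circle_shift z), snd (circle_shift z))"
    by (rule groupoid_morphismI) (auto simp: circle_shift_def topspace_circle_Ar topspace_circle_Ob)
  then show ?thesis
    by simp
qed

lemma circle_refine_in:
  assumes W: "W \<in> admissible_covers" "W' \<in> admissible_covers" "refines W' W"
  shows "p \<in> topspace (Ob (circle_groupoid W')) \<Longrightarrow> fst (circle_refine W) p \<in> topspace (Ob (circle_groupoid W))"
    and "r \<in> topspace (Ar (circle_groupoid W')) \<Longrightarrow> snd (circle_refine W) r \<in> topspace (Ar (circle_groupoid W))"
  using coarsen_in[OF admissible_fst(1,2)[OF W(1)]] ivl_refine[OF W]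
  by (auto simp: circle_refine_def topspace_circle_Ar topspace_circle_Ob)

lemma circle_refine_refine:
  assumes W: "W \<in> admissible_covers" "W' \<in> admissible_covers" "refines W' W"
  shows "fst (circle_refine W) (fst (circle_refine W') p) = fst (circle_refine W) p"
    and "snd (circle_refine W) (snd (circle_refine W') r) = snd (circle_refine W) r"
  using coarsen_coarsen[OF admissible_fst(1,2)[OF W(2)] breaks_mono[OF W(3)]]
  by (auto simp: circle_refine_def split: prod.splits)

lemma circle_refine_simps:
  assumes "finite (fst W)" "fst W \<noteq> {}"
  shows "src (circle_groupoid W) (snd (circle_refine W) r) = fst (circle_refine W) (src (circle_groupoid W') r)"
    and "tgt (circle_groupoid W) (snd (circle_refine W) r) = fst (circle_refine W) (tgt (circle_groupoid W') r)"
    and "ide (circle_groupoid W) (fst (circle_refine W) p) = snd (circle_refine W) (ide (circle_groupoid W') p)"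
    and "snd (snd (circle_refine W) r) = snd r"
  using coarsen_add_int[OF assms]
  by (auto simp: circle_refine_def split: prod.splits)

lemma circle_refine_shift:
  assumes "finite (fst W)" "fst W \<noteq> {}"
  shows "fst (circle_refine W) (fst (circle_shift z) p) = fst (circle_shift z) (fst (circle_refine (shift_cover z W)) p)"
    and "snd (circle_refine W) (snd (circle_shift z) r) = snd (circle_shift z) (snd (circle_refine (shift_cover z W)) r)"
  using coarsen_shift[OF assms]
  by (auto simp: circle_refine_def circle_shift_def split: prod.splits)

section \<open>Directed colimits\<close>

text \<open>Transition maps enter through their composition law: classes compare transported
  elements, and the final topology refers only to the spaces \<open>D i\<close>. For loops the law
  holds for arbitrary functions, since pullback is a formula followed by a restriction.\<close>

locale directed_system =
  fixes I :: "'i set" and le :: "'i \<Rightarrow> 'i \<Rightarrow> bool" and D :: "'i \<Rightarrow> 'x topology"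
    and f :: "'i \<Rightarrow> 'i \<Rightarrow> 'x \<Rightarrow> 'x"
  assumes le_refl: "i \<in> I \<Longrightarrow> le i i"
    and le_trans: "\<lbrakk>le k j; le j i\<rbrakk> \<Longrightarrow> le k i"
    and directed: "\<lbrakk>i \<in> I; j \<in> I\<rbrakk> \<Longrightarrow> \<exists>k\<in>I. le k i \<and> le k j"
    and functorial: "\<lbrakk>i \<in> I; j \<in> I; k \<in> I; le j i; le k j\<rbrakk> \<Longrightarrow> f j k (f i j x) = f i k x"
begin

abbreviation "cls \<equiv> colim_class I le D f"
abbreviation "colim \<equiv> colim_topology I le D f"

lemma related_trans:
  assumes "i \<in> I" "j \<in> I" "m \<in> I" "k \<in> I" "k' \<in> I"
    and "le k i" "le k j" "f i k x = f j k y" "le k' j" "le k' m" "f j k' y = f m k' w"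
  shows "\<exists>k\<in>I. le k i \<and> le k m \<and> f i k x = f m k w"
proof -
  obtain n where n: "n \<in> I" "le n k" "le n k'"
    using directed assms(4,5) by blast
  have "f i n x = f k n (f j k y)"
    using functorial[of i k n x] assms n by simp
  also have "\<dots> = f k' n (f j k' y)"
    using functorial[of j k n y] functorial[of j k' n y] assms n by simp
  also have "\<dots> = f m n w"
    using functorial[of m k' n w] assms n by simp
  finally show ?thesis
    using assms n le_trans by blast
qed

lemma cls_eqI:
  assumes "i \<in> I" "j \<in> I" "k \<in> I" "le k i" "le k j" "f i k x = f j k y"
  shows "cls i x = cls j y"
proof -
  have "(\<exists>k\<in>I. le k i \<and> le k m \<and> f i k x = f m k w) \<longleftrightarrow> (\<exists>k\<in>I. le k j \<and> le k m \<and> f j k y = f m k w)"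
    if "m \<in> I" for m w
    using related_trans[of i j m k _ x y w] related_trans[of j i m k _ y x w] assms that by fastforce
  then show ?thesis
    unfolding colim_class_def by blast
qed

lemma cls_refl: "\<lbrakk>i \<in> I; x \<in> topspace (D i)\<rbrakk> \<Longrightarrow> (i, x) \<in> cls i x"
  using le_refl by (auto simp: colim_class_def)

lemma cls_memD:
  assumes "(j, y) \<in> cls i x"
  shows "j \<in> I" "y \<in> topspace (D j)" "\<exists>k\<in>I. le k i \<and> le k j \<and> f i k x = f j k y"
  using assms by (auto simp: colim_class_def)

lemma topspace_colim: "topspace colim = {cls i x | i x. i \<in> I \<and> x \<in> topspace (D i)}"
proof -
  have "openin colim {cls i x | i x. i \<in> I \<and> x \<in> topspace (D i)}"
    unfolding openin_colim_topology
  proof (intro conjI subset_refl ballI)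
    fix i assume "i \<in> I"
    then have "{x \<in> topspace (D i). cls i x \<in> {cls i x | i x. i \<in> I \<and> x \<in> topspace (D i)}} = topspace (D i)"
      by blast
    then show "openin (D i) {x \<in> topspace (D i). cls i x \<in> {cls i x | i x. i \<in> I \<and> x \<in> topspace (D i)}}"
      by simp
  qed
  moreover have "topspace colim \<subseteq> {cls i x | i x. i \<in> I \<and> x \<in> topspace (D i)}"
    using openin_topspace[of colim] unfolding openin_colim_topology by blast
  ultimately show ?thesis
    by (simp add: subset_antisym openin_subset)
qed

lemma continuous_map_cls: "i \<in> I \<Longrightarrow> continuous_map (D i) colim (cls i)"
  unfolding continuous_map_def topspace_colim by (auto simp: openin_colim_topology)

lemma continuous_map_from_colim:
  assumes "\<And>i. i \<in> I \<Longrightarrow> continuous_map (D i) Y (\<lambda>x. g (cls i x))"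
  shows "continuous_map colim Y g"
  unfolding continuous_map_def
proof (intro conjI allI impI)
  show "g \<in> topspace colim \<rightarrow> topspace Y"
    using assms by (auto simp: topspace_colim continuous_map_def)
next
  fix U assume U: "openin Y U"
  show "openin colim {c \<in> topspace colim. g c \<in> U}"
    unfolding openin_colim_topology
  proof (intro conjI ballI)
    show "{c \<in> topspace colim. g c \<in> U} \<subseteq> {cls i x | i x. i \<in> I \<and> x \<in> topspace (D i)}"
      by (auto simp: topspace_colim)
    fix i assume i: "i \<in> I"
    then have "{x \<in> topspace (D i). cls i x \<in> {c \<in> topspace colim. g c \<in> U}} =
        {x \<in> topspace (D i). g (cls i x) \<in> U}"
      by (auto simp: topspace_colim)
    then show "openin (D i) {x \<in> topspace (D i). cls i x \<in> {c \<in> topspace colim. g c \<in> U}}"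
      using openin_continuous_map_preimage[OF assms[OF i] U] by simp
  qed
qed

end

text \<open>Evaluations on the colimit, and all structure maps of the loop groupoid except
  \<open>mul\<close>, are descriptions of this shape. Each is computed from one representative
  together with independence of the choice.\<close>

lemma the_on_class:
  assumes "(i, x) \<in> c" "\<And>j y. (j, y) \<in> c \<Longrightarrow> P j y = d"
  shows "(THE d. \<exists>(j, y)\<in>c. d = P j y) = d"
  by (rule the_equality) (use assms in blast)+

section \<open>Pulling back and shifting loops\<close>

abbreviation circle_Ob :: "cover \<Rightarrow> (real \<times> real) set" where
  "circle_Ob W \<equiv> topspace (Ob (circle_groupoid W))"

abbreviation circle_Ar :: "cover \<Rightarrow> (((real \<times> real) \<times> real) \<times> int) set" where
  "circle_Ar W \<equiv> topspace (Ar (circle_groupoid W))"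

lemma pull_arr_simp:
  "pull_arr W W' (\<Psi>, \<Lambda>, \<Phi>) =
    (pull_obj W W' \<Psi>, restrict (\<Lambda> \<circ> snd (circle_refine W)) (circle_Ar W'), pull_obj W W' \<Phi>)"
  by (simp add: pull_arr_def)

lemma restrict_pull:
  assumes "W \<in> admissible_covers" "W' \<in> admissible_covers" "W'' \<in> admissible_covers"
    "refines W' W" "refines W'' W'"
  shows "restrict (restrict (F \<circ> fst (circle_refine W)) (circle_Ob W') \<circ> fst (circle_refine W')) (circle_Ob W'') =
      restrict (F \<circ> fst (circle_refine W)) (circle_Ob W'')"
    and "restrict (restrict (H \<circ> snd (circle_refine W)) (circle_Ar W') \<circ> snd (circle_refine W')) (circle_Ar W'') =
      restrict (H \<circ> snd (circle_refine W)) (circle_Ar W'')"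
  by (intro restrict_ext; simp add: circle_refine_in[OF assms(2,3,5)] circle_refine_refine[OF assms(1,2,4)])+

lemma pull_obj_pull_obj:
  assumes "W \<in> admissible_covers" "W' \<in> admissible_covers" "W'' \<in> admissible_covers"
    "refines W' W" "refines W'' W'"
  shows "pull_obj W' W'' (pull_obj W W' \<Psi>) = pull_obj W W'' \<Psi>"
  by (simp add: pull_obj_def restrict_pull[OF assms])

lemma pull_arr_pull_arr:
  assumes "W \<in> admissible_covers" "W' \<in> admissible_covers" "W'' \<in> admissible_covers"
    "refines W' W" "refines W'' W'"
  shows "pull_arr W' W'' (pull_arr W W' \<alpha>) = pull_arr W W'' \<alpha>"
  by (cases \<alpha>) (simp add: pull_arr_simp pull_obj_pull_obj[OF assms] restrict_pull[OF assms])

lemma circle_shift_in: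
  assumes "finite (fst W)" "fst W \<noteq> {}"
  shows "p \<in> circle_Ob (shift_cover z W) \<Longrightarrow> fst (circle_shift z) p \<in> circle_Ob W"
    and "r \<in> circle_Ar (shift_cover z W) \<Longrightarrow> snd (circle_shift z) r \<in> circle_Ar W"
  using groupoid_morphismD(3,4)[OF groupoid_morphism_circle_shift[OF assms]] by auto

lemma circle_shift_simps:
  "src (circle_groupoid W) (snd (circle_shift z) r) = fst (circle_shift z) (src (circle_groupoid W') r)"
  "tgt (circle_groupoid W) (snd (circle_shift z) r) = fst (circle_shift z) (tgt (circle_groupoid W') r)"
  "ide (circle_groupoid W) (fst (circle_shift z) p) = snd (circle_shift z) (ide (circle_groupoid W') p)"
  "snd (snd (circle_shift z) r) = snd r"
  by (auto simp: circle_shift_def split: prod.splits)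

lemma restrict_shift_pull:
  assumes "W \<in> admissible_covers" "W' \<in> admissible_covers" "refines W' W"
  shows "restrict (restrict (F \<circ> fst (circle_shift z)) (circle_Ob (shift_cover z W)) \<circ>
        fst (circle_refine (shift_cover z W))) (circle_Ob (shift_cover z W')) =
      restrict (restrict (F \<circ> fst (circle_refine W)) (circle_Ob W') \<circ> fst (circle_shift z))
        (circle_Ob (shift_cover z W'))"
    and "restrict (restrict (H \<circ> snd (circle_shift z)) (circle_Ar (shift_cover z W)) \<circ>
        snd (circle_refine (shift_cover z W))) (circle_Ar (shift_cover z W')) =
      restrict (restrict (H \<circ> snd (circle_refine W)) (circle_Ar W') \<circ> snd (circle_shift z))
        (circle_Ar (shift_cover z W'))"
proof -
  note W = admissible_fst(1,2)[OF assms(1)] and W' = admissible_fst(1,2)[OF assms(2)]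
  note r = circle_refine_in[OF shift_admissible[OF assms(1)] shift_admissible[OF assms(2)]
      shift_refines[OF assms(3)]]
  show "restrict (restrict (F \<circ> fst (circle_shift z)) (circle_Ob (shift_cover z W)) \<circ>
        fst (circle_refine (shift_cover z W))) (circle_Ob (shift_cover z W')) =
      restrict (restrict (F \<circ> fst (circle_refine W)) (circle_Ob W') \<circ> fst (circle_shift z))
        (circle_Ob (shift_cover z W'))"
    by (intro restrict_ext) (simp add: r circle_shift_in[OF W'] circle_refine_shift[OF W])
  show "restrict (restrict (H \<circ> snd (circle_shift z)) (circle_Ar (shift_cover z W)) \<circ>
        snd (circle_refine (shift_cover z W))) (circle_Ar (shift_cover z W')) =
      restrict (restrict (H \<circ> snd (circle_refine W)) (circle_Ar W') \<circ> snd (circle_shift z))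
        (circle_Ar (shift_cover z W'))"
    by (intro restrict_ext) (simp add: r circle_shift_in[OF W'] circle_refine_shift[OF W])
qed

lemma pull_shift_obj:
  assumes "W \<in> admissible_covers" "W' \<in> admissible_covers" "refines W' W"
  shows "pull_obj (shift_cover z W) (shift_cover z W') (shift_obj z W \<Psi>) = shift_obj z W' (pull_obj W W' \<Psi>)"
  by (simp add: pull_obj_def shift_obj_eq restrict_shift_pull[OF assms])

lemma pull_shift_arr:
  assumes "W \<in> admissible_covers" "W' \<in> admissible_covers" "refines W' W"
  shows "pull_arr (shift_cover z W) (shift_cover z W') (shift_arr z W \<alpha>) = shift_arr z W' (pull_arr W W' \<alpha>)"
  by (cases \<alpha>) (simp add: pull_arr_simp shift_arr_eq pull_shift_obj[OF assms] restrict_shift_pull[OF assms])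

lemma restrict_shift_shift:
  assumes "W \<in> admissible_covers"
  shows "F \<in> extensional (circle_Ob W) \<Longrightarrow>
      restrict (restrict (F \<circ> fst (circle_shift (- z))) (circle_Ob (shift_cover (- z) W)) \<circ> fst (circle_shift z))
        (circle_Ob W) = F"
    and "H \<in> extensional (circle_Ar W) \<Longrightarrow>
      restrict (restrict (H \<circ> snd (circle_shift (- z))) (circle_Ar (shift_cover (- z) W)) \<circ> snd (circle_shift z))
        (circle_Ar W) = H"
proof -
  note W = admissible_fst(1,2)[OF shift_admissible[OF assms, of "- z"]]
  note s = circle_shift_in[OF W, of _ z, unfolded shift_shift[OF assms]]
  show "restrict (restrict (F \<circ> fst (circle_shift (- z))) (circle_Ob (shift_cover (- z) W)) \<circ> fst (circle_shift z))
        (circle_Ob W) = F" if F: "F \<in> extensional (circle_Ob W)"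
    by (rule extensionalityI[OF restrict_extensional F]) (simp add: s, simp add: circle_shift_def case_prod_unfold)
  show "restrict (restrict (H \<circ> snd (circle_shift (- z))) (circle_Ar (shift_cover (- z) W)) \<circ> snd (circle_shift z))
        (circle_Ar W) = H" if H: "H \<in> extensional (circle_Ar W)"
    by (rule extensionalityI[OF restrict_extensional H]) (simp add: s, simp add: circle_shift_def case_prod_unfold)
qed

lemma shift_shift_obj:
  assumes "W \<in> admissible_covers" "\<Psi> \<in> groupoid_morphisms (circle_groupoid W) G"
  shows "shift_obj z (shift_cover (- z) W) (shift_obj (- z) W \<Psi>) = \<Psi>"
  using assms(2)
  by (simp add: shift_obj_eq shift_shift[OF assms(1)] restrict_shift_shift[OF assms(1)] groupoid_morphisms_def)

lemma groupoid_morphism_restrict: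
  assumes "groupoid_morphism (circle_groupoid W) G \<Psi>" "W \<in> admissible_covers"
  shows "(restrict (fst \<Psi>) (circle_Ob W), restrict (snd \<Psi>) (circle_Ar W)) \<in> groupoid_morphisms (circle_groupoid W) G"
proof -
  note \<Psi> = groupoid_morphismD[OF assms(1)]
  have "groupoid_morphism (circle_groupoid W) G (restrict (fst \<Psi>) (circle_Ob W), restrict (snd \<Psi>) (circle_Ar W))"
    by (rule groupoid_morphismI)
      (simp_all add: circle_closed[OF admissible_fst(1,2)[OF assms(2)]] \<Psi>(5-)
        continuous_map_eq[OF \<Psi>(1)] continuous_map_eq[OF \<Psi>(2)])
  then show ?thesis
    by (simp add: groupoid_morphisms_def)
qed

lemma shift_obj_in:
  assumes "W \<in> admissible_covers" "\<Psi> \<in> groupoid_morphisms (circle_groupoid W) G"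
  shows "shift_obj z W \<Psi> \<in> groupoid_morphisms (circle_groupoid (shift_cover z W)) G"
proof -
  have "groupoid_morphism (circle_groupoid (shift_cover z W)) G
      (fst \<Psi> \<circ> fst (circle_shift z), snd \<Psi> \<circ> snd (circle_shift z))"
    using assms(2) by (intro groupoid_morphism_compose[OF groupoid_morphism_circle_shift] admissible_fst assms(1))
      (simp add: groupoid_morphisms_def)
  from groupoid_morphism_restrict[OF this shift_admissible[OF assms(1)]] show ?thesis
    by (simp add: shift_obj_eq)
qed

lemma loop_arrows_iff:
  "(\<Psi>, \<Lambda>, \<Phi>) \<in> loop_arrows G W \<longleftrightarrow>
     \<Psi> \<in> groupoid_morphisms (circle_groupoid W) G \<and> \<Phi> \<in> groupoid_morphisms (circle_groupoid W) G \<and>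
     \<Lambda> \<in> extensional (circle_Ar W) \<and> continuous_map (Ar (circle_groupoid W)) (Ar G) \<Lambda> \<and>
     (\<forall>r\<in>circle_Ar W. src G (\<Lambda> r) = fst \<Psi> (src (circle_groupoid W) r) \<and>
        tgt G (\<Lambda> r) = fst \<Phi> (tgt (circle_groupoid W) r) \<and>
        \<Lambda> r = mul G (snd \<Psi> r) (\<Lambda> (ide (circle_groupoid W) (tgt (circle_groupoid W) r))) \<and>
        \<Lambda> r = mul G (\<Lambda> (ide (circle_groupoid W) (src (circle_groupoid W) r))) (snd \<Phi> r))"
  by (simp add: loop_arrows_def Let_def)

lemma loop_arrow:
  assumes "(\<Psi>, \<Lambda>, \<Phi>) \<in> loop_arrows G W"
  shows "\<Psi> \<in> groupoid_morphisms (circle_groupoid W) G" "\<Phi> \<in> groupoid_morphisms (circle_groupoid W) G"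
    "\<Lambda> \<in> extensional (circle_Ar W)" "continuous_map (Ar (circle_groupoid W)) (Ar G) \<Lambda>"
    "r \<in> circle_Ar W \<Longrightarrow> src G (\<Lambda> r) = fst \<Psi> (src (circle_groupoid W) r)"
    "r \<in> circle_Ar W \<Longrightarrow> tgt G (\<Lambda> r) = fst \<Phi> (tgt (circle_groupoid W) r)"
    "r \<in> circle_Ar W \<Longrightarrow>
      \<Lambda> r = mul G (snd \<Psi> r) (\<Lambda> (ide (circle_groupoid W) (tgt (circle_groupoid W) r)))"
    "r \<in> circle_Ar W \<Longrightarrow>
      \<Lambda> r = mul G (\<Lambda> (ide (circle_groupoid W) (src (circle_groupoid W) r))) (snd \<Phi> r)"
  using assms unfolding loop_arrows_iff by blast+

lemma shift_shift_arr:
  assumes W: "W \<in> admissible_covers" and \<alpha>: "\<alpha> \<in> loop_arrows G W"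
  shows "shift_arr z (shift_cover (- z) W) (shift_arr (- z) W \<alpha>) = \<alpha>"
proof -
  obtain \<Psi> \<Lambda> \<Phi> where a: "\<alpha> = (\<Psi>, \<Lambda>, \<Phi>)"
    by (cases \<alpha>)
  note L = loop_arrow[OF \<alpha>[unfolded a]]
  show ?thesis
    by (simp add: a shift_arr_eq shift_shift[OF W] shift_shift_obj[OF W L(1)] shift_shift_obj[OF W L(2)]
        restrict_shift_shift(2)[OF W L(3)])
qed

text \<open>The equations for an arrow are imposed pointwise and involve the circle groupoid only
  through \<open>src\<close>, \<open>tgt\<close> and \<open>ide\<close>, with which the shift
  commutes. Each one is the original equation at the shifted point.\<close>

lemma shift_arr_in:
  assumes W: "W \<in> admissible_covers" and \<alpha>: "\<alpha> \<in> loop_arrows G W"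
  shows "shift_arr z W \<alpha> \<in> loop_arrows G (shift_cover z W)"
proof -
  obtain \<Psi> \<Lambda> \<Phi> where a: "\<alpha> = (\<Psi>, \<Lambda>, \<Phi>)"
    by (cases \<alpha>)
  note f = admissible_fst(1,2)[OF W] and f' = admissible_fst(1,2)[OF shift_admissible[OF W, of z]]
  note L = loop_arrow[OF \<alpha>[unfolded a]]
  have c: "continuous_map (Ar (circle_groupoid (shift_cover z W))) (Ar G)
      (restrict (\<Lambda> \<circ> snd (circle_shift z)) (circle_Ar (shift_cover z W)))"
    using continuous_map_compose[OF groupoid_morphismD(2)[OF groupoid_morphism_circle_shift[OF f]] L(4)]
    by (rule continuous_map_eq) simp
  have e: "src G (\<Lambda> (snd (circle_shift z) r)) = fst \<Psi> (fst (circle_shift z) (src (circle_groupoid (shift_cover z W)) r)) \<and>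
    tgt G (\<Lambda> (snd (circle_shift z) r)) = fst \<Phi> (fst (circle_shift z) (tgt (circle_groupoid (shift_cover z W)) r)) \<and>
    \<Lambda> (snd (circle_shift z) r) = mul G (snd \<Psi> (snd (circle_shift z) r))
      (\<Lambda> (snd (circle_shift z) (ide (circle_groupoid (shift_cover z W)) (tgt (circle_groupoid (shift_cover z W)) r)))) \<and>
    \<Lambda> (snd (circle_shift z) r) = mul G (\<Lambda> (snd (circle_shift z)
      (ide (circle_groupoid (shift_cover z W)) (src (circle_groupoid (shift_cover z W)) r)))) (snd \<Phi> (snd (circle_shift z) r))"
    if "r \<in> circle_Ar (shift_cover z W)" for r
    using L(5-8)[OF circle_shift_in(2)[OF f that]]
    unfolding circle_shift_simps(1-3)[where W = W and W' = "shift_cover z W"] by (intro conjI)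
  have "shift_obj z W \<Psi> \<in> groupoid_morphisms (circle_groupoid (shift_cover z W)) G"
    "shift_obj z W \<Phi> \<in> groupoid_morphisms (circle_groupoid (shift_cover z W)) G"
    using L(1,2) by (simp_all add: shift_obj_in[OF W])
  with c show ?thesis
    unfolding a shift_arr_eq loop_arrows_iff
  proof (intro conjI restrict_extensional ballI)
    let ?S = "circle_groupoid (shift_cover z W)" and ?\<sigma> = "circle_shift z"
    let ?\<Lambda> = "restrict (\<Lambda> \<circ> snd ?\<sigma>) (circle_Ar (shift_cover z W))"
    fix r assume r: "r \<in> circle_Ar (shift_cover z W)"
    note cl = circle_closed(1-3)[OF f']
    have \<Lambda>: "?\<Lambda> r = \<Lambda> (snd ?\<sigma> r)"
      "?\<Lambda> (ide ?S (src ?S r)) = \<Lambda> (snd ?\<sigma> (ide ?S (src ?S r)))"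
      "?\<Lambda> (ide ?S (tgt ?S r)) = \<Lambda> (snd ?\<sigma> (ide ?S (tgt ?S r)))"
      using r by (simp_all add: cl)
    have o: "fst (shift_obj z W \<Psi>) (src ?S r) = fst \<Psi> (fst ?\<sigma> (src ?S r))"
      "fst (shift_obj z W \<Phi>) (tgt ?S r) = fst \<Phi> (fst ?\<sigma> (tgt ?S r))"
      "snd (shift_obj z W \<Psi>) r = snd \<Psi> (snd ?\<sigma> r)" "snd (shift_obj z W \<Phi>) r = snd \<Phi> (snd ?\<sigma> r)"
      using r by (simp_all add: cl shift_obj_eq)
    note e' = e[OF r]
    show "src G (?\<Lambda> r) = fst (shift_obj z W \<Psi>) (src ?S r)"
      unfolding \<Lambda> o using e' by (elim conjE)
    show "tgt G (?\<Lambda> r) = fst (shift_obj z W \<Phi>) (tgt ?S r)"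
      unfolding \<Lambda> o using e' by (elim conjE)
    show "?\<Lambda> r = mul G (snd (shift_obj z W \<Psi>) r) (?\<Lambda> (ide ?S (tgt ?S r)))"
      unfolding \<Lambda> o using e' by (elim conjE)
    show "?\<Lambda> r = mul G (?\<Lambda> (ide ?S (src ?S r))) (snd (shift_obj z W \<Phi>) r)"
      unfolding \<Lambda> o using e' by (elim conjE)
  qed
qed

section \<open>Constant loops\<close>

text \<open>The composite of \<open>\<phi>\<close> with the morphism from the circle groupoid to the
  delooping of the integers that sends an arrow to its degree \<open>snd r\<close>.\<close>

definition const_obj :: "cover \<Rightarrow> ('o, 'a) hom_obj \<Rightarrow> ('o, 'a) loop_obj" where
  "const_obj W \<phi> = (\<lambda>p\<in>circle_Ob W. fst \<phi> (), \<lambda>r\<in>circle_Ar W. snd \<phi> (snd r))"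

definition const_arr :: "cover \<Rightarrow> ('o, 'a) hom_arr \<Rightarrow> ('o, 'a) loop_arr" where
  "const_arr W = (\<lambda>(\<phi>, \<kappa>, \<psi>). (const_obj W \<phi>, \<lambda>r\<in>circle_Ar W. \<kappa> (snd r), const_obj W \<psi>))"

lemma pull_const_obj:
  assumes "W \<in> admissible_covers" "W' \<in> admissible_covers" "refines W' W"
  shows "pull_obj W W' (const_obj W \<phi>) = const_obj W' \<phi>"
  using circle_refine_in[OF assms] circle_refine_simps(4)[OF admissible_fst(1,2)[OF assms(1)]]
  by (auto simp: pull_obj_def const_obj_def intro!: restrict_ext)

lemma pull_const_arr:
  assumes "W \<in> admissible_covers" "W' \<in> admissible_covers" "refines W' W"
  shows "pull_arr W W' (const_arr W a) = const_arr W' a"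
  using circle_refine_in[OF assms] circle_refine_simps(4)[OF admissible_fst(1,2)[OF assms(1)]]
  by (cases a) (auto simp: pull_arr_simp const_arr_def pull_const_obj[OF assms] intro!: restrict_ext)

lemma shift_const_obj:
  assumes "W \<in> admissible_covers"
  shows "shift_obj z W (const_obj W \<phi>) = const_obj (shift_cover z W) \<phi>"
  using circle_shift_in[OF admissible_fst(1,2)[OF assms]]
  by (auto simp: shift_obj_eq const_obj_def circle_shift_simps intro!: restrict_ext)

lemma shift_const_arr:
  assumes "W \<in> admissible_covers"
  shows "shift_arr z W (const_arr W a) = const_arr (shift_cover z W) a"
  using circle_shift_in[OF admissible_fst(1,2)[OF assms]]
  by (cases a) (auto simp: shift_arr_eq const_arr_def shift_const_obj[OF assms] circle_shift_simps intro!: restrict_ext)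

context groupoid_space
begin

lemma const_obj_in:
  assumes W: "W \<in> admissible_covers" and \<phi>: "\<phi> \<in> hom_objects"
  shows "const_obj W \<phi> \<in> groupoid_morphisms (circle_groupoid W) G"
proof -
  have "continuous_map (Ar (circle_groupoid W)) (Ar G) (\<lambda>r. snd \<phi> (snd r))"
    using continuous_map_compose[OF continuous_circle_degree, of "Ar G" "snd \<phi>"] \<phi>
    by (auto simp: comp_def hom_object)
  then have "groupoid_morphism (circle_groupoid W) G (\<lambda>p. fst \<phi> (), \<lambda>r. snd \<phi> (snd r))"
    using \<phi> by (intro groupoid_morphismI) (auto simp: hom_object)
  from groupoid_morphism_restrict[OF this W] show ?thesis
    by (simp add: const_obj_def)
qed

lemma const_arr_in:
  assumes W: "W \<in> admissible_covers" and a: "a \<in> hom_arrows G"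
  shows "const_arr W a \<in> loop_arrows G W"
proof -
  obtain \<phi> \<kappa> \<psi> where a_eq: "a = (\<phi>, \<kappa>, \<psi>)"
    by (cases a)
  note h = hom_arrow[OF a[unfolded a_eq]]
  note f = admissible_fst(1,2)[OF W]
  have "continuous_map (Ar (circle_groupoid W)) (Ar G) (\<lambda>r. \<kappa> (snd r))"
    using continuous_map_compose[OF continuous_circle_degree, of "Ar G" "\<kappa>"] h
    by (auto simp: comp_def)
  then have c: "continuous_map (Ar (circle_groupoid W)) (Ar G) (\<lambda>r\<in>circle_Ar W. \<kappa> (snd r))"
    by (rule continuous_map_eq) simp
  have d: "snd (ide (circle_groupoid W) p) = 0" for p
    by (cases p) simp
  show ?thesis
    unfolding a_eq const_arr_def prod.case loop_arrows_iff
    using c h const_obj_in[OF W] by (simp add: const_obj_def circle_closed[OF f] d)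
qed

section \<open>The loop groupoid as a colimit\<close>

abbreviation "LG \<equiv> loop_groupoid G"

lemma topspace_loop_Ob: "topspace (Ob (loop_groupoid_at G W)) = groupoid_morphisms (circle_groupoid W) G"
  by (auto simp: loop_groupoid_at_def Let_def groupoid_morphisms_def groupoid_morphism_def)

lemma topspace_loop_Ar: "topspace (Ar (loop_groupoid_at G W)) = loop_arrows G W"
proof -
  have "continuous_map (Ob (circle_groupoid W)) (Ar G)
      (restrict (\<Lambda> \<circ> ide (circle_groupoid W)) (circle_Ob W))"
    if "(\<Psi>, \<Lambda>, \<Phi>) \<in> loop_arrows G W" for \<Psi> \<Lambda> \<Phi>
    using continuous_map_compose[OF continuous_circle_ide loop_arrow(4)[OF that]]
    by (rule continuous_map_eq) simp
  moreover have "continuous_map (Ar (circle_groupoid W)) (Ar G) (snd \<Psi>)" "snd \<Psi> \<in> extensional (circle_Ar W)"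
    if "(\<Psi>, \<Lambda>, \<Phi>) \<in> loop_arrows G W" for \<Psi> \<Lambda> \<Phi>
    using loop_arrow(1)[OF that] by (auto simp: groupoid_morphisms_def groupoid_morphism_def)
  ultimately have "(\<Psi>, \<Lambda>, \<Phi>) \<in> topspace (Ar (loop_groupoid_at G W)) \<longleftrightarrow> (\<Psi>, \<Lambda>, \<Phi>) \<in> loop_arrows G W"
    for \<Psi> \<Lambda> \<Phi>
    unfolding loop_groupoid_at_def Let_def top_groupoid.select_convs topspace_pullback_topology
    by (simp add: vimage_def) blast
  then show ?thesis
    by auto
qed

lemma common_refinement:
  "\<lbrakk>W \<in> admissible_covers; W' \<in> admissible_covers\<rbrakk> \<Longrightarrow> \<exists>U\<in>admissible_covers. refines U W \<and> refines U W'"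
  using spaced_refinement by blast

sublocale Obj: directed_system admissible_covers refines "\<lambda>W. Ob (loop_groupoid_at G W)" pull_obj
  by unfold_locales (auto simp: pull_obj_pull_obj common_refinement intro: refines_trans)

sublocale Arr: directed_system admissible_covers refines "\<lambda>W. Ar (loop_groupoid_at G W)" pull_arr
  by unfold_locales (auto simp: pull_arr_pull_arr common_refinement intro: refines_trans)

lemma loop_at_simps:
  "src (loop_groupoid_at G W) (\<Psi>, \<Lambda>, \<Phi>) = \<Psi>" "tgt (loop_groupoid_at G W) (\<Psi>, \<Lambda>, \<Phi>) = \<Phi>"
  "ide (loop_groupoid_at G W) \<Psi> = (\<Psi>, snd \<Psi>, \<Psi>)"
  "ginv (loop_groupoid_at G W) (\<Psi>, \<Lambda>, \<Phi>) = (\<Phi>, \<lambda>r\<in>circle_Ar W.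
    mul G (ginv G (\<Lambda> (ide (circle_groupoid W) (src (circle_groupoid W) r)))) (snd \<Psi> r), \<Psi>)"
  "mul (loop_groupoid_at G W) (\<Psi>, \<Lambda>, \<Phi>) (\<Phi>', \<Omega>, \<Gamma>) = (\<Psi>, \<lambda>r\<in>circle_Ar W.
    mul G (mul G (\<Lambda> (ide (circle_groupoid W) (src (circle_groupoid W) r)))
      (\<Omega> (ide (circle_groupoid W) (src (circle_groupoid W) r)))) (snd \<Gamma> r), \<Gamma>)"
  by (simp_all add: loop_groupoid_at_def Let_def)

text \<open>Purely formal: inverse and product are computed pointwise from values at
  \<open>r\<close> and at the identity of its source, and \<open>circle_refine\<close> respects
  both. This makes the structure maps on classes independent of representatives.\<close>

lemma pull_structure:
  assumes W: "W \<in> admissible_covers" "W' \<in> admissible_covers" "refines W' W"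
  shows "src (loop_groupoid_at G W') (pull_arr W W' \<alpha>) = pull_obj W W' (src (loop_groupoid_at G W) \<alpha>)"
    and "tgt (loop_groupoid_at G W') (pull_arr W W' \<alpha>) = pull_obj W W' (tgt (loop_groupoid_at G W) \<alpha>)"
    and "ide (loop_groupoid_at G W') (pull_obj W W' \<Psi>) = pull_arr W W' (ide (loop_groupoid_at G W) \<Psi>)"
    and "ginv (loop_groupoid_at G W') (pull_arr W W' \<alpha>) = pull_arr W W' (ginv (loop_groupoid_at G W) \<alpha>)"
    and "mul (loop_groupoid_at G W') (pull_arr W W' \<alpha>) (pull_arr W W' \<beta>) =
      pull_arr W W' (mul (loop_groupoid_at G W) \<alpha> \<beta>)"
proof -
  note f = admissible_fst(1,2)[OF W(1)] and f' = admissible_fst(1,2)[OF W(2)]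
  note s = circle_refine_simps(1,3)[OF f, of _ W', THEN sym] circle_refine_in[OF W] circle_closed[OF f]
    circle_closed[OF f']
  obtain \<Psi>1 \<Lambda>1 \<Phi>1 \<Psi>2 \<Lambda>2 \<Phi>2 where a: "\<alpha> = (\<Psi>1, \<Lambda>1, \<Phi>1)" "\<beta> = (\<Psi>2, \<Lambda>2, \<Phi>2)"
    by (cases \<alpha>; cases \<beta>)
  show "src (loop_groupoid_at G W') (pull_arr W W' \<alpha>) = pull_obj W W' (src (loop_groupoid_at G W) \<alpha>)"
    "tgt (loop_groupoid_at G W') (pull_arr W W' \<alpha>) = pull_obj W W' (tgt (loop_groupoid_at G W) \<alpha>)"
    "ide (loop_groupoid_at G W') (pull_obj W W' \<Psi>) = pull_arr W W' (ide (loop_groupoid_at G W) \<Psi>)"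
    by (simp_all add: a pull_arr_simp loop_at_simps) (simp add: pull_obj_def)
  show "ginv (loop_groupoid_at G W') (pull_arr W W' \<alpha>) = pull_arr W W' (ginv (loop_groupoid_at G W) \<alpha>)"
    "mul (loop_groupoid_at G W') (pull_arr W W' \<alpha>) (pull_arr W W' \<beta>) =
      pull_arr W W' (mul (loop_groupoid_at G W) \<alpha> \<beta>)"
    unfolding a pull_arr_simp loop_at_simps prod.inject
    by (intro conjI refl restrict_ext; simp add: pull_obj_def s)+
qed

lemma const_structure:
  assumes W: "W \<in> admissible_covers"
  shows "src (loop_groupoid_at G W) (const_arr W a) = const_obj W (src Hom a)"
    and "tgt (loop_groupoid_at G W) (const_arr W a) = const_obj W (tgt Hom a)"
    and "ide (loop_groupoid_at G W) (const_obj W \<phi>) = const_arr W (ide Hom \<phi>)"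
    and "ginv (loop_groupoid_at G W) (const_arr W a) = const_arr W (ginv Hom a)"
    and "mul (loop_groupoid_at G W) (const_arr W a) (const_arr W b) = const_arr W (mul Hom a b)"
proof -
  note f = admissible_fst(1,2)[OF W]
  have d: "snd (ide (circle_groupoid W) p) = 0" for p
    by (cases p) simp
  obtain \<phi>1 \<kappa>1 \<psi>1 \<phi>2 \<kappa>2 \<psi>2 where a: "a = (\<phi>1, \<kappa>1, \<psi>1)" "b = (\<phi>2, \<kappa>2, \<psi>2)"
    by (cases a; cases b)
  show "src (loop_groupoid_at G W) (const_arr W a) = const_obj W (src Hom a)"
    "tgt (loop_groupoid_at G W) (const_arr W a) = const_obj W (tgt Hom a)"
    "ide (loop_groupoid_at G W) (const_obj W \<phi>) = const_arr W (ide Hom \<phi>)"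
    by (simp_all add: a const_arr_def loop_at_simps) (simp add: const_obj_def)
  show "ginv (loop_groupoid_at G W) (const_arr W a) = const_arr W (ginv Hom a)"
    "mul (loop_groupoid_at G W) (const_arr W a) (const_arr W b) = const_arr W (mul Hom a b)"
    unfolding a const_arr_def loop_at_simps prod.case Hom_simps prod.inject
    by (intro conjI refl restrict_ext; simp add: const_obj_def d circle_closed[OF f])+
qed

lemma LG_simps:
  "Ob LG = Obj.colim" "Ar LG = Arr.colim"
  "src LG c = (THE d. \<exists>(W, \<alpha>)\<in>c. d = Obj.cls W (src (loop_groupoid_at G W) \<alpha>))"
  "tgt LG c = (THE d. \<exists>(W, \<alpha>)\<in>c. d = Obj.cls W (tgt (loop_groupoid_at G W) \<alpha>))"
  "ide LG e = (THE d. \<exists>(W, \<Psi>)\<in>e. d = Arr.cls W (ide (loop_groupoid_at G W) \<Psi>))"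
  "ginv LG c = (THE d. \<exists>(W, \<alpha>)\<in>c. d = Arr.cls W (ginv (loop_groupoid_at G W) \<alpha>))"
  "mul LG c c' = (THE d. \<exists>W \<alpha> \<beta>. (W, \<alpha>) \<in> c \<and> (W, \<beta>) \<in> c' \<and>
        (\<alpha>, \<beta>) \<in> composable (loop_groupoid_at G W) \<and>
        d = Arr.cls W (mul (loop_groupoid_at G W) \<alpha> \<beta>))"
  by (simp_all add: loop_groupoid_def)

lemma LG_structure:
  assumes W: "W \<in> admissible_covers" and \<alpha>: "\<alpha> \<in> loop_arrows G W"
    and \<Psi>: "\<Psi> \<in> groupoid_morphisms (circle_groupoid W) G"
  shows "src LG (Arr.cls W \<alpha>) = Obj.cls W (src (loop_groupoid_at G W) \<alpha>)"
    and "tgt LG (Arr.cls W \<alpha>) = Obj.cls W (tgt (loop_groupoid_at G W) \<alpha>)"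
    and "ide LG (Obj.cls W \<Psi>) = Arr.cls W (ide (loop_groupoid_at G W) \<Psi>)"
    and "ginv LG (Arr.cls W \<alpha>) = Arr.cls W (ginv (loop_groupoid_at G W) \<alpha>)"
proof -
  have \<alpha>': "(W, \<alpha>) \<in> Arr.cls W \<alpha>" and \<Psi>': "(W, \<Psi>) \<in> Obj.cls W \<Psi>"
    using assms Arr.cls_refl Obj.cls_refl by (simp_all add: topspace_loop_Ar topspace_loop_Ob)
  have "Obj.cls V (src (loop_groupoid_at G V) \<beta>) = Obj.cls W (src (loop_groupoid_at G W) \<alpha>) \<and>
      Obj.cls V (tgt (loop_groupoid_at G V) \<beta>) = Obj.cls W (tgt (loop_groupoid_at G W) \<alpha>) \<and>
      Arr.cls V (ginv (loop_groupoid_at G V) \<beta>) = Arr.cls W (ginv (loop_groupoid_at G W) \<alpha>)"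
    if V: "(V, \<beta>) \<in> Arr.cls W \<alpha>" for V \<beta>
  proof -
    obtain U where U: "V \<in> admissible_covers" "U \<in> admissible_covers" "refines U W" "refines U V"
      "pull_arr W U \<alpha> = pull_arr V U \<beta>"
      using Arr.cls_memD[OF V] by blast
    show ?thesis
      using U W by (intro conjI Obj.cls_eqI[of V W U] Arr.cls_eqI[of V W U])
        (simp_all flip: pull_structure)
  qed
  then show "src LG (Arr.cls W \<alpha>) = Obj.cls W (src (loop_groupoid_at G W) \<alpha>)"
    "tgt LG (Arr.cls W \<alpha>) = Obj.cls W (tgt (loop_groupoid_at G W) \<alpha>)"
    "ginv LG (Arr.cls W \<alpha>) = Arr.cls W (ginv (loop_groupoid_at G W) \<alpha>)"
    unfolding LG_simps by (intro the_on_class[OF \<alpha>']; blast)+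
  show "ide LG (Obj.cls W \<Psi>) = Arr.cls W (ide (loop_groupoid_at G W) \<Psi>)"
    unfolding LG_simps
  proof (rule the_on_class[OF \<Psi>'])
    fix V \<Phi> assume V: "(V, \<Phi>) \<in> Obj.cls W \<Psi>"
    obtain U where U: "V \<in> admissible_covers" "U \<in> admissible_covers" "refines U W" "refines U V"
      "pull_obj W U \<Psi> = pull_obj V U \<Phi>"
      using Obj.cls_memD[OF V] by blast
    show "Arr.cls V (ide (loop_groupoid_at G V) \<Phi>) = Arr.cls W (ide (loop_groupoid_at G W) \<Psi>)"
      using U W by (intro Arr.cls_eqI[of V W U]) (simp_all flip: pull_structure)
  qed
qed

lemma LG_mul:
  assumes W: "W \<in> admissible_covers"
    and \<alpha>\<beta>: "\<alpha> \<in> loop_arrows G W" "\<beta> \<in> loop_arrows G W"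
      "tgt (loop_groupoid_at G W) \<alpha> = src (loop_groupoid_at G W) \<beta>"
  shows "mul LG (Arr.cls W \<alpha>) (Arr.cls W \<beta>) = Arr.cls W (mul (loop_groupoid_at G W) \<alpha> \<beta>)"
  unfolding LG_simps
proof (rule the_equality)
  show "\<exists>V \<gamma> \<delta>. (V, \<gamma>) \<in> Arr.cls W \<alpha> \<and> (V, \<delta>) \<in> Arr.cls W \<beta> \<and>
        (\<gamma>, \<delta>) \<in> composable (loop_groupoid_at G V) \<and>
        Arr.cls W (mul (loop_groupoid_at G W) \<alpha> \<beta>) = Arr.cls V (mul (loop_groupoid_at G V) \<gamma> \<delta>)"
    using assms Arr.cls_refl[OF W, unfolded topspace_loop_Ar]
    by (intro exI[of _ W] exI[of _ \<alpha>] exI[of _ \<beta>]) (simp add: topspace_loop_Ar composable_def)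
next
  fix d
  assume "\<exists>V \<gamma> \<delta>. (V, \<gamma>) \<in> Arr.cls W \<alpha> \<and> (V, \<delta>) \<in> Arr.cls W \<beta> \<and>
        (\<gamma>, \<delta>) \<in> composable (loop_groupoid_at G V) \<and> d = Arr.cls V (mul (loop_groupoid_at G V) \<gamma> \<delta>)"
  then obtain V \<gamma> \<delta> where V: "(V, \<gamma>) \<in> Arr.cls W \<alpha>" "(V, \<delta>) \<in> Arr.cls W \<beta>"
    and d: "d = Arr.cls V (mul (loop_groupoid_at G V) \<gamma> \<delta>)"
    by blast
  obtain U where U: "V \<in> admissible_covers" "U \<in> admissible_covers" "refines U W" "refines U V"
    "pull_arr W U \<alpha> = pull_arr V U \<gamma>"
    using Arr.cls_memD[OF V(1)] by blast
  obtain U' where U': "U' \<in> admissible_covers" "refines U' W" "refines U' V"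
    "pull_arr W U' \<beta> = pull_arr V U' \<delta>"
    using Arr.cls_memD[OF V(2)] by blast
  \<comment> \<open>The two pairs of representatives become equal over possibly different
    refinements \<open>U\<close> and \<open>U'\<close>. Over \<open>T\<close> both identifications
    hold, so the products agree there.\<close>
  obtain T where T: "T \<in> admissible_covers" "refines T U" "refines T U'"
    using spaced_refinement[OF U(2) U'(1)] by blast
  have r: "refines T W" "refines T V"
    using T U refines_trans by blast+
  have "pull_arr W T \<alpha> = pull_arr V T \<gamma>"
    using pull_arr_pull_arr[OF W U(2) T(1) U(3) T(2), of \<alpha>] pull_arr_pull_arr[OF U(1,2) T(1) U(4) T(2), of \<gamma>] U
    by simp
  moreover have "pull_arr W T \<beta> = pull_arr V T \<delta>"
    using pull_arr_pull_arr[OF W U'(1) T(1) U'(2) T(3), of \<beta>]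
      pull_arr_pull_arr[OF U(1) U'(1) T(1) U'(3) T(3), of \<delta>] U' by simp
  ultimately show "d = Arr.cls W (mul (loop_groupoid_at G W) \<alpha> \<beta>)"
    unfolding d using W U T r by (intro Arr.cls_eqI[of V W T]) (simp_all flip: pull_structure)
qed

end

section \<open>Base points\<close>

definition one_point_cover :: cover where
  "one_point_cover = ({1}, 1 / 2)"

text \<open>The break points are the integers, and half their distance is the largest width for
  which the cover is spaced.\<close>

lemma one_point_cover_admissible: "one_point_cover \<in> admissible_covers"
proof (rule spaced_imp_admissible)
  have "1 \<le> \<bar>p - q\<bar>" if pq: "p \<in> breaks one_point_cover" "q \<in> breaks one_point_cover" "p \<noteq> q" for p q
  proof -
    obtain j k where jk: "p = 1 + of_int j" "q = 1 + of_int k"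
      using pq by (auto simp: breaks_def one_point_cover_def)
    then have "1 \<le> \<bar>j - k\<bar>"
      using pq by auto
    then have "1 \<le> \<bar>real_of_int (j - k)\<bar>"
      by linarith
    then show ?thesis
      by (simp add: jk)
  qed
  then show "spaced one_point_cover"
    by (simp add: spaced_def) (simp add: one_point_cover_def)
qed (simp_all add: one_point_cover_def)

text \<open>The index of the interval around \<open>0\<close> is chosen compatibly with refinement, so evaluation
  at these points is defined on the colimit.\<close>

definition basepoint :: "cover \<Rightarrow> int \<Rightarrow> ((real \<times> real) \<times> real) \<times> int" where
  "basepoint W n = (((coarsen W 0, coarsen W 0), 0), n)"

lemma basepoint_in:
  assumes "W \<in> admissible_covers"
  shows "basepoint W n \<in> circle_Ar W"
  using coarsen_in[OF admissible_fst(1,2)[OF assms]] in_ivl_coarsen[OF admissible_fst(1-3)[OF assms]]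
  by (simp add: basepoint_def topspace_circle_Ar)

lemma refine_basepoint:
  assumes "W \<in> admissible_covers" "W' \<in> admissible_covers" "refines W' W"
  shows "snd (circle_refine W) (basepoint W' n) = basepoint W n"
  using coarsen_coarsen[OF admissible_fst(1,2)[OF assms(2)] breaks_mono[OF assms(3)]]
  by (simp add: basepoint_def circle_refine_def)

lemma snd_basepoint [simp]: "snd (basepoint W n) = n"
  by (simp add: basepoint_def)

lemma ide_src_basepoint: "ide (circle_groupoid W) (src (circle_groupoid W) (basepoint W n)) = basepoint W 0"
  by (simp add: basepoint_def)

context groupoid_space
begin

section \<open>Constant loops are fixed\<close>

lemma cls_const_obj:
  assumes "W \<in> admissible_covers" "W' \<in> admissible_covers"
  shows "Obj.cls W (const_obj W \<phi>) = Obj.cls W' (const_obj W' \<phi>)"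
proof -
  obtain U where U: "U \<in> admissible_covers" "refines U W" "refines U W'"
    using common_refinement[OF assms] by blast
  then show ?thesis
    using assms by (intro Obj.cls_eqI[of W W' U]) (simp_all add: pull_const_obj)
qed

lemma cls_const_arr:
  assumes "W \<in> admissible_covers" "W' \<in> admissible_covers"
  shows "Arr.cls W (const_arr W a) = Arr.cls W' (const_arr W' a)"
proof -
  obtain U where U: "U \<in> admissible_covers" "refines U W" "refines U W'"
    using common_refinement[OF assms] by blast
  then show ?thesis
    using assms by (intro Arr.cls_eqI[of W W' U]) (simp_all add: pull_const_arr)
qed

lemma cls_pull_const_obj:
  assumes W: "W \<in> admissible_covers" "U \<in> admissible_covers" "refines U W"
    and eq: "pull_obj W U \<Psi> = const_obj U \<phi>"
  shows "Obj.cls W \<Psi> = Obj.cls U (const_obj U \<phi>)"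
  using assms by (intro Obj.cls_eqI[of W U U]) (simp_all add: pull_const_obj)

lemma cls_pull_const_arr:
  assumes W: "W \<in> admissible_covers" "U \<in> admissible_covers" "refines U W"
    and eq: "pull_arr W U \<alpha> = const_arr U a"
  shows "Arr.cls W \<alpha> = Arr.cls U (const_arr U a)"
  using assms by (intro Arr.cls_eqI[of W U U]) (simp_all add: pull_const_arr)

text \<open>A class is moved as a set of representatives, so it is shown to be stable under every
  shift; stability under \<open>- z\<close> then gives the reverse inclusion. A representative
  becomes constant after refinement, and shifting a constant loop changes only its cover.\<close>

lemma act_obj_const:
  assumes W: "W \<in> admissible_covers"
  shows "act_obj z (Obj.cls W (const_obj W \<phi>)) = Obj.cls W (const_obj W \<phi>)"
proof -
  let ?c = "Obj.cls W (const_obj W \<phi>)"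
  have shift: "(shift_cover z V, shift_obj z V \<Psi>) \<in> ?c" if V: "(V, \<Psi>) \<in> ?c" for z V \<Psi>
  proof -
    obtain U where U: "V \<in> admissible_covers" "U \<in> admissible_covers" "refines U W" "refines U V"
      "pull_obj W U (const_obj W \<phi>) = pull_obj V U \<Psi>"
      using Obj.cls_memD[OF V] by blast
    have \<Psi>: "shift_obj z V \<Psi> \<in> groupoid_morphisms (circle_groupoid (shift_cover z V)) G"
      using Obj.cls_memD(2)[OF V] by (intro shift_obj_in U) (simp add: topspace_loop_Ob)
    have "pull_obj (shift_cover z V) (shift_cover z U) (shift_obj z V \<Psi>) = const_obj (shift_cover z U) \<phi>"
      using U W by (simp add: pull_shift_obj shift_const_obj pull_const_obj flip: U(5))
    then have "Obj.cls (shift_cover z V) (shift_obj z V \<Psi>) = Obj.cls (shift_cover z U) (const_obj (shift_cover z U) \<phi>)"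
      by (intro cls_pull_const_obj shift_admissible shift_refines U)
    also have "\<dots> = ?c"
      by (intro cls_const_obj shift_admissible U W)
    finally show ?thesis
      using Obj.cls_refl[OF shift_admissible[OF U(1)], of "shift_obj z V \<Psi>" z] \<Psi>
      by (simp add: topspace_loop_Ob)
  qed
  have "(V, \<Psi>) \<in> act_obj z ?c" if V: "(V, \<Psi>) \<in> ?c" for V \<Psi>
  proof -
    have "shift_cover z (shift_cover (- z) V) = V" "shift_obj z (shift_cover (- z) V) (shift_obj (- z) V \<Psi>) = \<Psi>"
      using Obj.cls_memD[OF V] by (simp_all add: shift_shift shift_shift_obj topspace_loop_Ob)
    with shift[OF V, of "- z"] show ?thesis
      unfolding act_obj_def by (intro image_eqI[of _ _ "(shift_cover (- z) V, shift_obj (- z) V \<Psi>)"]) auto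
  qed
  with shift show ?thesis
    unfolding act_obj_def by (intro equalityI subsetI) auto
qed

lemma act_arr_const:
  assumes W: "W \<in> admissible_covers"
  shows "act_arr z (Arr.cls W (const_arr W a)) = Arr.cls W (const_arr W a)"
proof -
  let ?c = "Arr.cls W (const_arr W a)"
  have shift: "(shift_cover z V, shift_arr z V \<alpha>) \<in> ?c" if V: "(V, \<alpha>) \<in> ?c" for z V \<alpha>
  proof -
    obtain U where U: "V \<in> admissible_covers" "U \<in> admissible_covers" "refines U W" "refines U V"
      "pull_arr W U (const_arr W a) = pull_arr V U \<alpha>"
      using Arr.cls_memD[OF V] by blast
    have \<alpha>: "shift_arr z V \<alpha> \<in> loop_arrows G (shift_cover z V)"
      using Arr.cls_memD(2)[OF V] by (intro shift_arr_in U) (simp add: topspace_loop_Ar)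
    have "pull_arr (shift_cover z V) (shift_cover z U) (shift_arr z V \<alpha>) = const_arr (shift_cover z U) a"
      using U W by (simp add: pull_shift_arr shift_const_arr pull_const_arr flip: U(5))
    then have "Arr.cls (shift_cover z V) (shift_arr z V \<alpha>) = Arr.cls (shift_cover z U) (const_arr (shift_cover z U) a)"
      by (intro cls_pull_const_arr shift_admissible shift_refines U)
    also have "\<dots> = ?c"
      by (intro cls_const_arr shift_admissible U W)
    finally show ?thesis
      using Arr.cls_refl[OF shift_admissible[OF U(1)], of "shift_arr z V \<alpha>" z] \<alpha>
      by (simp add: topspace_loop_Ar)
  qed
  have "(V, \<alpha>) \<in> act_arr z ?c" if V: "(V, \<alpha>) \<in> ?c" for V \<alpha>
  proof -
    have "shift_cover z (shift_cover (- z) V) = V" "shift_arr z (shift_cover (- z) V) (shift_arr (- z) V \<alpha>) = \<alpha>"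
      using Arr.cls_memD[OF V] by (simp_all add: shift_shift shift_shift_arr topspace_loop_Ar)
    with shift[OF V, of "- z"] show ?thesis
      unfolding act_arr_def by (intro image_eqI[of _ _ "(shift_cover (- z) V, shift_arr (- z) V \<alpha>)"]) auto
  qed
  with shift show ?thesis
    unfolding act_arr_def by (intro equalityI subsetI) auto
qed

section \<open>Fixed loops are constant\<close>

text \<open>The values of a loop at the arrows starting at the base point. They need not compose for
  a general loop, since the arrow of degree \<open>m\<close> ends over the point \<open>m\<close>
  and not over \<open>0\<close>.\<close>

definition monodromy :: "cover \<Rightarrow> ('o, 'a) loop_obj \<Rightarrow> ('o, 'a) hom_obj" where
  "monodromy W \<Psi> = (\<lambda>_. fst \<Psi> (src (circle_groupoid W) (basepoint W 0)), \<lambda>n. snd \<Psi> (basepoint W n))"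

text \<open>The arrow of degree \<open>n\<close> at the point \<open>m\<close> extends
  \<open>basepoint W m\<close> to \<open>basepoint W (m + n)\<close>, and by \<open>diag\<close> its
  value is the one at \<open>basepoint W n\<close>. Inverses are treated likewise.\<close>

lemma monodromy_in:
  assumes W: "W \<in> admissible_covers" and \<Psi>: "\<Psi> \<in> groupoid_morphisms (circle_groupoid W) G"
    and diag: "\<And>x l. snd \<Psi> (((coarsen W x, coarsen W x), x), l) = snd \<Psi> (basepoint W l)"
  shows "monodromy W \<Psi> \<in> hom_objects"
proof -
  let ?S = "circle_groupoid W"
  note f = admissible_fst(1,2)[OF W]
  have "groupoid_morphism ?S G \<Psi>"
    using \<Psi> by (simp add: groupoid_morphisms_def)
  note m = groupoid_morphismD[OF this]
  note b = basepoint_in[OF W]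
  have b': "(((coarsen W x, coarsen W x), x), l) \<in> circle_Ar W" for x l
    using coarsen_in[OF f] in_ivl_coarsen[OF f admissible_fst(3)[OF W]] by (simp add: topspace_circle_Ar)
  have tgt: "tgt ?S (basepoint W n) = (coarsen W (of_int n), of_int n)" for n
    using coarsen_add_int[OF f, of 0 n] by (simp add: basepoint_def)
  have base: "fst \<Psi> (coarsen W x, x) = fst \<Psi> (src ?S (basepoint W 0))" for x
    using m(5)[OF b'[of x 0]] m(5)[OF b[of 0]] diag[of x 0] by simp
  have "snd \<Psi> (basepoint W (m + n)) = mul G (snd \<Psi> (basepoint W m)) (snd \<Psi> (basepoint W n))" for m n
  proof -
    let ?q = "(((coarsen W (of_int m), coarsen W (of_int m)), of_int m), n)"
    have "mul ?S (basepoint W m) ?q = basepoint W (m + n)"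
      using coarsen_add_int[OF f, of 0 m] by (simp add: basepoint_def)
    moreover have "snd \<Psi> (mul ?S (basepoint W m) ?q) = mul G (snd \<Psi> (basepoint W m)) (snd \<Psi> ?q)"
      using b b' by (intro groupoid_morphismD(9)[OF \<open>groupoid_morphism ?S G \<Psi>\<close>]) (simp_all add: tgt)
    ultimately show ?thesis
      by (simp add: diag)
  qed
  moreover have "snd \<Psi> (basepoint W (- n)) = ginv G (snd \<Psi> (basepoint W n))" for n
  proof -
    have "ginv ?S (basepoint W n) = (((coarsen W (of_int n), coarsen W (of_int n)), of_int n), - n)"
      using coarsen_add_int[OF f, of 0 n] by (simp add: basepoint_def)
    then show ?thesis
      using m(7)[OF b[of n]] diag by simp
  qed
  moreover have "snd \<Psi> (basepoint W 0) = ide G (fst \<Psi> (src ?S (basepoint W 0)))"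
    using m(8)[OF circle_closed(1)[OF f b[of 0]]] by (simp add: ide_src_basepoint)
  moreover have "src G (snd \<Psi> (basepoint W n)) = fst \<Psi> (src ?S (basepoint W 0))"
    "tgt G (snd \<Psi> (basepoint W n)) = fst \<Psi> (src ?S (basepoint W 0))" for n
    using m(5)[OF b[of n]] m(6)[OF b[of n]] by (simp_all only: tgt base) (simp add: basepoint_def)
  ultimately show ?thesis
    unfolding hom_objects_iff monodromy_def fst_conv snd_conv
    using m(3)[OF circle_closed(1)[OF f b[of 0]]] m(4)[OF b] by simp
qed

text \<open>Constancy is assumed for arrows only. An object is the source of its identity arrow,
  which has degree 0, so the values on objects are constant as well.\<close>

lemma pull_obj_constant:
  assumes W: "W \<in> admissible_covers" "W' \<in> admissible_covers" "refines W' W"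
    and \<Psi>: "\<Psi> \<in> groupoid_morphisms (circle_groupoid W) G"
    and const: "\<And>r. r \<in> circle_Ar W' \<Longrightarrow> snd \<Psi> (snd (circle_refine W) r) = snd \<Psi> (basepoint W (snd r))"
  shows "pull_obj W W' \<Psi> = const_obj W' (monodromy W \<Psi>)"
proof -
  note f = admissible_fst(1,2)[OF W(1)] and f' = admissible_fst(1,2)[OF W(2)]
  have "groupoid_morphism (circle_groupoid W) G \<Psi>"
    using \<Psi> by (simp add: groupoid_morphisms_def)
  note m = groupoid_morphismD[OF this]
  have "fst \<Psi> (fst (circle_refine W) p) = fst \<Psi> (src (circle_groupoid W) (basepoint W 0))" if p: "p \<in> circle_Ob W'" for p
  proof -
    let ?r = "ide (circle_groupoid W') p"
    have r: "?r \<in> circle_Ar W'" "src (circle_groupoid W') ?r = p" "snd ?r = 0"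
      by (rule circle_closed(3)[OF f' p]) (cases p; simp)+
    have "src (circle_groupoid W) (snd (circle_refine W) ?r) = fst (circle_refine W) p"
      using circle_refine_simps(1)[OF f, of ?r W'] r by simp
    then show ?thesis
      using m(5)[OF circle_refine_in(2)[OF W r(1)]] m(5)[OF basepoint_in[OF W(1), of 0]] const[OF r(1)] r(3)
      by simp
  qed
  then show ?thesis
    using const by (auto simp: pull_obj_def const_obj_def monodromy_def intro!: restrict_ext)
qed

lemma fixed_obj:
  assumes c: "c \<in> topspace (Ob LG)" and fixed: "\<And>z. act_obj z c = c"
  obtains W \<phi> where "W \<in> admissible_covers" "\<phi> \<in> hom_objects" "c = Obj.cls W (const_obj W \<phi>)"
proof -
  obtain W \<Psi> where W: "W \<in> admissible_covers" and \<Psi>: "\<Psi> \<in> groupoid_morphisms (circle_groupoid W) G"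
    and c_eq: "c = Obj.cls W \<Psi>"
    using c by (auto simp: LG_simps Obj.topspace_colim topspace_loop_Ob)
  note f = admissible_fst(1,2)[OF W]
  have inv: "\<exists>W'\<in>admissible_covers. refines W' W \<and> refines W' (shift_cover z W) \<and>
      (\<forall>b\<in>breaks W'. \<forall>c\<in>breaks W'. \<forall>x l. x \<in> ivl W' b \<longrightarrow> x \<in> ivl W' c \<longrightarrow>
        snd \<Psi> (((coarsen W b, coarsen W c), x), l) =
        snd \<Psi> (((coarsen W (b - z), coarsen W (c - z)), x - z), l))" for z
  proof -
    have "(W, \<Psi>) \<in> c"
      unfolding c_eq using W \<Psi> by (intro Obj.cls_refl) (simp_all add: topspace_loop_Ob)
    \<comment> \<open>The shift of a representative represents the same class again, so it agrees
      with \<open>\<Psi>\<close> after a refinement, which depends on \<open>z\<close>.\<close>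
    then have "(shift_cover z W, shift_obj z W \<Psi>) \<in> act_obj z c"
      unfolding act_obj_def by force
    then have "(shift_cover z W, shift_obj z W \<Psi>) \<in> Obj.cls W \<Psi>"
      using fixed c_eq by simp
    from Obj.cls_memD(3)[OF this] obtain W' where W': "W' \<in> admissible_covers" "refines W' W"
      "refines W' (shift_cover z W)" and eq: "pull_obj W W' \<Psi> = pull_obj (shift_cover z W) W' (shift_obj z W \<Psi>)"
      by blast
    have "snd \<Psi> (snd (circle_refine W) r) = snd \<Psi> (snd (circle_shift z) (snd (circle_refine (shift_cover z W)) r))"
      if r: "r \<in> circle_Ar W'" for r
      using arg_cong[OF eq, of "\<lambda>\<Psi>. snd \<Psi> r"] r circle_refine_in(2)[OF shift_admissible[OF W] W'(1,3) r]
      by (simp add: pull_obj_def shift_obj_eq)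
    then have "snd \<Psi> (((coarsen W b, coarsen W c), x), l) =
        snd \<Psi> (((coarsen W (b - z), coarsen W (c - z)), x - z), l)"
      if "b \<in> breaks W'" "c \<in> breaks W'" "x \<in> ivl W' b" "x \<in> ivl W' c" for b c x l
      using that by (force simp: topspace_circle_Ar circle_refine_def circle_shift_def coarsen_shift[OF f])
    with W' show ?thesis
      by blast
  qed
  note const = shift_invariant_constant[of W "snd \<Psi>", OF W inv]
  obtain W' where W': "W' \<in> admissible_covers" "refines W' W"
    and "\<forall>b\<in>breaks W'. \<forall>c\<in>breaks W'. \<forall>x l. x \<in> ivl W' b \<longrightarrow> x \<in> ivl W' c \<longrightarrow>
      snd \<Psi> (((coarsen W b, coarsen W c), x), l) = snd \<Psi> (((coarsen W 0, coarsen W 0), 0), l)"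
    using const(2) by blast
  then have "snd \<Psi> (snd (circle_refine W) r) = snd \<Psi> (basepoint W (snd r))" if "r \<in> circle_Ar W'" for r
    using that by (auto simp: topspace_circle_Ar circle_refine_def basepoint_def)
  then have "pull_obj W W' \<Psi> = const_obj W' (monodromy W \<Psi>)"
    by (intro pull_obj_constant W W' \<Psi>)
  moreover have "monodromy W \<Psi> \<in> hom_objects"
    using const(1) by (intro monodromy_in W \<Psi>) (simp add: basepoint_def)
  ultimately show thesis
    using that W W' cls_pull_const_obj c_eq by blast
qed

lemma fixed_arr:
  assumes c: "c \<in> topspace (Ar LG)" and fixed: "\<And>z. act_arr z c = c"
  obtains W a where "W \<in> admissible_covers" "a \<in> hom_arrows G" "c = Arr.cls W (const_arr W a)"
proof -
  obtain W \<alpha> where W: "W \<in> admissible_covers" and "\<alpha> \<in> loop_arrows G W" and "c = Arr.cls W \<alpha>"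
    using c by (auto simp: LG_simps Arr.topspace_colim topspace_loop_Ar)
  then obtain \<Psi> \<Lambda> \<Phi> where \<alpha>: "(\<Psi>, \<Lambda>, \<Phi>) \<in> loop_arrows G W" and c_eq: "c = Arr.cls W (\<Psi>, \<Lambda>, \<Phi>)"
    by (cases \<alpha>) auto
  note f = admissible_fst(1,2)[OF W]
  note L = loop_arrow[OF \<alpha>]
  \<comment> \<open>Bundling the three functions yields one refinement over which source, arrow and
    target become constant together.\<close>
  define F where "F r = (snd \<Psi> r, \<Lambda> r, snd \<Phi> r)" for r
  have inv: "\<exists>W'\<in>admissible_covers. refines W' W \<and> refines W' (shift_cover z W) \<and>
      (\<forall>b\<in>breaks W'. \<forall>c\<in>breaks W'. \<forall>x l. x \<in> ivl W' b \<longrightarrow> x \<in> ivl W' c \<longrightarrow>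
        F (((coarsen W b, coarsen W c), x), l) =
        F (((coarsen W (b - z), coarsen W (c - z)), x - z), l))" for z
  proof -
    have "(W, \<Psi>, \<Lambda>, \<Phi>) \<in> c"
      unfolding c_eq using W \<alpha> by (intro Arr.cls_refl) (simp_all add: topspace_loop_Ar)
    then have "(shift_cover z W, shift_arr z W (\<Psi>, \<Lambda>, \<Phi>)) \<in> act_arr z c"
      unfolding act_arr_def by force
    then have "(shift_cover z W, shift_arr z W (\<Psi>, \<Lambda>, \<Phi>)) \<in> Arr.cls W (\<Psi>, \<Lambda>, \<Phi>)"
      using fixed c_eq by simp
    from Arr.cls_memD(3)[OF this] obtain W' where W': "W' \<in> admissible_covers" "refines W' W"
      "refines W' (shift_cover z W)"
      and eq: "pull_arr W W' (\<Psi>, \<Lambda>, \<Phi>) = pull_arr (shift_cover z W) W' (shift_arr z W (\<Psi>, \<Lambda>, \<Phi>))"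
      by blast
    have "F (snd (circle_refine W) r) = F (snd (circle_shift z) (snd (circle_refine (shift_cover z W)) r))"
      if r: "r \<in> circle_Ar W'" for r
      using arg_cong[OF eq, of "\<lambda>(\<Psi>, \<Lambda>, \<Phi>). (snd \<Psi> r, \<Lambda> r, snd \<Phi> r)"] r
        circle_refine_in(2)[OF shift_admissible[OF W] W'(1,3) r]
      by (simp add: pull_obj_def shift_obj_eq pull_arr_simp shift_arr_eq F_def)
    then have "F (((coarsen W b, coarsen W c), x), l) =
        F (((coarsen W (b - z), coarsen W (c - z)), x - z), l)"
      if "b \<in> breaks W'" "c \<in> breaks W'" "x \<in> ivl W' b" "x \<in> ivl W' c" for b c x l
      using that by (force simp: topspace_circle_Ar circle_refine_def circle_shift_def coarsen_shift[OF f])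
    with W' show ?thesis
      by blast
  qed
  note const = shift_invariant_constant[of W F, OF W inv]
  obtain W' where W': "W' \<in> admissible_covers" "refines W' W"
    and "\<forall>b\<in>breaks W'. \<forall>c\<in>breaks W'. \<forall>x l. x \<in> ivl W' b \<longrightarrow> x \<in> ivl W' c \<longrightarrow>
      F (((coarsen W b, coarsen W c), x), l) = F (((coarsen W 0, coarsen W 0), 0), l)"
    using const(2) by blast
  then have off: "F (snd (circle_refine W) r) = F (basepoint W (snd r))" if "r \<in> circle_Ar W'" for r
    using that by (auto simp: topspace_circle_Ar circle_refine_def basepoint_def)
  have diag: "F (((coarsen W x, coarsen W x), x), l) = F (basepoint W l)" for x l
    using const(1) by (simp add: basepoint_def)
  let ?a = "(monodromy W \<Psi>, \<lambda>n. \<Lambda> (basepoint W n), monodromy W \<Phi>)"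
  have "pull_obj W W' \<Psi> = const_obj W' (monodromy W \<Psi>)" "pull_obj W W' \<Phi> = const_obj W' (monodromy W \<Phi>)"
    using off by (auto intro!: pull_obj_constant W W' L simp: F_def)
  moreover have "restrict (\<Lambda> \<circ> snd (circle_refine W)) (circle_Ar W') = (\<lambda>r\<in>circle_Ar W'. \<Lambda> (basepoint W (snd r)))"
    using off by (intro restrict_ext) (simp add: F_def)
  ultimately have pull: "pull_arr W W' (\<Psi>, \<Lambda>, \<Phi>) = const_arr W' ?a"
    by (simp add: pull_arr_simp const_arr_def)
  have mon: "monodromy W \<Psi> \<in> hom_objects" "monodromy W \<Phi> \<in> hom_objects"
    using diag by (auto intro!: monodromy_in W L simp: F_def)
  have "?a \<in> hom_arrows G"
    unfolding hom_arrows_iff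
  proof (intro conjI allI mon)
    let ?S = "circle_groupoid W"
    note b = basepoint_in[OF W]
    show "\<Lambda> (basepoint W 0) \<in> topspace (Ar G)"
      using L(4) b[of 0] by (auto simp: continuous_map_def)
    show "src G (\<Lambda> (basepoint W 0)) = fst (monodromy W \<Psi>) ()"
      using L(5)[OF b] by (simp add: monodromy_def)
    have "tgt ?S (basepoint W 0) = src ?S (basepoint W 0)"
      by (simp add: basepoint_def)
    then show "tgt G (\<Lambda> (basepoint W 0)) = fst (monodromy W \<Phi>) ()"
      using L(6)[OF b] by (simp add: monodromy_def)
    show "mul G (\<Lambda> (basepoint W 0)) (snd (monodromy W \<Phi>) n) = \<Lambda> (basepoint W n)" for n
      using L(8)[OF b[of n]] by (simp add: monodromy_def ide_src_basepoint)
    show "mul G (snd (monodromy W \<Psi>) n) (\<Lambda> (basepoint W 0)) = \<Lambda> (basepoint W n)" for n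
    proof -
      \<comment> \<open>This identity lies over the point \<open>n\<close>; invariance on the
        diagonal identifies its value with that at the base point.\<close>
      have "ide ?S (tgt ?S (basepoint W n)) = (((coarsen W (of_int n), coarsen W (of_int n)), of_int n), 0)"
        using coarsen_add_int[OF f, of 0 n] by (simp add: basepoint_def)
      then have "\<Lambda> (ide ?S (tgt ?S (basepoint W n))) = \<Lambda> (basepoint W 0)"
        using diag by (simp add: F_def)
      then show ?thesis
        using L(7)[OF b[of n]] by (simp add: monodromy_def)
    qed
  qed
  then show thesis
    using that W W' cls_pull_const_arr[OF W W' pull] c_eq by blast
qed

section \<open>Evaluation of loops\<close>

definition eval_obj :: "int \<Rightarrow> (cover \<times> ('o, 'a) loop_obj) set \<Rightarrow> 'a" where
  "eval_obj n c = (THE a. \<exists>(W, \<Psi>)\<in>c. a = snd \<Psi> (basepoint W n))"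

definition eval_arr :: "int \<Rightarrow> (cover \<times> ('o, 'a) loop_arr) set \<Rightarrow> 'a" where
  "eval_arr n c = (THE a. \<exists>(W, \<alpha>)\<in>c. a = fst (snd \<alpha>) (basepoint W n))"

lemma eval_obj_cls:
  assumes W: "W \<in> admissible_covers" and \<Psi>: "\<Psi> \<in> groupoid_morphisms (circle_groupoid W) G"
  shows "eval_obj n (Obj.cls W \<Psi>) = snd \<Psi> (basepoint W n)"
  unfolding eval_obj_def
proof (rule the_on_class)
  show "(W, \<Psi>) \<in> Obj.cls W \<Psi>"
    using assms by (intro Obj.cls_refl) (simp_all add: topspace_loop_Ob)
  fix V \<Phi> assume V: "(V, \<Phi>) \<in> Obj.cls W \<Psi>"
  obtain U where U: "V \<in> admissible_covers" "U \<in> admissible_covers" "refines U W" "refines U V"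
    "pull_obj W U \<Psi> = pull_obj V U \<Phi>"
    using Obj.cls_memD[OF V] by blast
  show "snd \<Phi> (basepoint V n) = snd \<Psi> (basepoint W n)"
    using arg_cong[OF U(5), of "\<lambda>\<Psi>. snd \<Psi> (basepoint U n)"] U W
    by (simp add: pull_obj_def basepoint_in refine_basepoint)
qed

lemma eval_arr_cls:
  assumes W: "W \<in> admissible_covers" and \<alpha>: "\<alpha> \<in> loop_arrows G W"
  shows "eval_arr n (Arr.cls W \<alpha>) = fst (snd \<alpha>) (basepoint W n)"
  unfolding eval_arr_def
proof (rule the_on_class)
  show "(W, \<alpha>) \<in> Arr.cls W \<alpha>"
    using assms by (intro Arr.cls_refl) (simp_all add: topspace_loop_Ar)
  fix V \<beta> assume V: "(V, \<beta>) \<in> Arr.cls W \<alpha>"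
  obtain U where U: "V \<in> admissible_covers" "U \<in> admissible_covers" "refines U W" "refines U V"
    "pull_arr W U \<alpha> = pull_arr V U \<beta>"
    using Arr.cls_memD[OF V] by blast
  show "fst (snd \<beta>) (basepoint V n) = fst (snd \<alpha>) (basepoint W n)"
    using arg_cong[OF U(5), of "\<lambda>\<alpha>. fst (snd \<alpha>) (basepoint U n)"] U W
    by (cases \<alpha>; cases \<beta>) (simp add: pull_arr_simp basepoint_in refine_basepoint)
qed

lemma continuous_map_eval_obj: "continuous_map (Ob LG) (Ar G) (eval_obj n)"
  unfolding LG_simps
proof (rule Obj.continuous_map_from_colim)
  fix W assume W: "W \<in> admissible_covers"
  have "continuous_map (Ob (loop_groupoid_at G W)) (compact_open_topology (Ar (circle_groupoid W)) (Ar G)) snd"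
    by (simp add: loop_groupoid_at_def Let_def continuous_map_subtopology_snd)
  from continuous_map_compose[OF this continuous_map_eval[OF basepoint_in[OF W]]]
  show "continuous_map (Ob (loop_groupoid_at G W)) (Ar G) (\<lambda>\<Psi>. eval_obj n (Obj.cls W \<Psi>))"
    by (rule continuous_map_eq) (simp add: topspace_loop_Ob eval_obj_cls[OF W])
qed

text \<open>The topology on arrows records only \<open>snd \<Psi>\<close> and the values of
  \<open>\<Lambda>\<close> on identities. The value of \<open>\<Lambda>\<close> in degree
  \<open>n\<close> is therefore rewritten as the value of \<open>snd \<Psi>\<close> there times
  \<open>\<Lambda>\<close> at the identity of the target.\<close>

lemma continuous_map_eval_arr: "continuous_map (Ar LG) (Ar G) (eval_arr n)"
  unfolding LG_simps
proof (rule Arr.continuous_map_from_colim)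
  fix W assume W: "W \<in> admissible_covers"
  let ?S = "circle_groupoid W" and ?b = "basepoint W n"
  note f = admissible_fst(1,2)[OF W]
  have t: "tgt ?S ?b \<in> circle_Ob W"
    by (rule circle_closed(2)[OF f basepoint_in[OF W]])
  have 1: "continuous_map (Ar (loop_groupoid_at G W)) (Ar G) (\<lambda>\<alpha>. snd (fst \<alpha>) ?b)"
  proof -
    have "continuous_map (Ar (loop_groupoid_at G W)) (Ar G)
      (((\<lambda>h. h ?b) \<circ> fst) \<circ> (\<lambda>(\<Psi>, \<Lambda>, \<Phi>). (snd \<Psi>, restrict (\<Lambda> \<circ> ide ?S) (topspace (Ob ?S)))))"
      unfolding loop_groupoid_at_def Let_def top_groupoid.select_convs
      by (intro continuous_map_pullback continuous_map_compose[OF continuous_map_fst continuous_map_eval]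
          basepoint_in W)
    then show ?thesis
      by (simp add: comp_def case_prod_unfold)
  qed
  have 2: "continuous_map (Ar (loop_groupoid_at G W)) (Ar G) (\<lambda>\<alpha>. fst (snd \<alpha>) (ide ?S (tgt ?S ?b)))"
  proof -
    have "continuous_map (Ar (loop_groupoid_at G W)) (Ar G)
      (((\<lambda>h. h (tgt ?S ?b)) \<circ> snd) \<circ> (\<lambda>(\<Psi>, \<Lambda>, \<Phi>). (snd \<Psi>, restrict (\<Lambda> \<circ> ide ?S) (topspace (Ob ?S)))))"
      unfolding loop_groupoid_at_def Let_def top_groupoid.select_convs
      by (intro continuous_map_pullback continuous_map_compose[OF continuous_map_snd continuous_map_eval] t)
    then show ?thesis
      using t by (simp add: comp_def case_prod_unfold)
  qed
  have "continuous_map (Ar (loop_groupoid_at G W)) (Ar G)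
      (\<lambda>\<alpha>. mul G (snd (fst \<alpha>) ?b) (fst (snd \<alpha>) (ide ?S (tgt ?S ?b))))"
  proof (rule continuous_map_mul[OF 1 2])
    fix \<alpha> assume "\<alpha> \<in> topspace (Ar (loop_groupoid_at G W))"
    then obtain \<Psi> \<Lambda> \<Phi> where a: "\<alpha> = (\<Psi>, \<Lambda>, \<Phi>)" "(\<Psi>, \<Lambda>, \<Phi>) \<in> loop_arrows G W"
      by (cases \<alpha>) (auto simp: topspace_loop_Ar)
    note L = loop_arrow[OF a(2)]
    have "groupoid_morphism ?S G \<Psi>"
      using L(1) by (simp add: groupoid_morphisms_def)
    note m = groupoid_morphismD[OF this]
    have "src ?S (ide ?S (tgt ?S ?b)) = tgt ?S ?b"
      by (simp add: basepoint_def)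
    then show "tgt G (snd (fst \<alpha>) ?b) = src G (fst (snd \<alpha>) (ide ?S (tgt ?S ?b)))"
      using L(5)[OF circle_closed(3)[OF f t]] m(6)[OF basepoint_in[OF W]] by (simp add: a)
  qed
  then show "continuous_map (Ar (loop_groupoid_at G W)) (Ar G) (\<lambda>\<alpha>. eval_arr n (Arr.cls W \<alpha>))"
  proof (rule continuous_map_eq)
    fix \<alpha> assume "\<alpha> \<in> topspace (Ar (loop_groupoid_at G W))"
    then obtain \<Psi> \<Lambda> \<Phi> where a: "\<alpha> = (\<Psi>, \<Lambda>, \<Phi>)" "(\<Psi>, \<Lambda>, \<Phi>) \<in> loop_arrows G W"
      by (cases \<alpha>) (auto simp: topspace_loop_Ar)
    show "mul G (snd (fst \<alpha>) ?b) (fst (snd \<alpha>) (ide ?S (tgt ?S ?b))) = eval_arr n (Arr.cls W \<alpha>)"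
      using loop_arrow(7)[OF a(2) basepoint_in[OF W]] by (simp add: a eval_arr_cls[OF W])
  qed
qed

section \<open>The isomorphism\<close>

text \<open>By \<open>cls_const_obj\<close> every admissible cover gives the same class; one is
  fixed in order to have a function that factors through a single stage of the colimit.\<close>

definition loop_of :: "('o, 'a) hom_obj \<Rightarrow> (cover \<times> ('o, 'a) loop_obj) set" where
  "loop_of \<phi> = Obj.cls one_point_cover (const_obj one_point_cover \<phi>)"

definition loop_arr_of :: "('o, 'a) hom_arr \<Rightarrow> (cover \<times> ('o, 'a) loop_arr) set" where
  "loop_arr_of a = Arr.cls one_point_cover (const_arr one_point_cover a)"

text \<open>\<open>eval_obj\<close> reads off arrow values, so the base object is taken to be the
  source of the value at \<open>0\<close>.\<close>

definition holonomy :: "(cover \<times> ('o, 'a) loop_obj) set \<Rightarrow> ('o, 'a) hom_obj" where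
  "holonomy c = (\<lambda>_. src G (eval_obj 0 c), \<lambda>n. eval_obj n c)"

definition holonomy_arr :: "(cover \<times> ('o, 'a) loop_arr) set \<Rightarrow> ('o, 'a) hom_arr" where
  "holonomy_arr c = (holonomy (src LG c), \<lambda>n. eval_arr n c, holonomy (tgt LG c))"

abbreviation "Fix \<equiv> fixed_loop_groupoid G"

lemma Fix_simps [simp]:
  "src Fix = src LG" "tgt Fix = tgt LG" "ide Fix = ide LG" "ginv Fix = ginv LG" "mul Fix = mul LG"
  "Ob Fix = subtopology (Ob LG) {c. \<forall>z. act_obj z c = c}"
  "Ar Fix = subtopology (Ar LG) {c. \<forall>z. act_arr z c = c}"
  by (simp_all add: fixed_loop_groupoid_def restrict_groupoid_def)

lemma loop_of_in:
  assumes "\<phi> \<in> hom_objects"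
  shows "loop_of \<phi> \<in> topspace (Ob Fix)"
proof -
  have "loop_of \<phi> \<in> topspace Obj.colim"
    unfolding loop_of_def Obj.topspace_colim topspace_loop_Ob
    using const_obj_in[OF one_point_cover_admissible assms] one_point_cover_admissible by blast
  then show ?thesis
    by (simp add: LG_simps loop_of_def act_obj_const[OF one_point_cover_admissible])
qed

lemma loop_arr_of_in:
  assumes "a \<in> hom_arrows G"
  shows "loop_arr_of a \<in> topspace (Ar Fix)"
proof -
  have "loop_arr_of a \<in> topspace Arr.colim"
    unfolding loop_arr_of_def Arr.topspace_colim topspace_loop_Ar
    using const_arr_in[OF one_point_cover_admissible assms] one_point_cover_admissible by blast
  then show ?thesis
    by (simp add: LG_simps loop_arr_of_def act_arr_const[OF one_point_cover_admissible])
qed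

lemma Fix_Ob: "topspace (Ob Fix) = loop_of ` hom_objects"
proof (intro equalityI subsetI)
  fix c assume "c \<in> topspace (Ob Fix)"
  then have "c \<in> topspace (Ob LG)" "\<And>z. act_obj z c = c"
    by auto
  then obtain W \<phi> where "W \<in> admissible_covers" "\<phi> \<in> hom_objects" "c = Obj.cls W (const_obj W \<phi>)"
    by (rule fixed_obj)
  then show "c \<in> loop_of ` hom_objects"
    using cls_const_obj[OF _ one_point_cover_admissible] by (auto simp: loop_of_def)
qed (use loop_of_in in blast)

lemma Fix_Ar: "topspace (Ar Fix) = loop_arr_of ` hom_arrows G"
proof (intro equalityI subsetI)
  fix c assume "c \<in> topspace (Ar Fix)"
  then have "c \<in> topspace (Ar LG)" "\<And>z. act_arr z c = c"
    by auto
  then obtain W a where "W \<in> admissible_covers" "a \<in> hom_arrows G" "c = Arr.cls W (const_arr W a)"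
    by (rule fixed_arr)
  then show "c \<in> loop_arr_of ` hom_arrows G"
    using cls_const_arr[OF _ one_point_cover_admissible] by (auto simp: loop_arr_of_def)
qed (use loop_arr_of_in in blast)

text \<open>All constant loops are represented over the same cover, so arrows composable in
  \<open>Hom\<close> have representatives composable there, and the formulas over that cover
  suffice.\<close>

lemma loop_structure:
  assumes a: "a \<in> hom_arrows G"
  shows "src LG (loop_arr_of a) = loop_of (src Hom a)" "tgt LG (loop_arr_of a) = loop_of (tgt Hom a)"
    "ginv LG (loop_arr_of a) = loop_arr_of (ginv Hom a)"
    "\<phi> \<in> hom_objects \<Longrightarrow> ide LG (loop_of \<phi>) = loop_arr_of (ide Hom \<phi>)"
    "\<lbrakk>b \<in> hom_arrows G; tgt Hom a = src Hom b\<rbrakk> \<Longrightarrow>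
      mul LG (loop_arr_of a) (loop_arr_of b) = loop_arr_of (mul Hom a b)"
proof -
  let ?W = one_point_cover
  note W = one_point_cover_admissible
  have s: "const_obj ?W (src Hom a) \<in> groupoid_morphisms (circle_groupoid ?W) G"
    using Hom_arrow[OF a] const_obj_in[OF W] by blast
  note str = LG_structure[OF W const_arr_in[OF W a], unfolded const_structure[OF W]]
  show "src LG (loop_arr_of a) = loop_of (src Hom a)" "tgt LG (loop_arr_of a) = loop_of (tgt Hom a)"
    "ginv LG (loop_arr_of a) = loop_arr_of (ginv Hom a)"
    unfolding loop_of_def loop_arr_of_def using str(1,2,4)[OF s] .
  show "ide LG (loop_of \<phi>) = loop_arr_of (ide Hom \<phi>)" if "\<phi> \<in> hom_objects"
    unfolding loop_of_def loop_arr_of_def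
    using str(3)[OF const_obj_in[OF W that]] by (simp only: const_structure[OF W])
  show "mul LG (loop_arr_of a) (loop_arr_of b) = loop_arr_of (mul Hom a b)"
    if "b \<in> hom_arrows G" "tgt Hom a = src Hom b"
    unfolding loop_arr_of_def
    using LG_mul[OF W const_arr_in[OF W a] const_arr_in[OF W that(1)]] that(2)
    by (simp only: const_structure[OF W])
qed

lemma holonomy_loop_of:
  assumes "\<phi> \<in> hom_objects"
  shows "holonomy (loop_of \<phi>) = \<phi>"
proof -
  note W = one_point_cover_admissible
  have "eval_obj n (loop_of \<phi>) = snd \<phi> n" for n
    unfolding loop_of_def eval_obj_cls[OF W const_obj_in[OF W assms]]
    by (simp add: const_obj_def basepoint_in[OF W])
  then show ?thesis
    using assms by (intro hom_object_eqI) (simp_all add: holonomy_def hom_object)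
qed

lemma holonomy_arr_loop_arr_of:
  assumes a: "a \<in> hom_arrows G"
  shows "holonomy_arr (loop_arr_of a) = a"
proof -
  note W = one_point_cover_admissible
  have "eval_arr n (loop_arr_of a) = fst (snd a) n" for n
    unfolding loop_arr_of_def eval_arr_cls[OF W const_arr_in[OF W assms]]
    by (cases a) (simp add: const_arr_def basepoint_in[OF W])
  then have "holonomy_arr (loop_arr_of a) = (src Hom a, fst (snd a), tgt Hom a)"
    by (simp add: holonomy_arr_def loop_structure[OF a] holonomy_loop_of Hom_arrow[OF a])
  then show ?thesis
    by (cases a) simp
qed

lemma continuous_map_loop_of: "continuous_map (Ob Hom) (Ob Fix) loop_of"
proof -
  let ?W = one_point_cover
  let ?S = "circle_groupoid ?W"
  note W = one_point_cover_admissible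
  have "continuous_map (Ob Hom) (compact_open_topology (Ob ?S) (Ob G)) (\<lambda>\<phi>. \<lambda>p\<in>circle_Ob ?W. fst \<phi> ())"
    \<comment> \<open>On objects a constant loop does not depend on the point: this is the case of
      the constant map to \<open>unit\<close>.\<close>
    by (rule continuous_map_into_compact_open_discrete[of _ "\<lambda>_. ()" _ _ fst]) (simp_all add: continuous_map_Hom_base)
  moreover have "continuous_map (Ob Hom) (compact_open_topology (Ar ?S) (Ar G)) (\<lambda>\<phi>. \<lambda>r\<in>circle_Ar ?W. snd \<phi> (snd r))"
    by (rule continuous_map_into_compact_open_discrete[OF continuous_circle_degree continuous_map_Hom_Ob])
  ultimately have "continuous_map (Ob Hom) (Ob (loop_groupoid_at G ?W)) (const_obj ?W)"
    using const_obj_in[OF W]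
    by (simp add: loop_groupoid_at_def Let_def continuous_map_in_subtopology const_obj_def[abs_def] continuous_map_pairedI
        Pi_iff image_subset_iff)
  from continuous_map_compose[OF this Obj.continuous_map_cls[OF W]]
  have "continuous_map (Ob Hom) (Ob LG) loop_of"
    by (simp add: LG_simps comp_def loop_of_def[abs_def])
  then show ?thesis
    using loop_of_in by (auto simp: continuous_map_in_subtopology)
qed

lemma continuous_map_loop_arr_of: "continuous_map (Ar Hom) (Ar Fix) loop_arr_of"
proof -
  let ?W = one_point_cover
  let ?S = "circle_groupoid ?W"
  note W = one_point_cover_admissible
  note f = admissible_fst(1,2)[OF W]
  let ?h = "\<lambda>(\<Psi>, \<Lambda>, \<Phi>). (snd \<Psi>, restrict (\<Lambda> \<circ> ide ?S) (circle_Ob ?W))"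
  have "continuous_map (Ar Hom) (compact_open_topology (Ar ?S) (Ar G)) (\<lambda>a. \<lambda>r\<in>circle_Ar ?W. snd (src Hom a) (snd r))"
    by (rule continuous_map_into_compact_open_discrete[OF continuous_circle_degree continuous_map_Hom_src])
  moreover have "continuous_map (Ar Hom) (compact_open_topology (Ob ?S) (Ar G)) (\<lambda>a. \<lambda>p\<in>circle_Ob ?W. fst (snd a) 0)"
    by (rule continuous_map_into_compact_open_discrete[of _ "\<lambda>_. ()" _ _ "\<lambda>a _. fst (snd a) 0"])
      (simp_all add: continuous_map_Hom_Ar)
  ultimately have "continuous_map (Ar Hom)
      (prod_topology (compact_open_topology (Ar ?S) (Ar G)) (compact_open_topology (Ob ?S) (Ar G)))
      (\<lambda>a. (\<lambda>r\<in>circle_Ar ?W. snd (src Hom a) (snd r), \<lambda>p\<in>circle_Ob ?W. fst (snd a) 0))"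
    by (rule continuous_map_pairedI)
  \<comment> \<open>Identities have degree 0, so the arrow topology sees an arrow between constant
    loops through its source and its value at \<open>0\<close>.\<close>
  moreover have "(\<lambda>r\<in>circle_Ar ?W. snd (src Hom a) (snd r), \<lambda>p\<in>circle_Ob ?W. fst (snd a) 0) =
      (?h \<circ> const_arr ?W) a" for a
  proof -
    have "snd (ide ?S p) = 0" for p
      by (cases p) simp
    then have "restrict ((\<lambda>r\<in>circle_Ar ?W. fst (snd a) (snd r)) \<circ> ide ?S) (circle_Ob ?W) = (\<lambda>p\<in>circle_Ob ?W. fst (snd a) 0)"
      by (intro restrict_ext) (simp add: circle_closed(3)[OF f])
    then show ?thesis
      by (cases a) (simp add: const_arr_def const_obj_def)
  qed
  ultimately have "continuous_map (Ar Hom)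
      (prod_topology (compact_open_topology (Ar ?S) (Ar G)) (compact_open_topology (Ob ?S) (Ar G)))
      (?h \<circ> const_arr ?W)"
    by (rule continuous_map_eq)
  then have "continuous_map (Ar Hom) (Ar (loop_groupoid_at G ?W)) (const_arr ?W)"
    unfolding loop_groupoid_at_def Let_def top_groupoid.select_convs
    by (rule continuous_map_pullback') (auto intro: const_arr_in[OF W])
  from continuous_map_compose[OF this Arr.continuous_map_cls[OF W]]
  have "continuous_map (Ar Hom) (Ar LG) loop_arr_of"
    by (simp add: LG_simps comp_def loop_arr_of_def[abs_def])
  then show ?thesis
    using loop_arr_of_in by (auto simp: continuous_map_in_subtopology)
qed

text \<open>The transport lemmas need the topological groupoid as domain, hence the direction out of
  \<open>Hom\<close>. As \<open>loop_of\<close> is onto the fixed objects by \<open>Fix_Ob\<close>,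
  the one-sided identity \<open>holonomy_loop_of\<close> already makes the two maps mutually
  inverse; arrows are treated in the same way.\<close>

lemma groupoid_iso_Hom_Fix: "groupoid_iso Hom Fix (loop_of, loop_arr_of)"
proof -
  have "homeomorphic_maps (Ob Hom) (Ob Fix) loop_of holonomy"
    unfolding homeomorphic_maps_def
  proof (intro conjI continuous_map_loop_of)
    show "continuous_map (Ob Fix) (Ob Hom) holonomy"
    proof (rule continuous_map_into_Hom_Ob)
      show "continuous_map (Ob Fix) (Ar G) (\<lambda>c. snd (holonomy c) n)" for n
        by (simp add: holonomy_def continuous_map_from_subtopology continuous_map_eval_obj)
    qed (unfold Fix_Ob, auto simp: holonomy_loop_of)
  qed (unfold Fix_Ob, auto simp: holonomy_loop_of)
  moreover have "homeomorphic_maps (Ar Hom) (Ar Fix) loop_arr_of holonomy_arr"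
    unfolding homeomorphic_maps_def
  proof (intro conjI continuous_map_loop_arr_of)
    show "continuous_map (Ar Fix) (Ar Hom) holonomy_arr"
    proof (rule continuous_map_into_Hom_Ar)
      show "continuous_map (Ar Fix) (Ar G) (\<lambda>c. fst (snd (holonomy_arr c)) n)" for n
        by (simp add: holonomy_arr_def continuous_map_from_subtopology continuous_map_eval_arr)
    qed (unfold Fix_Ar, auto simp: holonomy_arr_loop_arr_of)
  qed (unfold Fix_Ar, auto simp: holonomy_arr_loop_arr_of)
  moreover have "groupoid_morphism Hom Fix (loop_of, loop_arr_of)"
  proof (rule groupoid_morphismI[OF continuous_map_loop_of continuous_map_loop_arr_of])
    show "loop_arr_of (ide Hom \<phi>) = ide Fix (loop_of \<phi>)" if "\<phi> \<in> topspace (Ob Hom)" for \<phi>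
      using loop_structure(4)[of "ide Hom \<phi>" \<phi>] that by (simp add: ide_in_hom_arrows)
  qed (simp_all only: Fix_simps topspace_Hom loop_structure)
  ultimately show ?thesis
    by (auto simp: groupoid_iso_def dest: homeomorphic_maps_imp_map)
qed

end

theorem theorem3p6p4:
  fixes G :: "('o, 'a) top_groupoid" and A0 :: "'o chart set" and A1 :: "'a chart set"
  assumes "orbifold_groupoid G A0 A1"
  shows "Morita_equivalent (fixed_loop_groupoid G) (integer_hom_groupoid G)"
proof -
  have top: "topological_groupoid G" and loc: "local_diffeomorphism (Ar G) A1 (Ob G) A0 (src G)"
    using assms by (auto simp: orbifold_groupoid_def smooth_groupoid_def etale_groupoid_def)
  interpret groupoid_space G
    by unfold_locales (rule top)
  \<comment> \<open>The local inverses of the local diffeomorphism \<open>src G\<close> are the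
    sections through prescribed arrows that \<open>open_src_Hom\<close> asks for.\<close>
  have "open_map (Ar Hom) (Ob Hom) (src Hom)"
    by (rule open_src_Hom) (meson local_diffeomorphism_local_section[OF loc])
  with topological_groupoid_Hom groupoid_iso_Hom_Fix show ?thesis
    by (rule Morita_equivalent_iso)
qed

end
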